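(* Let $P_{S_eS}$ be the joint distribution of side information and state, let $P_{YZ|XS}$ be the channel, and let $d$ be the distortion measure. For $D\ge0$, the common-randomness-assisted distribution-preserving capacity-distortion region with a deterministic encoder, causal channel side information at the encoder, and the strict reconstruction constraint $P_{S_e^n\hat S^n}=\prod_{i=1}^nP_{S_eS}$ equals $$C(D,0)=\left\{(R,R_c)\in\mathbb{R}^2:\ R\ge0,\ R_c\ge0,\ \exists\,P_{S_eSUXYZ\hat S}\in\mathcal{P}_{DE}'\text{ such that } R\le I(U;Y),\ R+R_c\ge I(U;\hat S,S_e),\ D\ge\mathbb{E}[d(S,\hat S)]\right\}.$$
   Context: All alphabets $\mathcal{S}_e,\mathcal{S}=\hat{\mathcal{S}},\mathcal{X},\mathcal{Y},\mathcal{Z}$ are finite. Given are a distribution $P_{S_eS}$, a channel $P_{YZ|XS}$, and a distortion measure $d:\mathcal{S}\times\hat{\mathcal{S}}\to[0,\infty)$ with $d(s^n,\hat s^n)=\frac1n\sum_{i=1}^nd(s_i,\hat s_i)$. The pairs $(S_{e,i},S_i)$ are i.i.d. $\sim P_{S_eS}$, and the channel is memoryless: given $X^n,S^n$, the pair $(Y^n,Z^n)$ has law $\prod_iP_{YZ|XS}$. $Y^n$ is the receiver's output, and $Z^n$ is feedback to the state estimator at the sender. An $(n,R,R_c)$ common-randomness-assisted code with a deterministic encoder and causal side information consists of: a message $M$ uniform on $\mathcal{M}=[1:2^{nR}]$; common randomness $\Gamma$ uniform on $[1:2^{nR_c}]$ ($M$, $\Gamma$, $(S_e^n,S^n)$ independent);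 deterministic encoding functions with $X_i=f_i(M,\Gamma,S_{e,1},\dots,S_{e,i})$ for $i=1,\dots,n$; a decoder mapping $(Y^n,\Gamma)$ to $\hat M\in\mathcal{M}$; and a (possibly stochastic) state estimator mapping $(\Gamma,X^n,S_e^n,Z^n)$ to $\hat S^n\in\hat{\mathcal{S}}^n$. $(R,R_c)$ is achievable at distortion $D$ under the strict constraint if for every $\epsilon>0$ and all sufficiently large $n$ there is such a code with $\Pr\{M\neq\hat M\}\le\epsilon$, $\mathbb{E}[d(S^n,\hat S^n)]\le D$ and $P_{S_e^n\hat S^n}=\prod_{i=1}^nP_{S_eS}$ (i.e. $(S_{e,i},\hat S_i)$ are i.i.d. with the law of $(S_e,S)$). The capacity-distortion region at $D$ is the set of $(R,R_c)$ such that $(R,R_c,D)$ lies in the closure of the set of $(R',R_c',D')$ for which $(R',R_c')$ is achievable at distortion $D'$ under the strict constraint. $\widetilde{\mathcal{P}}(U,X,\hat S)$ is the set of joint distributions (with $U$ an auxiliary variable on some finite alphabet) of the form $$P_{S_eS}(s_e,s)\,P_U(u)\,\mathbb{I}\{x=x(u,s_e)\}\,P_{YZ|XS}(y,z|x,s)\,P_{\hat S|XS_eZ}(\hat s|x,s_e,z)$$ for some function $(u,s_e)\mapsto x(u,s_e)\in\mathcal{X}$, and $\mathcal{P}_{DE}'$ is the subset of those with $P_{S_e\hat S}=P_{S_eS}$. *)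

theory Defs
  imports "HOL-Probability.Probability"
begin

text \<open>
  A sequence of length \<open>n\<close> is an extensional function on \<open>{..<n}\<close> (value \<open>undefined\<close>
  elsewhere), so that position \<open>i\<close> of the usual 1-based notation is index \<open>i - 1\<close>.
\<close>

abbreviation seqs :: "nat \<Rightarrow> (nat \<Rightarrow> 'a) set" where
  "seqs n \<equiv> {..<n} \<rightarrow>\<^sub>E UNIV"

abbreviation prod_law :: "nat \<Rightarrow> (nat \<Rightarrow> 'a pmf) \<Rightarrow> (nat \<Rightarrow> 'a) pmf" where
  "prod_law n p \<equiv> Pi_pmf {..<n} undefined p"

text \<open>The index set \<open>[1 : 2\<^bsup>nR\<^esup>]\<close>, rounding down; it is nonempty for \<open>R \<ge> 0\<close>.\<close>

definition index_set :: "nat \<Rightarrow> real \<Rightarrow> nat set" where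
  "index_set n R = {1..nat \<lfloor>2 powr (real n * R)\<rfloor>}"

text \<open>
  The encoding function at time \<open>i\<close> receives the side information truncated to the
  indices \<open>{..i}\<close>; this is where causality is enforced.
\<close>

definition encode ::
  "nat \<Rightarrow> (nat \<Rightarrow> nat \<Rightarrow> nat \<Rightarrow> (nat \<Rightarrow> 'se) \<Rightarrow> 'x) \<Rightarrow> nat \<Rightarrow> nat \<Rightarrow> (nat \<Rightarrow> 'se) \<Rightarrow> nat \<Rightarrow> 'x" where
  "encode n f m g se = (\<lambda>i\<in>{..<n}. f i m g (restrict se {..i}))"

text \<open>
  Conditions on an \<open>(n, R, R\<^sub>c)\<close> code beyond what the types express.  The encoder needs
  none: it is unconstrained apart from causality.
\<close>

definition is_code ::
  "nat \<Rightarrow> real \<Rightarrow> real \<Rightarrow> ((nat \<Rightarrow> 'y) \<Rightarrow> nat \<Rightarrow> nat)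
    \<Rightarrow> (nat \<Rightarrow> (nat \<Rightarrow> 'x) \<Rightarrow> (nat \<Rightarrow> 'se) \<Rightarrow> (nat \<Rightarrow> 'z) \<Rightarrow> (nat \<Rightarrow> 's) pmf) \<Rightarrow> bool" where
  "is_code n R Rc dec est \<longleftrightarrow>
     0 \<le> R \<and> 0 \<le> Rc \<and>
     (\<forall>y\<in>seqs n. \<forall>g\<in>index_set n Rc. dec y g \<in> index_set n R) \<and>
     (\<forall>g\<in>index_set n Rc. \<forall>x\<in>seqs n. \<forall>se\<in>seqs n. \<forall>z\<in>seqs n.
        set_pmf (est g x se z) \<subseteq> seqs n)"

text \<open>
  Joint law of \<open>(M, M_hat, S\<^sub>e\<^sup>n, S\<^sup>n, S_hat\<^sup>n)\<close> induced by a code.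
\<close>

definition code_law ::
  "('se \<times> 's) pmf \<Rightarrow> ('x \<Rightarrow> 's \<Rightarrow> ('y \<times> 'z) pmf) \<Rightarrow> nat \<Rightarrow> real \<Rightarrow> real
    \<Rightarrow> (nat \<Rightarrow> nat \<Rightarrow> nat \<Rightarrow> (nat \<Rightarrow> 'se) \<Rightarrow> 'x)
    \<Rightarrow> ((nat \<Rightarrow> 'y) \<Rightarrow> nat \<Rightarrow> nat)
    \<Rightarrow> (nat \<Rightarrow> (nat \<Rightarrow> 'x) \<Rightarrow> (nat \<Rightarrow> 'se) \<Rightarrow> (nat \<Rightarrow> 'z) \<Rightarrow> (nat \<Rightarrow> 's) pmf)
    \<Rightarrow> (nat \<times> nat \<times> (nat \<Rightarrow> 'se) \<times> (nat \<Rightarrow> 's) \<times> (nat \<Rightarrow> 's)) pmf" where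
  "code_law P W n R Rc f dec est = do {
     m \<leftarrow> pmf_of_set (index_set n R);
     g \<leftarrow> pmf_of_set (index_set n Rc);
     ses \<leftarrow> prod_law n (\<lambda>_. P);
     let se = (\<lambda>i\<in>{..<n}. fst (ses i));
     let s = (\<lambda>i\<in>{..<n}. snd (ses i));
     let x = encode n f m g se;
     yz \<leftarrow> prod_law n (\<lambda>i. W (x i) (s i));
     let y = (\<lambda>i\<in>{..<n}. fst (yz i));
     let z = (\<lambda>i\<in>{..<n}. snd (yz i));
     sh \<leftarrow> est g x se z;
     return_pmf (m, dec y g, se, s, sh)
   }"

definition achievable ::
  "('se \<times> 's) pmf \<Rightarrow> ('x \<Rightarrow> 's \<Rightarrow> ('y \<times> 'z) pmf) \<Rightarrow> ('s \<Rightarrow> 's \<Rightarrow> real)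
    \<Rightarrow> real \<Rightarrow> real \<Rightarrow> real \<Rightarrow> bool" where
  "achievable P W d R Rc D \<longleftrightarrow>
     (\<forall>\<epsilon>>0. \<forall>\<^sub>F n in sequentially. \<exists>f dec est.
        is_code n R Rc dec est \<and>
        (let J = code_law P W n R Rc f dec est in
           measure_pmf.prob J {(m, mh, se, s, sh). m \<noteq> mh} \<le> \<epsilon> \<and>
           measure_pmf.expectation J (\<lambda>(m, mh, se, s, sh). (\<Sum>i<n. d (s i) (sh i)) / real n) \<le> D \<and>
           map_pmf (\<lambda>(m, mh, se, s, sh). \<lambda>i\<in>{..<n}. (se i, sh i)) J = prod_law n (\<lambda>_. P)))"

definition capacity_distortion_region ::
  "('se \<times> 's) pmf \<Rightarrow> ('x \<Rightarrow> 's \<Rightarrow> ('y \<times> 'z) pmf) \<Rightarrow> ('s \<Rightarrow> 's \<Rightarrow> real)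
    \<Rightarrow> real \<Rightarrow> (real \<times> real) set" where
  "capacity_distortion_region P W d D =
     {(R, Rc). (R, Rc, D) \<in> closure {(R', Rc', D'). achievable P W d R' Rc' D'}}"

text \<open>
  Joint law of \<open>(S\<^sub>e, S, U, X, Y, Z, S_hat)\<close>.  A finite alphabet for \<open>U\<close> is represented by a
  finitely supported law on \<open>nat\<close>, into which every finite alphabet embeds.
\<close>

definition single_letter_law ::
  "('se \<times> 's) pmf \<Rightarrow> ('x \<Rightarrow> 's \<Rightarrow> ('y \<times> 'z) pmf) \<Rightarrow> nat pmf \<Rightarrow> (nat \<Rightarrow> 'se \<Rightarrow> 'x)
    \<Rightarrow> ('x \<Rightarrow> 'se \<Rightarrow> 'z \<Rightarrow> 's pmf) \<Rightarrow> ('se \<times> 's \<times> nat \<times> 'x \<times> 'y \<times> 'z \<times> 's) pmf" where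
  "single_letter_law P W PU xf V = do {
     (se, s) \<leftarrow> P;
     u \<leftarrow> PU;
     let x = xf u se;
     (y, z) \<leftarrow> W x s;
     sh \<leftarrow> V x se z;
     return_pmf (se, s, u, x, y, z, sh)
   }"

definition P_tilde ::
  "('se \<times> 's) pmf \<Rightarrow> ('x \<Rightarrow> 's \<Rightarrow> ('y \<times> 'z) pmf)
    \<Rightarrow> ('se \<times> 's \<times> nat \<times> 'x \<times> 'y \<times> 'z \<times> 's) pmf set" where
  "P_tilde P W = {single_letter_law P W PU xf V | PU xf V. finite (set_pmf PU)}"

definition P_DE' ::
  "('se \<times> 's) pmf \<Rightarrow> ('x \<Rightarrow> 's \<Rightarrow> ('y \<times> 'z) pmf)
    \<Rightarrow> ('se \<times> 's \<times> nat \<times> 'x \<times> 'y \<times> 'z \<times> 's) pmf set" where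
  "P_DE' P W = {J \<in> P_tilde P W. map_pmf (\<lambda>(se, s, u, x, y, z, sh). (se, sh)) J = P}"

text \<open>Mutual information \<open>I(A; B)\<close> in bits for discrete random variables \<open>A\<close>, \<open>B\<close>.\<close>

definition mutual_info :: "'w pmf \<Rightarrow> ('w \<Rightarrow> 'a) \<Rightarrow> ('w \<Rightarrow> 'b) \<Rightarrow> real" where
  "mutual_info J A B =
     prob_space.mutual_information (measure_pmf J) 2 (count_space UNIV) (count_space UNIV) A B"

end

theory Submission
  imports Defs
begin

text \<open>
  Achievability: codewords drawn i.i.d. from \<open>P\<^sub>U\<close> are indexed by message and common randomness. For each value of
  the common randomness a threshold decoder succeeds if \<open>R < I(U; Y)\<close>. If \<open>R + R\<^sub>c > I(U; S_hat, S\<^sub>e)\<close>, soft covering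
  makes the law of side information and memoryless reconstruction close to i.i.d. in total variation; since
  the estimator knows the side information, a maximal coupling corrects this law to be exactly i.i.d., changing
  the reconstruction, hence the distortion, only with small probability. The random codebook has the right
  error, variation and distortion on average, so one codebook is good for all three.

  Converse: as auxiliary variable at a uniformly random time take the strategy mapping current side information to
  current input. Fano's inequality bounds the message rate by \<open>I(U; Y)\<close>, and \<open>H(M, \<Gamma>) \<ge> I(M, \<Gamma>; S_hat\<^sup>n, S\<^sub>e\<^sup>n)\<close>
  bounds the total rate, because the reconstruction is exactly i.i.d. All entropy inequalities are instances of Gibbs'
  inequality \<open>H(X | Y) \<le> E[- log q(X | Y)]\<close>. The strategies form a finite set, so the single-letter laws are compact and
  the bounds pass to the closure.
\<close>

section \<open>Entropy and mutual information of finitely supported laws\<close>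

text \<open>The strict constraint is the obstacle: soft covering only approximates the i.i.d. law.
  The repair works because, whatever the codebook, the side information is exactly i.i.d.; simulated
  and wanted law thus share their first marginal, and only S_hat, which the estimator controls, has
  to be changed. The slack used by the random-coding estimates (in the rates and in the distortion)
  is absorbed by the closure in (R, R_c, D).

  In the converse the two rates ask for opposite estimates. H(Y_i | past) must be bounded below, so
  it is computed exactly under a larger condition; the conditional entropy of side information and
  reconstruction must be bounded above, where any kernel may serve as the guess in Gibbs'
  inequality. The guess comes from a memoryless estimator, although that of the code sees the whole
  block. Averaging the latter keeps the joint law with the input u(s_e), but perhaps not with the
  whole strategy u; this suffices, since at side information s_e the kernel depends on u only
  through u(s_e). The time index can stay outside U because both kernels are determined by the
  strategy.\<close>

abbreviation (input) expn :: "'a pmf \<Rightarrow> ('a \<Rightarrow> real) \<Rightarrow> real" where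
  "expn \<equiv> \<lambda>p. measure_pmf.expectation p"

lemma expn_finite:
  "finite (set_pmf p) \<Longrightarrow> expn p f = (\<Sum>x\<in>set_pmf p. pmf p x * f x)"
  by (subst integral_measure_pmf_real[of "set_pmf p"]) (auto simp: mult.commute)

lemma expn_superset:
  "finite A \<Longrightarrow> set_pmf p \<subseteq> A \<Longrightarrow> expn p f = (\<Sum>x\<in>A. pmf p x * f x)"
  by (subst integral_measure_pmf_real[of A]) (auto simp: mult.commute)

lemma expn_cong: "(\<And>x. x \<in> set_pmf p \<Longrightarrow> f x = g x) \<Longrightarrow> expn p f = expn p g"
  by (rule integral_cong_AE) (auto simp: AE_measure_pmf_iff)

lemma expn_mono:
  "finite (set_pmf p) \<Longrightarrow> (\<And>x. x \<in> set_pmf p \<Longrightarrow> f x \<le> g x) \<Longrightarrow> expn p f \<le> expn p g"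
  by (simp add: expn_finite sum_mono mult_left_mono)

lemma expn_add:
  "finite (set_pmf p) \<Longrightarrow> expn p (\<lambda>x. f x + g x) = expn p f + expn p g"
  by (simp add: expn_finite distrib_left sum.distrib)

lemma expn_diff:
  "finite (set_pmf p) \<Longrightarrow> expn p (\<lambda>x. f x - g x) = expn p f - expn p g"
  by (simp add: expn_finite right_diff_distrib sum_subtractf)

lemma expn_sum:
  "finite (set_pmf p) \<Longrightarrow> expn p (\<lambda>x. \<Sum>i\<in>I. f i x) = (\<Sum>i\<in>I. expn p (f i))"
  by (simp add: expn_finite sum_distrib_left) (rule sum.swap)

lemma expn_nonneg: "(\<And>x. x \<in> set_pmf p \<Longrightarrow> 0 \<le> f x) \<Longrightarrow> 0 \<le> expn p f"
  by (intro integral_nonneg_AE) (auto simp: AE_measure_pmf_iff)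

lemma expn_bind:
  assumes "finite (set_pmf p)" "\<And>x. x \<in> set_pmf p \<Longrightarrow> finite (set_pmf (q x))"
  shows "expn (bind_pmf p q) f = expn p (\<lambda>x. expn (q x) f)"
  using assms by (subst pmf_expectation_bind[of "set_pmf p"]) (auto simp: expn_finite[of p])

lemma prob_expn: "measure_pmf.prob p A = expn p (indicator A)"
  by simp

text \<open>Written on the sample space, so that entropies of different variables are expectations
  under one law. Conditional entropy gets no constant of its own: H(X | Y) always appears as the
  difference of \<open>ent\<close> for the pair (Y, X) and \<open>ent J Y\<close>.\<close>

definition ent :: "'w pmf \<Rightarrow> ('w \<Rightarrow> 'a) \<Rightarrow> real" where
  "ent J X = expn J (\<lambda>w. - log 2 (pmf (map_pmf X J) (X w)))"

lemma pmf_map_pos: "w \<in> set_pmf J \<Longrightarrow> 0 < pmf (map_pmf X J) (X w)"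
  by (auto simp: pmf_positive_iff)

lemma log2_le: "0 < x \<Longrightarrow> log 2 x \<le> (x - 1) / ln 2"
  using ln_le_minus_one[of x] by (simp add: log_def divide_right_mono)

text \<open>Gibbs' inequality: \<open>log2_le\<close> is applied to the ratio of q(x | y) P(y) to
  P(y, x), whose mean is at most 1. The guess \<open>q\<close> may be subnormalised and is tested
  only on values that occur, so any convenient kernel can be inserted.\<close>

lemma ent_cond_le:
  fixes q :: "'b \<Rightarrow> 'a \<Rightarrow> real"
  assumes fin: "finite (set_pmf J)"
    and pos: "\<And>w. w \<in> set_pmf J \<Longrightarrow> 0 < q (Y w) (X w)"
    and nonneg: "\<And>w w'. w \<in> set_pmf J \<Longrightarrow> w' \<in> set_pmf J \<Longrightarrow> 0 \<le> q (Y w) (X w')"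
    and le1: "\<And>w. w \<in> set_pmf J \<Longrightarrow> (\<Sum>x\<in>X ` set_pmf J. q (Y w) x) \<le> 1"
  shows "ent J (\<lambda>w. (Y w, X w)) - ent J Y \<le> expn J (\<lambda>w. - log 2 (q (Y w) (X w)))"
proof -
  let ?YX = "\<lambda>w. (Y w, X w)"
  let ?S = "set_pmf J"
  let ?g = "\<lambda>(y, x). q y x * pmf (map_pmf Y J) y / pmf (map_pmf ?YX J) (y, x)"
  have "ent J ?YX - ent J Y - expn J (\<lambda>w. - log 2 (q (Y w) (X w)))
      = expn J (\<lambda>w. - log 2 (pmf (map_pmf ?YX J) (?YX w)) - - log 2 (pmf (map_pmf Y J) (Y w))
          - - log 2 (q (Y w) (X w)))"
    unfolding ent_def using fin by (simp only: expn_diff)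
  also have "\<dots> = expn J (\<lambda>w. log 2 (?g (?YX w)))"
  proof (rule expn_cong)
    fix w assume w: "w \<in> ?S"
    have "0 < pmf (map_pmf ?YX J) (Y w, X w)"
      using pmf_map_pos[OF w, of ?YX] by simp
    then show "- log 2 (pmf (map_pmf ?YX J) (?YX w)) - - log 2 (pmf (map_pmf Y J) (Y w))
          - - log 2 (q (Y w) (X w)) = log 2 (?g (?YX w))"
      using pos[OF w] pmf_map_pos[OF w, of Y]
      by (simp add: log_divide log_mult)
  qed
  also have "\<dots> \<le> expn J (\<lambda>w. (?g (?YX w) - 1) / ln 2)"
  proof (rule expn_mono[OF fin])
    fix w assume w: "w \<in> ?S"
    have "0 < pmf (map_pmf ?YX J) (Y w, X w)"
      using pmf_map_pos[OF w, of ?YX] by simp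
    then have "0 < ?g (?YX w)"
      using pos[OF w] pmf_map_pos[OF w, of Y] by simp
    then show "log 2 (?g (?YX w)) \<le> (?g (?YX w) - 1) / ln 2"
      by (rule log2_le)
  qed
  also have "\<dots> = (expn J (\<lambda>w. ?g (?YX w)) - 1) / ln 2"
    using fin by (simp add: expn_diff case_prod_unfold)
  also have "\<dots> \<le> 0"
  proof -
    have "expn J (\<lambda>w. ?g (?YX w)) = expn (map_pmf ?YX J) ?g"
      by simp
    also have "\<dots> = (\<Sum>z\<in>?YX ` ?S. pmf (map_pmf ?YX J) z * ?g z)"
      using fin by (subst expn_finite) auto
    also have "\<dots> \<le> (\<Sum>z\<in>?YX ` ?S. pmf (map_pmf Y J) (fst z) * q (fst z) (snd z))"
    proof (rule sum_mono)
      fix z assume "z \<in> ?YX ` ?S"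
      then obtain w where w: "w \<in> ?S" "z = (Y w, X w)" by auto
      have "0 < pmf (map_pmf ?YX J) (Y w, X w)"
        using pmf_map_pos[OF w(1), of ?YX] by simp
      then show "pmf (map_pmf ?YX J) z * ?g z \<le> pmf (map_pmf Y J) (fst z) * q (fst z) (snd z)"
        using w by simp
    qed
    \<comment> \<open>Adding the pairs of values that never occur together lets the sum factor; this
      is where \<open>nonneg\<close> at two different sample points enters.\<close>
    also have "\<dots> \<le> (\<Sum>z\<in>Y ` ?S \<times> X ` ?S. pmf (map_pmf Y J) (fst z) * q (fst z) (snd z))"
      using fin nonneg by (intro sum_mono2) auto
    also have "\<dots> = (\<Sum>y\<in>Y ` ?S. pmf (map_pmf Y J) y * (\<Sum>x\<in>X ` ?S. q y x))"
      by (simp add: sum.cartesian_product sum_distrib_left case_prod_unfold)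
    also have "\<dots> \<le> (\<Sum>y\<in>Y ` ?S. pmf (map_pmf Y J) y * 1)"
      using le1 by (intro sum_mono mult_left_mono) auto
    also have "\<dots> = 1"
      using fin by (simp add: sum_pmf_eq_1)
    finally show ?thesis
      by (simp add: divide_nonpos_pos)
  qed
  finally show ?thesis by simp
qed

lemma ent_le:
  assumes fin: "finite (set_pmf J)"
    and pos: "\<And>w. w \<in> set_pmf J \<Longrightarrow> 0 < q (X w)"
    and le1: "(\<Sum>x\<in>X ` set_pmf J. q x) \<le> 1"
  shows "ent J X \<le> expn J (\<lambda>w. - log 2 (q (X w)))"
proof -
  have "map_pmf (\<lambda>w. ((), X w)) J = map_pmf (Pair ()) (map_pmf X J)"
    by (simp add: map_pmf_comp)
  then have "ent J (\<lambda>w. ((), X w)) = ent J X"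
    unfolding ent_def by (simp add: pmf_map_inj' inj_on_def)
  moreover have "ent J (\<lambda>w. ()) = 0"
    by (simp add: ent_def)
  ultimately show ?thesis
    using ent_cond_le[OF fin, of "\<lambda>_. q" "\<lambda>_. ()" X] pos le1 by (simp add: less_imp_le)
qed

lemma ent_inj:
  assumes "inj_on h (X ` set_pmf J)"
  shows "ent J (\<lambda>w. h (X w)) = ent J X"
  unfolding ent_def
proof (rule expn_cong)
  fix w assume "w \<in> set_pmf J"
  then have "pmf (map_pmf h (map_pmf X J)) (h (X w)) = pmf (map_pmf X J) (X w)"
    using assms by (intro pmf_map_inj) auto
  then show "- log 2 (pmf (map_pmf (\<lambda>w. h (X w)) J) (h (X w))) = - log 2 (pmf (map_pmf X J) (X w))"
    by (simp add: map_pmf_comp)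
qed

text \<open>Gibbs' inequality with the true conditional law of \<open>X\<close> given
  \<open>f (Y w)\<close> as the guess: conditioning on less leaves at least as much entropy.\<close>

lemma ent_cond_mono:
  assumes fin: "finite (set_pmf J)"
  shows "ent J (\<lambda>w. (Y w, X w)) - ent J Y \<le> ent J (\<lambda>w. (f (Y w), X w)) - ent J (\<lambda>w. f (Y w))"
proof -
  let ?F = "\<lambda>w. f (Y w)" and ?FX = "\<lambda>w. (f (Y w), X w)"
  let ?q = "\<lambda>y x. pmf (map_pmf ?FX J) (f y, x) / pmf (map_pmf ?F J) (f y)"
  have "ent J (\<lambda>w. (Y w, X w)) - ent J Y \<le> expn J (\<lambda>w. - log 2 (?q (Y w) (X w)))"
  proof (rule ent_cond_le[OF fin])
    fix w assume w: "w \<in> set_pmf J"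
    show "0 < ?q (Y w) (X w)"
      using pmf_map_pos[OF w, of ?F] pmf_map_pos[OF w, of ?FX] by simp
    have "(\<Sum>x\<in>X ` set_pmf J. pmf (map_pmf ?FX J) (f (Y w), x))
        = measure_pmf.prob (map_pmf ?FX J) (Pair (f (Y w)) ` (X ` set_pmf J))"
      using fin by (subst measure_measure_pmf_finite) (auto simp: sum.reindex inj_on_def)
    also have "\<dots> \<le> measure_pmf.prob (map_pmf ?FX J) (fst -` {f (Y w)})"
      by (intro measure_pmf.finite_measure_mono) auto
    also have "\<dots> = pmf (map_pmf fst (map_pmf ?FX J)) (f (Y w))"
      by (simp add: pmf_map)
    also have "\<dots> = pmf (map_pmf ?F J) (f (Y w))"
      by (simp add: map_pmf_comp)
    finally show "(\<Sum>x\<in>X ` set_pmf J. ?q (Y w) x) \<le> 1"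
      using pmf_map_pos[OF w, of ?F]
      by (simp add: sum_divide_distrib[symmetric] divide_le_eq_1)
  qed auto
  also have "\<dots> = ent J ?FX - ent J ?F"
    unfolding ent_def expn_diff[OF fin, symmetric]
  proof (rule expn_cong)
    fix w assume w: "w \<in> set_pmf J"
    show "- log 2 (?q (Y w) (X w)) = - log 2 (pmf (map_pmf ?FX J) (f (Y w), X w)) -
               - log 2 (pmf (map_pmf ?F J) (f (Y w)))"
      using pmf_map_pos[OF w, of ?F] pmf_map_pos[OF w, of ?FX]
      by (simp add: log_divide)
  qed
  finally show ?thesis .
qed

text \<open>The library's mutual information is a Kullback-Leibler divergence of measures. On
  countable types both the joint law and the product of the marginals have densities with respect to
  the counting measure, which turns it into the expected log-likelihood ratio.\<close>

lemma mutual_info_eq: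
  fixes A :: "'w \<Rightarrow> 'a::countable" and B :: "'w \<Rightarrow> 'b::countable"
  assumes fin: "finite (set_pmf J)"
  shows "mutual_info J A B = expn J (\<lambda>w. log 2 (pmf (map_pmf (\<lambda>w. (A w, B w)) J) (A w, B w) /
           (pmf (map_pmf A J) (A w) * pmf (map_pmf B J) (B w))))"
proof -
  let ?AB = "\<lambda>w. (A w, B w)"
  let ?f = "\<lambda>z. pmf (map_pmf A J) (fst z) * pmf (map_pmf B J) (snd z)"
  let ?C = "count_space UNIV :: ('a \<times> 'b) measure"
  have cs: "count_space UNIV \<Otimes>\<^sub>M count_space UNIV = ?C"
    by (subst pair_measure_countable) auto
  have dA: "distr (measure_pmf J) (count_space UNIV) A = measure_pmf (map_pmf A J)"
    and dB: "distr (measure_pmf J) (count_space UNIV) B = measure_pmf (map_pmf B J)"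
    and dAB: "distr (measure_pmf J) ?C ?AB = measure_pmf (map_pmf ?AB J)"
    by (simp_all add: map_pmf_rep_eq)
  have prod: "measure_pmf (map_pmf A J) \<Otimes>\<^sub>M measure_pmf (map_pmf B J) = density ?C ?f"
  proof -
    have "measure_pmf (map_pmf A J) \<Otimes>\<^sub>M measure_pmf (map_pmf B J)
        = density (count_space UNIV) (pmf (map_pmf A J)) \<Otimes>\<^sub>M density (count_space UNIV) (pmf (map_pmf B J))"
      by (simp add: measure_pmf_eq_density)
    also have "\<dots> = density (count_space UNIV \<Otimes>\<^sub>M count_space UNIV)
        (\<lambda>(x, y). ennreal (pmf (map_pmf A J) x) * ennreal (pmf (map_pmf B J) y))"
      by (intro pair_measure_density)
         (auto simp: sigma_finite_measure_count_space_countable measure_pmf_eq_density[symmetric]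
           intro!: prob_space_imp_sigma_finite prob_space_measure_pmf)
    also have "\<dots> = density ?C ?f"
      unfolding cs by (intro density_cong) (auto simp: ennreal_mult)
    finally show ?thesis .
  qed
  interpret C: sigma_finite_measure ?C
    by (simp add: sigma_finite_measure_count_space_countable)
  \<comment> \<open>Absolute continuity of the joint law, a premise of
    \<open>KL_density_density\<close>.\<close>
  have ac: "pmf (map_pmf ?AB J) z = 0" if "?f z = 0" for z
  proof (rule ccontr)
    assume "pmf (map_pmf ?AB J) z \<noteq> 0"
    then have "z \<in> ?AB ` set_pmf J" by (auto simp: set_pmf_iff[symmetric])
    then obtain w where "w \<in> set_pmf J" "z = (A w, B w)" by auto
    with that pmf_map_pos[of w J A] pmf_map_pos[of w J B] show False by auto
  qed
  have "mutual_info J A B = KL_divergence 2 (density ?C ?f) (density ?C (pmf (map_pmf ?AB J)))"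
    unfolding mutual_info_def prob_space.mutual_information_def[OF prob_space_measure_pmf] dA dB cs dAB prod
    by (simp add: measure_pmf_eq_density)
  also have "\<dots> = (\<integral>z. pmf (map_pmf ?AB J) z * log 2 (pmf (map_pmf ?AB J) z / ?f z) \<partial>?C)"
    by (rule C.KL_density_density) (use ac in auto)
  also have "\<dots> = expn (map_pmf ?AB J) (\<lambda>z. log 2 (pmf (map_pmf ?AB J) z / ?f z))"
    by (simp add: measure_pmf_eq_density integral_density)
  finally show ?thesis by simp
qed

lemma mutual_info_ent:
  fixes A :: "'w \<Rightarrow> 'a::countable" and B :: "'w \<Rightarrow> 'b::countable"
  assumes fin: "finite (set_pmf J)"
  shows "mutual_info J A B = ent J A + ent J B - ent J (\<lambda>w. (A w, B w))"
  unfolding mutual_info_eq[OF fin] ent_def expn_diff[OF fin, symmetric] expn_add[OF fin, symmetric]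
proof (rule expn_cong)
  fix w assume w: "w \<in> set_pmf J"
  show "log 2 (pmf (map_pmf (\<lambda>w. (A w, B w)) J) (A w, B w) /
           (pmf (map_pmf A J) (A w) * pmf (map_pmf B J) (B w)))
      = - log 2 (pmf (map_pmf A J) (A w)) + - log 2 (pmf (map_pmf B J) (B w))
        - - log 2 (pmf (map_pmf (\<lambda>w. (A w, B w)) J) (A w, B w))"
    using pmf_map_pos[OF w, of A] pmf_map_pos[OF w, of B] pmf_map_pos[OF w, of "\<lambda>w. (A w, B w)"]
    by (simp add: log_divide log_mult)
qed

section \<open>Coupling, soft covering and random coding\<close>

lemma exists_pmf:
  assumes "finite B" "\<And>x. x \<in> B \<Longrightarrow> 0 \<le> w x" "sum w B = (1::real)"
  shows "\<exists>r. \<forall>x. pmf r x = (if x \<in> B then w x else 0)"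
proof -
  let ?f = "\<lambda>x. if x \<in> B then w x else 0"
  have "(\<integral>\<^sup>+ x. ennreal (?f x) \<partial>count_space UNIV) = (\<integral>\<^sup>+ x. ennreal (w x) \<partial>count_space B)"
    by (subst nn_integral_count_space_indicator)
       (auto intro!: nn_integral_cong simp: indicator_def)
  also have "\<dots> = ennreal (sum w B)"
    using assms by (subst nn_integral_count_space_finite) (auto simp: sum_ennreal)
  finally have "pmf (embed_pmf ?f) x = ?f x" for x
    using assms by (intro pmf_embed_pmf) auto
  then show ?thesis by blast
qed

lemma pmf_pair_kernel:
  fixes p :: "('a \<times> 'b) pmf"
  assumes fin: "finite B" and sub: "set_pmf p \<subseteq> A \<times> B" "finite A" and a: "a \<in> A"
  shows "pmf (bind_pmf p (\<lambda>(a, b). map_pmf (Pair a) (k a b))) (a, c) =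
    (\<Sum>b\<in>B. pmf p (a, b) * pmf (k a b) c)"
proof -
  have single: "pmf (map_pmf (Pair a') r) (a, c) = (if a' = a then pmf r c else 0)" for a' and r :: "'c pmf"
    by (auto simp: pmf_map vimage_def measure_pmf_single)
  have "pmf (bind_pmf p (\<lambda>(a, b). map_pmf (Pair a) (k a b))) (a, c)
      = expn p (\<lambda>z. if fst z = a then pmf (k (fst z) (snd z)) c else 0)"
    by (simp add: pmf_bind case_prod_unfold single)
  also have "\<dots> = (\<Sum>z\<in>A \<times> B. pmf p z * (if fst z = a then pmf (k (fst z) (snd z)) c else 0))"
    using assms by (intro expn_superset) auto
  also have "\<dots> = (\<Sum>a'\<in>A. \<Sum>b\<in>B. pmf p (a', b) * (if a' = a then pmf (k a' b) c else 0))"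
    by (simp add: sum.cartesian_product case_prod_unfold)
  also have "\<dots> = (\<Sum>a'\<in>A. if a' = a then \<Sum>b\<in>B. pmf p (a, b) * pmf (k a b) c else 0)"
    by (intro sum.cong) auto
  also have "\<dots> = (\<Sum>b\<in>B. pmf p (a, b) * pmf (k a b) c)"
    using assms by simp
  finally show ?thesis .
qed

lemma pmf_map_fst_sum:
  fixes p :: "('a \<times> 'b) pmf"
  assumes "finite B" "set_pmf p \<subseteq> UNIV \<times> B"
  shows "pmf (map_pmf fst p) a = (\<Sum>b\<in>B. pmf p (a, b))"
proof -
  have "pmf (map_pmf fst p) a = measure_pmf.prob p (fst -` {a})"
    by (simp add: pmf_map)
  also have "\<dots> = measure_pmf.prob p (Pair a ` B)"
    using assms by (intro measure_pmf.finite_measure_eq_AE) (auto simp: AE_measure_pmf_iff)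
  also have "\<dots> = (\<Sum>b\<in>B. pmf p (a, b))"
    using assms by (subst measure_measure_pmf_finite) (auto simp: sum.reindex inj_on_def)
  finally show ?thesis .
qed

text \<open>
  A maximal coupling of \<open>p\<close> and \<open>q\<close> over each value of the first component. Applied to the law of side
  information and simulated reconstruction, it makes this law exactly i.i.d.
\<close>

lemma correction_kernel:
  fixes p q :: "('a \<times> 'b) pmf"
  assumes fin: "finite A" "finite B" and p: "set_pmf p \<subseteq> A \<times> B" and q: "set_pmf q \<subseteq> A \<times> B"
    and marg: "map_pmf fst p = map_pmf fst q"
  obtains k :: "'a \<Rightarrow> 'b \<Rightarrow> 'b pmf" where
    "bind_pmf p (\<lambda>(a, b). map_pmf (Pair a) (k a b)) = q"
    "\<And>a b. set_pmf (k a b) \<subseteq> insert b B"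
    "expn p (\<lambda>(a, b). measure_pmf.prob (k a b) (- {b})) \<le> (\<Sum>z\<in>A \<times> B. \<bar>pmf p z - pmf q z\<bar>)"
proof -
  have pB: "set_pmf p \<subseteq> UNIV \<times> B" and qB: "set_pmf q \<subseteq> UNIV \<times> B"
    using p q by auto
  have Bne: "B \<noteq> {}" using q set_pmf_not_empty[of q] by auto
  \<comment> \<open>Mass missing from \<open>p\<close> above \<open>a\<close>. Since the first
    marginals agree, it equals the surplus of \<open>p\<close> above \<open>a\<close>, so the
    surplus can fill the gap without leaving the fibre.\<close>
  define D where "D = (\<lambda>a. \<Sum>b\<in>B. max 0 (pmf q (a, b) - pmf p (a, b)))"
  have D0: "0 \<le> D a" for a unfolding D_def by (simp add: sum_nonneg)
  have D': "(\<Sum>b\<in>B. max 0 (pmf p (a, b) - pmf q (a, b))) = D a" for a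
  proof -
    have "(\<Sum>b\<in>B. pmf p (a, b)) = (\<Sum>b\<in>B. pmf q (a, b))"
      using pmf_map_fst_sum[OF fin(2) pB] pmf_map_fst_sum[OF fin(2) qB] marg by simp
    moreover have "(\<Sum>b\<in>B. max 0 (pmf p (a, b) - pmf q (a, b))) - D a
        = (\<Sum>b\<in>B. pmf p (a, b)) - (\<Sum>b\<in>B. pmf q (a, b))"
      unfolding D_def sum_subtractf[symmetric] by (intro sum.cong) auto
    ultimately show ?thesis by simp
  qed
  \<comment> \<open>\<open>r a\<close> is the missing mass normalised. The equation is multiplied by
    \<open>D a\<close> so that it also holds when nothing is missing, where any law on
    \<open>B\<close> does.\<close>
  have "\<exists>r. set_pmf r \<subseteq> B \<and> (\<forall>b\<in>B. pmf r b * D a = max 0 (pmf q (a, b) - pmf p (a, b)))" for a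
  proof (cases "D a = 0")
    case True
    obtain b0 where "b0 \<in> B" using Bne by auto
    moreover have "\<forall>b\<in>B. max 0 (pmf q (a, b) - pmf p (a, b)) = 0"
      using True fin unfolding D_def by (subst (asm) sum_nonneg_eq_0_iff) auto
    ultimately show ?thesis using True by (intro exI[of _ "return_pmf b0"]) auto
  next
    case False
    have "\<exists>r. \<forall>x. pmf r x = (if x \<in> B then max 0 (pmf q (a, x) - pmf p (a, x)) / D a else 0)"
    proof (rule exists_pmf[OF fin(2)])
      show "(\<Sum>x\<in>B. max 0 (pmf q (a, x) - pmf p (a, x)) / D a) = 1"
        using False unfolding sum_divide_distrib[symmetric] by (simp add: fun_cong[OF D_def, symmetric])
    qed (simp add: D0)
    then obtain r where r: "\<And>x. pmf r x = (if x \<in> B then max 0 (pmf q (a, x) - pmf p (a, x)) / D a else 0)"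
      by blast
    then have "set_pmf r \<subseteq> B" by (auto simp: set_pmf_iff split: if_splits)
    with r False show ?thesis by (intro exI[of _ r]) auto
  qed
  then obtain r where r: "\<And>a. set_pmf (r a) \<subseteq> B"
    "\<And>a b. b \<in> B \<Longrightarrow> pmf (r a) b * D a = max 0 (pmf q (a, b) - pmf p (a, b))"
    using choice[of "\<lambda>a r. set_pmf r \<subseteq> B \<and> (\<forall>b\<in>B. pmf r b * D a = max 0 (pmf q (a, b) - pmf p (a, b)))"]
    by blast
  \<comment> \<open>The probability of keeping \<open>b\<close>, the largest that does not overshoot
    \<open>q\<close>. Where \<open>pmf p z = 0\<close> the quotient is 0, which is harmless because
    such \<open>z\<close> do not occur.\<close>
  define t where "t = (\<lambda>z. min 1 (pmf q z / pmf p z))"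
  have t: "0 \<le> t z" "t z \<le> 1" for z by (auto simp: t_def)
  have pt: "pmf p z * t z = min (pmf p z) (pmf q z)" for z
    by (cases "pmf p z = 0") (auto simp: t_def min_def field_simps)
  define k where "k = (\<lambda>a b. bind_pmf (bernoulli_pmf (t (a, b))) (\<lambda>h. if h then return_pmf b else r a))"
  have pk: "pmf (k a b) c = t (a, b) * indicator {c} b + (1 - t (a, b)) * pmf (r a) c" for a b c
    using t[of "(a, b)"] by (simp add: k_def pmf_bind)
  have k_set: "set_pmf (k a b) \<subseteq> insert b B" for a b
    using r(1)[of a] by (auto simp: k_def split: if_splits)
  have main: "pmf (bind_pmf p (\<lambda>(a, b). map_pmf (Pair a) (k a b))) (a, c) = pmf q (a, c)"
    if "a \<in> A" "c \<in> B" for a c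
  proof -
    have "pmf (bind_pmf p (\<lambda>(a, b). map_pmf (Pair a) (k a b))) (a, c)
        = (\<Sum>b\<in>B. pmf p (a, b) * pmf (k a b) c)"
      using fin p that by (intro pmf_pair_kernel) auto
    also have "\<dots> = (\<Sum>b\<in>B. min (pmf p (a, b)) (pmf q (a, b)) * indicator {c} b
        + max 0 (pmf p (a, b) - pmf q (a, b)) * pmf (r a) c)"
    proof (rule sum.cong[OF refl])
      fix b
      have "pmf p (a, b) * pmf (k a b) c
          = pmf p (a, b) * t (a, b) * indicator {c} b
            + (pmf p (a, b) - pmf p (a, b) * t (a, b)) * pmf (r a) c"
        unfolding pk by (simp add: algebra_simps)
      then show "pmf p (a, b) * pmf (k a b) c = min (pmf p (a, b)) (pmf q (a, b)) * indicator {c} b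
        + max 0 (pmf p (a, b) - pmf q (a, b)) * pmf (r a) c"
        unfolding pt by (simp add: min_def max_def)
    qed
    \<comment> \<open>Kept mass plus redistributed mass: the released masses above \<open>a\<close>
      add up to \<open>D a\<close>, and \<open>r a\<close> spreads them over the gaps.\<close>
    also have "\<dots> = min (pmf p (a, c)) (pmf q (a, c)) + D a * pmf (r a) c"
      using fin that by (simp add: sum.distrib sum_distrib_right[symmetric] D' indicator_def
        if_distrib[of "\<lambda>x. _ * x"] sum.delta' cong: if_cong)
    also have "\<dots> = pmf q (a, c)"
      using r(2)[OF that(2), of a] by (simp add: mult.commute min_def max_def split: if_splits)
    finally show ?thesis .
  qed
  have "bind_pmf p (\<lambda>(a, b). map_pmf (Pair a) (k a b)) = q"
  proof (rule pmf_eqI)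
    fix z
    show "pmf (bind_pmf p (\<lambda>(a, b). map_pmf (Pair a) (k a b))) z = pmf q z"
    proof (cases "z \<in> A \<times> B")
      case True
      then show ?thesis using main by auto
    next
      case False
      moreover have "set_pmf (bind_pmf p (\<lambda>(a, b). map_pmf (Pair a) (k a b))) \<subseteq> A \<times> B"
        using p k_set by fastforce
      ultimately have "z \<notin> set_pmf (bind_pmf p (\<lambda>(a, b). map_pmf (Pair a) (k a b)))" "z \<notin> set_pmf q"
        using q by blast+
      then show ?thesis unfolding pmf_eq_0_set_pmf[symmetric] by simp
    qed
  qed
  moreover have "expn p (\<lambda>(a, b). measure_pmf.prob (k a b) (- {b})) \<le> (\<Sum>z\<in>A \<times> B. \<bar>pmf p z - pmf q z\<bar>)"
  proof -
    have "expn p (\<lambda>(a, b). measure_pmf.prob (k a b) (- {b}))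
        = (\<Sum>z\<in>A \<times> B. pmf p z * (1 - pmf (k (fst z) (snd z)) (snd z)))"
      using fin p by (subst expn_superset[of "A \<times> B"])
        (auto simp: case_prod_unfold measure_pmf.prob_compl[simplified] Compl_eq_Diff_UNIV measure_pmf_single intro!: sum.cong)
    \<comment> \<open>A change needs \<open>b\<close> not to be kept. The exact total is half of the
      right-hand side; the termwise bound is enough.\<close>
    also have "\<dots> \<le> (\<Sum>z\<in>A \<times> B. \<bar>pmf p z - pmf q z\<bar>)"
    proof (rule sum_mono)
      fix z :: "'a \<times> 'b"
      have "pmf p z * (1 - pmf (k (fst z) (snd z)) (snd z)) \<le> pmf p z * (1 - t z)"
        using t[of z] by (intro mult_left_mono) (auto simp: pk)
      also have "\<dots> = pmf p z - min (pmf p z) (pmf q z)"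
        using pt[of z] by (simp add: algebra_simps)
      also have "\<dots> \<le> \<bar>pmf p z - pmf q z\<bar>" by auto
      finally show "pmf p z * (1 - pmf (k (fst z) (snd z)) (snd z)) \<le> \<bar>pmf p z - pmf q z\<bar>" .
    qed
    finally show ?thesis .
  qed
  ultimately show thesis using that k_set by blast
qed

section \<open>Random codebooks\<close>

text \<open>Pairwise independence of the codewords suffices for both random coding arguments.\<close>

definition pairwise_codebook :: "'u pmf \<Rightarrow> 'i set \<Rightarrow> ('i \<Rightarrow> 'u) pmf \<Rightarrow> bool" where
  "pairwise_codebook Q I C \<longleftrightarrow> finite (set_pmf C) \<and> finite (set_pmf Q) \<and>
     (\<forall>i\<in>I. map_pmf (\<lambda>c. c i) C = Q) \<and>
     (\<forall>i\<in>I. \<forall>j\<in>I. i \<noteq> j \<longrightarrow> map_pmf (\<lambda>c. (c i, c j)) C = pair_pmf Q Q)"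

lemma codebook_expn:
  assumes "pairwise_codebook Q I C" "i \<in> I"
  shows "expn C (\<lambda>c. f (c i)) = expn Q f"
proof -
  have "expn C (\<lambda>c. f (c i)) = expn (map_pmf (\<lambda>c. c i) C) f" by simp
  with assms show ?thesis by (simp only: pairwise_codebook_def)
qed

lemma expn_pair:
  assumes "finite (set_pmf p)" "finite (set_pmf q)"
  shows "expn (pair_pmf p q) (\<lambda>z. f (fst z) (snd z)) = expn p (\<lambda>x. expn q (f x))"
  using assms by (simp add: pair_pmf_def expn_bind)

lemma codebook_expn2:
  assumes "pairwise_codebook Q I C" "i \<in> I" "j \<in> I" "i \<noteq> j"
  shows "expn C (\<lambda>c. f (c i) (c j)) = expn Q (\<lambda>u. expn Q (f u))"
proof -
  have law: "map_pmf (\<lambda>c. (c i, c j)) C = pair_pmf Q Q"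
    using assms by (auto simp: pairwise_codebook_def)
  have "expn C (\<lambda>c. f (c i) (c j)) = expn (map_pmf (\<lambda>c. (c i, c j)) C) (\<lambda>z. f (fst z) (snd z))" by simp
  also have "\<dots> = expn (pair_pmf Q Q) (\<lambda>z. f (fst z) (snd z))"
    by (simp only: law)
  also have "\<dots> = expn Q (\<lambda>u. expn Q (f u))"
    using assms by (intro expn_pair) (auto simp: pairwise_codebook_def)
  finally show ?thesis .
qed

lemma expn_abs_le_sqrt:
  assumes "finite (set_pmf p)"
  shows "expn p (\<lambda>x. \<bar>f x\<bar>) \<le> sqrt (expn p (\<lambda>x. (f x)\<^sup>2))"
proof -
  let ?m = "expn p (\<lambda>x. \<bar>f x\<bar>)"
  have "0 \<le> expn p (\<lambda>x. (\<bar>f x\<bar> - ?m)\<^sup>2)" by (intro expn_nonneg) auto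
  also have "(\<lambda>x. (\<bar>f x\<bar> - ?m)\<^sup>2) = (\<lambda>x. ((f x)\<^sup>2 + ?m\<^sup>2) - 2 * ?m * \<bar>f x\<bar>)"
    by (auto simp: power2_eq_square algebra_simps)
  also have "expn p \<dots> = expn p (\<lambda>x. (f x)\<^sup>2) + ?m\<^sup>2 - 2 * ?m * ?m"
    using assms by (simp add: expn_diff expn_add)
  finally have "?m\<^sup>2 \<le> expn p (\<lambda>x. (f x)\<^sup>2)" by (simp add: power2_eq_square)
  then show ?thesis by (rule real_le_rsqrt)
qed

text \<open>Second-moment method: by pairwise independence the covariances vanish, so the average
  has the variance of one term divided by \<open>card I\<close>.\<close>

lemma codebook_average_deviation:
  assumes C: "pairwise_codebook Q I C" and I: "finite I" "I \<noteq> {}"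
  shows "expn C (\<lambda>c. \<bar>(\<Sum>i\<in>I. f (c i)) / card I - expn Q f\<bar>) \<le> sqrt (expn Q (\<lambda>u. (f u)\<^sup>2) / card I)"
proof -
  let ?m = "expn Q f" and ?L = "real (card I)"
  define h where "h = (\<lambda>u. f u - ?m)"
  have fin: "finite (set_pmf Q)" "finite (set_pmf C)" using C by (auto simp: pairwise_codebook_def)
  have L: "0 < ?L" using I by (simp add: card_gt_0_iff)
  have h0: "expn Q h = 0" unfolding h_def using fin by (simp add: expn_diff)
  have hv: "expn Q (\<lambda>u. (h u)\<^sup>2) \<le> expn Q (\<lambda>u. (f u)\<^sup>2)"
  proof -
    have "(\<lambda>u. (h u)\<^sup>2) = (\<lambda>u. (f u)\<^sup>2 + ?m\<^sup>2 - 2 * ?m * f u)"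
      by (auto simp: h_def power2_eq_square algebra_simps)
    then have "expn Q (\<lambda>u. (h u)\<^sup>2) = expn Q (\<lambda>u. (f u)\<^sup>2) + ?m\<^sup>2 - 2 * ?m * ?m"
      using fin by (simp add: expn_diff expn_add)
    then show ?thesis by (simp add: power2_eq_square)
  qed
  have cov: "expn C (\<lambda>c. h (c i) * h (c j)) = (if i = j then expn Q (\<lambda>u. (h u)\<^sup>2) else 0)"
    if "i \<in> I" "j \<in> I" for i j
  proof (cases "i = j")
    case True
    then show ?thesis using codebook_expn[OF C that(1), of "\<lambda>u. (h u)\<^sup>2"] by (simp add: power2_eq_square)
  next
    case False
    then show ?thesis using codebook_expn2[OF C that False, of "\<lambda>u v. h u * h v"] h0 by simp
  qed
  have "expn C (\<lambda>c. \<bar>(\<Sum>i\<in>I. f (c i)) / ?L - ?m\<bar>)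
      \<le> sqrt (expn C (\<lambda>c. ((\<Sum>i\<in>I. f (c i)) / ?L - ?m)\<^sup>2))"
    by (rule expn_abs_le_sqrt[OF fin(2)])
  also have "(\<lambda>c. ((\<Sum>i\<in>I. f (c i)) / ?L - ?m)\<^sup>2) = (\<lambda>c. (\<Sum>i\<in>I. \<Sum>j\<in>I. h (c i) * h (c j)) / ?L\<^sup>2)"
  proof
    fix c
    have "(\<Sum>i\<in>I. f (c i)) / ?L - ?m = (\<Sum>i\<in>I. h (c i)) / ?L"
      using L by (simp add: h_def sum_subtractf field_simps)
    then show "((\<Sum>i\<in>I. f (c i)) / ?L - ?m)\<^sup>2 = (\<Sum>i\<in>I. \<Sum>j\<in>I. h (c i) * h (c j)) / ?L\<^sup>2"
      by (simp add: power_divide power2_eq_square sum_product)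
  qed
  also have "expn C (\<lambda>c. (\<Sum>i\<in>I. \<Sum>j\<in>I. h (c i) * h (c j)) / ?L\<^sup>2)
      = (\<Sum>i\<in>I. \<Sum>j\<in>I. expn C (\<lambda>c. h (c i) * h (c j))) / ?L\<^sup>2"
    using fin by (simp add: expn_sum)
  also have "\<dots> = (\<Sum>i\<in>I. \<Sum>j\<in>I. if i = j then expn Q (\<lambda>u. (h u)\<^sup>2) else 0) / ?L\<^sup>2"
    using cov by simp
  also have "\<dots> = expn Q (\<lambda>u. (h u)\<^sup>2) / ?L"
    using I by (simp add: power2_eq_square)
  also have "sqrt \<dots> \<le> sqrt (expn Q (\<lambda>u. (f u)\<^sup>2) / ?L)"
    using hv L by (simp add: divide_right_mono)
  finally show ?thesis .
qed

text \<open>The kernel is split at likelihood ratio \<tau>. The part \<open>k1\<close> below it has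
  second moment at most \<tau> P(a)^2, so its codebook average deviates by at most sqrt(\<tau> /
  card I) P(a) in mean. The part \<open>k2\<close> above it is estimated by its mean alone, once for
  the codebook average and once for the target, whence the factor 2.\<close>

lemma soft_covering:
  fixes K :: "'u \<Rightarrow> 'a pmf"
  assumes C: "pairwise_codebook Q I C" and I: "finite I" "I \<noteq> {}"
    and A: "finite A" "\<And>u. u \<in> set_pmf Q \<Longrightarrow> set_pmf (K u) \<subseteq> A" and \<tau>: "0 \<le> \<tau>"
  shows "expn C (\<lambda>c. \<Sum>a\<in>A. \<bar>(\<Sum>i\<in>I. pmf (K (c i)) a) / card I - pmf (bind_pmf Q K) a\<bar>)
    \<le> 2 * expn Q (\<lambda>u. measure_pmf.prob (K u) {a. \<tau> * pmf (bind_pmf Q K) a < pmf (K u) a})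
      + sqrt (\<tau> / card I)"
proof -
  let ?L = "real (card I)"
  define P where "P = pmf (bind_pmf Q K)"
  have fin: "finite (set_pmf Q)" "finite (set_pmf C)" using C by (auto simp: pairwise_codebook_def)
  have L: "0 < ?L" using I by (simp add: card_gt_0_iff)
  define k1 where "k1 = (\<lambda>a u. if pmf (K u) a \<le> \<tau> * P a then pmf (K u) a else 0)"
  define k2 where "k2 = (\<lambda>a u. if pmf (K u) a \<le> \<tau> * P a then 0 else pmf (K u) a)"
  have k: "pmf (K u) a = k1 a u + k2 a u" "0 \<le> k1 a u" "0 \<le> k2 a u" for a u
    by (auto simp: k1_def k2_def)
  have P: "P a = expn Q (k1 a) + expn Q (k2 a)" for a
    unfolding P_def using fin by (simp add: pmf_bind k(1) expn_add)
  have P0: "0 \<le> P a" for a by (simp add: P_def)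
  have k1sq: "expn Q (\<lambda>u. (k1 a u)\<^sup>2) \<le> \<tau> * (P a)\<^sup>2" for a
  proof -
    have "expn Q (\<lambda>u. (k1 a u)\<^sup>2) \<le> expn Q (\<lambda>u. \<tau> * P a * k1 a u)"
      using fin \<tau> P0 by (intro expn_mono) (auto simp: k1_def power2_eq_square intro!: mult_right_mono)
    also have "\<dots> = \<tau> * P a * expn Q (k1 a)" by simp
    also have "\<dots> \<le> \<tau> * P a * P a"
      using \<tau> P0 k(3) by (intro mult_left_mono) (auto simp: P intro!: expn_nonneg add_nonneg_nonneg k)
    finally show ?thesis by (simp add: power2_eq_square)
  qed
  have each: "expn C (\<lambda>c. \<bar>(\<Sum>i\<in>I. pmf (K (c i)) a) / ?L - P a\<bar>) \<le> sqrt (\<tau> / ?L) * P a + 2 * expn Q (k2 a)" for a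
  proof -
    have "expn C (\<lambda>c. \<bar>(\<Sum>i\<in>I. pmf (K (c i)) a) / ?L - P a\<bar>)
        \<le> expn C (\<lambda>c. \<bar>(\<Sum>i\<in>I. k1 a (c i)) / ?L - expn Q (k1 a)\<bar> + ((\<Sum>i\<in>I. k2 a (c i)) / ?L + expn Q (k2 a)))"
    proof (rule expn_mono[OF fin(2)])
      fix c
      have "(\<Sum>i\<in>I. pmf (K (c i)) a) / ?L - P a
          = ((\<Sum>i\<in>I. k1 a (c i)) / ?L - expn Q (k1 a)) + ((\<Sum>i\<in>I. k2 a (c i)) / ?L - expn Q (k2 a))"
        by (simp add: k(1) sum.distrib add_divide_distrib P)
      moreover have "0 \<le> (\<Sum>i\<in>I. k2 a (c i)) / ?L" "0 \<le> expn Q (k2 a)"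
        using k(3) by (auto intro!: sum_nonneg divide_nonneg_nonneg expn_nonneg)
      ultimately show "\<bar>(\<Sum>i\<in>I. pmf (K (c i)) a) / ?L - P a\<bar>
          \<le> \<bar>(\<Sum>i\<in>I. k1 a (c i)) / ?L - expn Q (k1 a)\<bar> + ((\<Sum>i\<in>I. k2 a (c i)) / ?L + expn Q (k2 a))"
        by linarith
    qed
    also have "\<dots> = expn C (\<lambda>c. \<bar>(\<Sum>i\<in>I. k1 a (c i)) / ?L - expn Q (k1 a)\<bar>)
        + ((\<Sum>i\<in>I. expn C (\<lambda>c. k2 a (c i))) / ?L + expn Q (k2 a))"
      using fin by (simp add: expn_add expn_sum)
    also have "(\<Sum>i\<in>I. expn C (\<lambda>c. k2 a (c i))) = ?L * expn Q (k2 a)"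
      using codebook_expn[OF C, of _ "k2 a"] by simp
    also have "expn C (\<lambda>c. \<bar>(\<Sum>i\<in>I. k1 a (c i)) / ?L - expn Q (k1 a)\<bar>) \<le> sqrt (expn Q (\<lambda>u. (k1 a u)\<^sup>2) / ?L)"
      by (rule codebook_average_deviation[OF C I])
    also have "\<dots> \<le> sqrt (\<tau> * (P a)\<^sup>2 / ?L)"
      using k1sq[of a] L by (simp add: divide_right_mono)
    also have "\<dots> = sqrt (\<tau> / ?L) * P a"
      using P0[of a] by (simp add: real_sqrt_divide real_sqrt_mult)
    finally show ?thesis using L by simp
  qed
  have "expn C (\<lambda>c. \<Sum>a\<in>A. \<bar>(\<Sum>i\<in>I. pmf (K (c i)) a) / ?L - P a\<bar>)
      \<le> (\<Sum>a\<in>A. sqrt (\<tau> / ?L) * P a + 2 * expn Q (k2 a))"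
    using each fin by (simp add: expn_sum sum_mono)
  also have "\<dots> = sqrt (\<tau> / ?L) * (\<Sum>a\<in>A. P a) + 2 * expn Q (\<lambda>u. \<Sum>a\<in>A. k2 a u)"
    using fin by (simp add: sum.distrib sum_distrib_left expn_sum)
  also have "(\<Sum>a\<in>A. P a) = 1"
    unfolding P_def using A by (intro sum_pmf_eq_1) auto
  also have "expn Q (\<lambda>u. \<Sum>a\<in>A. k2 a u) = expn Q (\<lambda>u. measure_pmf.prob (K u) {a. \<tau> * P a < pmf (K u) a})"
  proof (rule expn_cong)
    fix u assume u: "u \<in> set_pmf Q"
    have "measure_pmf.prob (K u) {a. \<tau> * P a < pmf (K u) a} = measure_pmf.prob (K u) {a\<in>A. \<tau> * P a < pmf (K u) a}"
      using A(2)[OF u] by (intro measure_pmf.finite_measure_eq_AE) (auto simp: AE_measure_pmf_iff)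
    also have "\<dots> = (\<Sum>a\<in>A. k2 a u)"
      using A(1) by (subst measure_measure_pmf_finite) (auto simp: k2_def sum.If_cases not_le Int_def conj_commute intro!: sum.cong)
    finally show "(\<Sum>a\<in>A. k2 a u) = measure_pmf.prob (K u) {a. \<tau> * P a < pmf (K u) a}" by simp
  qed
  finally show ?thesis unfolding P_def by simp
qed

text \<open>Several hits are resolved arbitrarily and no hit gives an arbitrary index, so that the
  output always lies in the message set, as \<open>is_code\<close> demands.\<close>

definition threshold_dec :: "('u \<Rightarrow> 'y \<Rightarrow> bool) \<Rightarrow> 'i set \<Rightarrow> ('i \<Rightarrow> 'u) \<Rightarrow> 'y \<Rightarrow> 'i" where
  "threshold_dec T I c y = (if \<exists>i\<in>I. T (c i) y then SOME i. i \<in> I \<and> T (c i) y else SOME i. i \<in> I)"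

lemma threshold_dec_in: "I \<noteq> {} \<Longrightarrow> threshold_dec T I c y \<in> I"
  unfolding threshold_dec_def
  by (auto intro: someI2_ex[of "\<lambda>i. i \<in> I \<and> T (c i) y"] simp: some_in_eq)

text \<open>An error requires that the sent codeword fails the test or another one passes it. A
  codeword v independent of the output passes with probability at most 1 / \<gamma>: passing means
  P(y) < K(v, y) / \<gamma>, and the right side sums to 1 / \<gamma> over y.\<close>

lemma random_coding:
  fixes K :: "'u \<Rightarrow> 'y pmf"
  assumes C: "pairwise_codebook Q I C" and I: "finite I"
    and K: "\<And>u. finite (set_pmf (K u))" and \<gamma>: "0 < \<gamma>" and i: "i \<in> I"
    and T: "T = (\<lambda>u y. \<gamma> * pmf (bind_pmf Q K) y < pmf (K u) y)"
  shows "expn C (\<lambda>c. measure_pmf.prob (K (c i)) {y. threshold_dec T I c y \<noteq> i})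
    \<le> expn Q (\<lambda>u. measure_pmf.prob (K u) {y. \<not> T u y}) + card I / \<gamma>"
proof -
  have fin: "finite (set_pmf Q)" "finite (set_pmf C)" using C by (auto simp: pairwise_codebook_def)
  have cross: "expn C (\<lambda>c. measure_pmf.prob (K (c i)) {y. T (c j) y}) \<le> 1 / \<gamma>" if j: "j \<in> I" "i \<noteq> j" for j
  proof -
    have "expn C (\<lambda>c. measure_pmf.prob (K (c i)) {y. T (c j) y})
        = expn Q (\<lambda>u. expn Q (\<lambda>v. measure_pmf.prob (K u) {y. T v y}))"
      using codebook_expn2[OF C i j, of "\<lambda>u v. measure_pmf.prob (K u) {y. T v y}"] .
    also have "\<dots> = expn Q (\<lambda>v. expn Q (\<lambda>u. measure_pmf.prob (K u) {y. T v y}))"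
      using fin unfolding expn_finite[OF fin(1)] sum_distrib_left
      by (subst sum.swap) (simp add: mult.left_commute)
    also have "\<dots> = expn Q (\<lambda>v. measure_pmf.prob (bind_pmf Q K) {y. T v y})"
      using fin K by (simp add: prob_expn expn_bind del: Bochner_Integration.integral_indicator)
    also have "\<dots> \<le> expn Q (\<lambda>v. 1 / \<gamma>)"
    proof (rule expn_mono[OF fin(1)])
      fix v assume v: "v \<in> set_pmf Q"
      let ?S = "{y \<in> set_pmf (K v). T v y}"
      have "measure_pmf.prob (bind_pmf Q K) {y. T v y} = measure_pmf.prob (bind_pmf Q K) {y \<in> set_pmf (bind_pmf Q K). T v y}"
        by (intro measure_pmf.finite_measure_eq_AE) (auto simp: AE_measure_pmf_iff)
      also have "\<dots> \<le> measure_pmf.prob (bind_pmf Q K) ?S"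
      proof (rule measure_pmf.finite_measure_mono)
        show "{y \<in> set_pmf (bind_pmf Q K). T v y} \<subseteq> ?S"
        proof
          fix y assume "y \<in> {y \<in> set_pmf (bind_pmf Q K). T v y}"
          then have "T v y" by simp
          moreover from this have "0 < pmf (K v) y"
            unfolding T using \<gamma> by (meson less_imp_le mult_nonneg_nonneg order_le_less_trans pmf_nonneg)
          ultimately show "y \<in> ?S" by (auto simp: pmf_positive_iff)
        qed
      qed simp
      also have "\<dots> = (\<Sum>y\<in>?S. pmf (bind_pmf Q K) y)"
        using K by (intro measure_measure_pmf_finite) auto
      also have "\<dots> \<le> (\<Sum>y\<in>?S. pmf (K v) y / \<gamma>)"
        using \<gamma> by (intro sum_mono) (auto simp: T field_simps)
      also have "\<dots> = measure_pmf.prob (K v) ?S / \<gamma>"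
        using K by (subst measure_measure_pmf_finite) (auto simp: sum_divide_distrib)
      also have "\<dots> \<le> 1 / \<gamma>"
        using \<gamma> by (intro divide_right_mono) auto
      finally show "measure_pmf.prob (bind_pmf Q K) {y. T v y} \<le> 1 / \<gamma>" .
    qed
    finally show ?thesis by simp
  qed
  have "expn C (\<lambda>c. measure_pmf.prob (K (c i)) {y. threshold_dec T I c y \<noteq> i})
      \<le> expn C (\<lambda>c. measure_pmf.prob (K (c i)) {y. \<not> T (c i) y}
          + (\<Sum>j\<in>I - {i}. measure_pmf.prob (K (c i)) {y. T (c j) y}))"
  proof (rule expn_mono[OF fin(2)])
    fix c
    have "{y. threshold_dec T I c y \<noteq> i} \<subseteq> {y. \<not> T (c i) y} \<union> (\<Union>j\<in>I - {i}. {y. T (c j) y})"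
    proof
      fix y assume y: "y \<in> {y. threshold_dec T I c y \<noteq> i}"
      show "y \<in> {y. \<not> T (c i) y} \<union> (\<Union>j\<in>I - {i}. {y. T (c j) y})"
      proof (cases "T (c i) y")
        case True
        then have ex: "\<exists>j. j \<in> I \<and> T (c j) y" using i by auto
        then have "threshold_dec T I c y \<in> I \<and> T (c (threshold_dec T I c y)) y"
          using someI_ex[OF ex] by (auto simp: threshold_dec_def)
        then show ?thesis using y by auto
      qed auto
    qed
    then have "measure_pmf.prob (K (c i)) {y. threshold_dec T I c y \<noteq> i}
        \<le> measure_pmf.prob (K (c i)) ({y. \<not> T (c i) y} \<union> (\<Union>j\<in>I - {i}. {y. T (c j) y}))"
      by (intro measure_pmf.finite_measure_mono) auto
    also have "\<dots> \<le> measure_pmf.prob (K (c i)) {y. \<not> T (c i) y}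
        + measure_pmf.prob (K (c i)) (\<Union>j\<in>I - {i}. {y. T (c j) y})"
      by (rule measure_Un_le) auto
    also have "measure_pmf.prob (K (c i)) (\<Union>j\<in>I - {i}. {y. T (c j) y})
        \<le> (\<Sum>j\<in>I - {i}. measure_pmf.prob (K (c i)) {y. T (c j) y})"
      using I by (intro measure_UNION_le) auto
    finally show "measure_pmf.prob (K (c i)) {y. threshold_dec T I c y \<noteq> i}
        \<le> measure_pmf.prob (K (c i)) {y. \<not> T (c i) y}
          + (\<Sum>j\<in>I - {i}. measure_pmf.prob (K (c i)) {y. T (c j) y})" by simp
  qed
  also have "\<dots> = expn Q (\<lambda>u. measure_pmf.prob (K u) {y. \<not> T u y})
      + (\<Sum>j\<in>I - {i}. expn C (\<lambda>c. measure_pmf.prob (K (c i)) {y. T (c j) y}))"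
    using fin codebook_expn[OF C i, of "\<lambda>u. measure_pmf.prob (K u) {y. \<not> T u y}"]
    by (simp add: expn_add expn_sum)
  also have "(\<Sum>j\<in>I - {i}. expn C (\<lambda>c. measure_pmf.prob (K (c i)) {y. T (c j) y})) \<le> (\<Sum>j\<in>I - {i}. 1 / \<gamma>)"
    using cross by (intro sum_mono) auto
  also have "\<dots> \<le> card I / \<gamma>"
    using I \<gamma> by (simp add: divide_right_mono card_Diff_subset card_mono)
  finally show ?thesis by simp
qed

section \<open>Memoryless laws and information density\<close>

lemma finite_set_Pi_pmf [simp]:
  "finite A \<Longrightarrow> (\<And>i. i \<in> A \<Longrightarrow> finite (set_pmf (p i))) \<Longrightarrow> finite (set_pmf (Pi_pmf A d p))"
  by (simp add: set_Pi_pmf finite_PiE_dflt)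

lemma iid_lower_tail:
  fixes f :: "'a \<Rightarrow> real"
  assumes fin: "finite (set_pmf p)" and \<alpha>: "\<alpha> < expn p f"
  shows "(\<lambda>n. measure_pmf.prob (Pi_pmf {..<n} dflt (\<lambda>_. p)) {w. (\<Sum>i<n. f (w i)) \<le> real n * \<alpha>}) \<longlonglongrightarrow> 0"
proof -
  \<comment> \<open>A common bound for all values of \<open>f\<close>; the added 1 keeps the
    interval of Hoeffding's inequality nondegenerate if \<open>f\<close> vanishes on the
    support.\<close>
  define B where "B = (\<Sum>x\<in>set_pmf p. \<bar>f x\<bar>) + 1"
  have B: "\<bar>f x\<bar> \<le> B" if "x \<in> set_pmf p" for x
    using member_le_sum[OF that, of "\<lambda>x. \<bar>f x\<bar>"] fin by (simp add: B_def)
  have B1: "1 \<le> B" by (simp add: B_def sum_nonneg)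
  define \<delta> where "\<delta> = expn p f - \<alpha>"
  have \<delta>: "0 < \<delta>" using \<alpha> by (simp add: \<delta>_def)
  \<comment> \<open>Chosen so that Hoeffding's exponent, 2 (n \<delta>)^2 divided by n (2 B)^2, is n
    times \<open>c\<close>.\<close>
  define c where "c = 2 * \<delta>\<^sup>2 / (2 * B)\<^sup>2"
  have c: "0 < c" using \<delta> B1 by (simp add: c_def)
  have bound: "measure_pmf.prob (Pi_pmf {..<n} dflt (\<lambda>_. p)) {w. (\<Sum>i<n. f (w i)) \<le> real n * \<alpha>} \<le> exp (- c) ^ n"
    if n: "0 < n" for n
  proof -
    let ?M = "Pi_pmf {..<n} dflt (\<lambda>_. p)"
    have comp: "map_pmf (\<lambda>w. w i) ?M = p" if "i < n" for i
      using that by (simp add: Pi_pmf_component)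
    have ex: "expn ?M (\<lambda>w. f (w i)) = expn p f" if "i < n" for i
    proof -
      have "expn ?M (\<lambda>w. f (w i)) = expn (map_pmf (\<lambda>w. w i) ?M) f" by simp
      then show ?thesis by (simp only: comp[OF that])
    qed
    interpret Hoeffding_ineq "measure_pmf ?M" "{..<n}" "\<lambda>i w. f (w i)" "\<lambda>_. - B" "\<lambda>_. B" "real n * expn p f"
    proof unfold_locales
      show "prob_space.indep_vars (measure_pmf ?M) (\<lambda>_. borel) (\<lambda>i w. f (w i)) {..<n}"
        by (rule prob_space.indep_vars_compose2[OF _ indep_vars_Pi_pmf])
           (auto simp: measure_pmf.prob_space_axioms)
    next
      fix i assume "i \<in> {..<n}"
      show "AE w in measure_pmf ?M. f (w i) \<in> {- B..B}"
      proof (rule AE_pmfI)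
        fix w assume "w \<in> set_pmf ?M"
        then have "w i \<in> set_pmf p" using \<open>i \<in> {..<n}\<close> by (auto simp: set_Pi_pmf PiE_dflt_def)
        from B[OF this] show "f (w i) \<in> {- B..B}" by auto
      qed
    qed (simp_all add: ex)
    have "measure_pmf.prob ?M {w. (\<Sum>i<n. f (w i)) \<le> real n * \<alpha>}
        = measure_pmf.prob ?M {w \<in> space (measure_pmf ?M). (\<Sum>i<n. f (w i)) \<le> real n * expn p f - real n * \<delta>}"
      by (simp add: \<delta>_def algebra_simps)
    also have "\<dots> \<le> exp (- 2 * (real n * \<delta>)\<^sup>2 / (\<Sum>i<n. (B - - B)\<^sup>2))"
      using n \<delta> B1 by (intro Hoeffding_ineq_le) auto
    also have "- 2 * (real n * \<delta>)\<^sup>2 / (\<Sum>i<n. (B - - B)\<^sup>2) = real n * (- c)"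
      using n by (simp add: c_def power2_eq_square field_simps)
    finally show ?thesis by (simp only: exp_of_nat_mult)
  qed
  show ?thesis
  proof (rule tendsto_sandwich[OF _ _ tendsto_const])
    show "\<forall>\<^sub>F n in sequentially. measure_pmf.prob (Pi_pmf {..<n} dflt (\<lambda>_. p))
        {w. (\<Sum>i<n. f (w i)) \<le> real n * \<alpha>} \<le> exp (- c) ^ n"
      using eventually_gt_at_top[of 0] by eventually_elim (rule bound)
    show "(\<lambda>n. exp (- c) ^ n) \<longlonglongrightarrow> 0"
      using c by (intro LIMSEQ_power_zero) auto
  qed auto
qed

lemma iid_upper_tail:
  fixes f :: "'a \<Rightarrow> real"
  assumes fin: "finite (set_pmf p)" and \<alpha>: "expn p f < \<alpha>"
  shows "(\<lambda>n. measure_pmf.prob (Pi_pmf {..<n} dflt (\<lambda>_. p)) {w. real n * \<alpha> \<le> (\<Sum>i<n. f (w i))}) \<longlonglongrightarrow> 0"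
  using iid_lower_tail[OF fin, of "- \<alpha>" "\<lambda>x. - f x" dflt] \<alpha> by (simp add: sum_negf)

lemma Pi_pmf_map_index:
  assumes "finite A"
  shows "Pi_pmf A d (\<lambda>i. map_pmf (h i) (p i)) = map_pmf (\<lambda>f i. if i \<in> A then h i (f i) else d) (Pi_pmf A d' p)"
  using assms unfolding map_pmf_def
  by (subst Pi_pmf_bind[where d' = d']) auto

lemma prod_law_kernel:
  "prod_law n (\<lambda>_. bind_pmf Q K) = bind_pmf (prod_law n (\<lambda>_. Q)) (\<lambda>u. prod_law n (\<lambda>i. K (u i)))"
  by (rule Pi_pmf_bind) simp

lemma prod_law_joint:
  "prod_law n (\<lambda>_. bind_pmf Q (\<lambda>u. map_pmf (Pair u) (K u))) =
     bind_pmf (prod_law n (\<lambda>_. Q)) (\<lambda>u. map_pmf (\<lambda>y i. if i \<in> {..<n} then (u i, y i) else undefined)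
       (prod_law n (\<lambda>i. K (u i))))"
  unfolding prod_law_kernel by (intro bind_pmf_cong refl Pi_pmf_map_index) simp

lemma pmf_prod_law_pos:
  assumes "y \<in> set_pmf (prod_law n p)"
  shows "pmf (prod_law n p) y = (\<Prod>i<n. pmf (p i) (y i))" "\<And>i. i < n \<Longrightarrow> y i \<in> set_pmf (p i)"
    "\<And>i. i \<notin> {..<n} \<Longrightarrow> y i = undefined"
  using assms by (auto simp: set_Pi_pmf PiE_dflt_def pmf_Pi)

text \<open>Likelihood ratios of product laws factor, so the threshold test becomes a test on a sum
  of single-letter information densities. On the supports every factor is positive and the
  logarithms are genuine.\<close>

lemma info_density_prod:
  assumes u: "u \<in> set_pmf (prod_law n (\<lambda>_. Q))" and y: "y \<in> set_pmf (prod_law n (\<lambda>i. K (u i)))"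
  shows "2 powr a * pmf (prod_law n (\<lambda>_. bind_pmf Q K)) y < pmf (prod_law n (\<lambda>i. K (u i))) y \<longleftrightarrow>
    a < (\<Sum>i<n. log 2 (pmf (K (u i)) (y i) / pmf (bind_pmf Q K) (y i)))"
proof -
  let ?q = "bind_pmf Q K"
  have pos: "0 < pmf (K (u i)) (y i)" "0 < pmf ?q (y i)" if "i < n" for i
    using pmf_prod_law_pos(2)[OF u that] pmf_prod_law_pos(2)[OF y that] by (auto simp: pmf_positive_iff)
  have K: "pmf (prod_law n (\<lambda>i. K (u i))) y = (\<Prod>i<n. pmf (K (u i)) (y i))"
    and q: "pmf (prod_law n (\<lambda>_. ?q)) y = (\<Prod>i<n. pmf ?q (y i))"
    using pmf_prod_law_pos[OF y] by (auto simp: pmf_Pi)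
  have qpos: "0 < (\<Prod>i<n. pmf ?q (y i))"
    using pos by (intro prod_pos) auto
  have "(\<Prod>i<n. pmf (K (u i)) (y i)) = (\<Prod>i<n. pmf ?q (y i)) * (\<Prod>i<n. pmf (K (u i)) (y i) / pmf ?q (y i))"
    using pos unfolding prod.distrib[symmetric] by (intro prod.cong refl) (simp add: less_imp_neq[symmetric])
  also have "(\<Prod>i<n. pmf (K (u i)) (y i) / pmf ?q (y i))
      = (\<Prod>i<n. 2 powr log 2 (pmf (K (u i)) (y i) / pmf ?q (y i)))"
    using pos by (intro prod.cong refl) simp
  also have "\<dots> = 2 powr (\<Sum>i<n. log 2 (pmf (K (u i)) (y i) / pmf ?q (y i)))"
    by (simp add: powr_sum)
  finally show ?thesis
    unfolding K q using qpos by (simp add: mult.commute)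
qed

text \<open>A random codeword with its output is a sequence of i.i.d. pairs, so the averaged
  probability becomes a tail probability of an i.i.d. sum. The predicates \<open>R\<close> and
  \<open>S\<close> are left open to serve both tails.\<close>

lemma info_density_tail:
  assumes fin: "finite (set_pmf Q)" "\<And>u. finite (set_pmf (K u))"
  defines "J \<equiv> bind_pmf Q (\<lambda>u. map_pmf (Pair u) (K u))"
  defines "i \<equiv> \<lambda>u y. log 2 (pmf (K u) y / pmf (bind_pmf Q K) y)"
  assumes R: "\<And>u y. u \<in> set_pmf (prod_law n (\<lambda>_. Q)) \<Longrightarrow> y \<in> set_pmf (prod_law n (\<lambda>i. K (u i))) \<Longrightarrow>
      R u y \<Longrightarrow> S (\<Sum>k<n. i (u k) (y k))"
  shows "expn (prod_law n (\<lambda>_. Q)) (\<lambda>u. measure_pmf.prob (prod_law n (\<lambda>i. K (u i))) {y. R u y})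
    \<le> measure_pmf.prob (prod_law n (\<lambda>_. J)) {w. S (\<Sum>k<n. case_prod i (w k))}"
proof -
  let ?Q = "prod_law n (\<lambda>_. Q)" and ?K = "\<lambda>u. prod_law n (\<lambda>i. K (u i))"
  let ?h = "\<lambda>u y k. if k \<in> {..<n} then (u k, y k) else undefined"
  have "expn ?Q (\<lambda>u. measure_pmf.prob (?K u) {y. R u y})
      \<le> expn ?Q (\<lambda>u. measure_pmf.prob (map_pmf (?h u) (?K u)) {w. S (\<Sum>k<n. case_prod i (w k))})"
  proof (rule expn_mono)
    fix u assume u: "u \<in> set_pmf ?Q"
    have "measure_pmf.prob (?K u) {y. R u y} \<le> measure_pmf.prob (?K u) {y. S (\<Sum>k<n. case_prod i (?h u y k))}"
      using R[OF u] by (intro measure_pmf.finite_measure_mono_AE) (auto simp: AE_measure_pmf_iff)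
    then show "measure_pmf.prob (?K u) {y. R u y}
        \<le> measure_pmf.prob (map_pmf (?h u) (?K u)) {w. S (\<Sum>k<n. case_prod i (w k))}"
      by (simp add: vimage_def)
  qed (use fin in auto)
  also have "\<dots> = measure_pmf.prob (prod_law n (\<lambda>_. J)) {w. S (\<Sum>k<n. case_prod i (w k))}"
    unfolding J_def prod_law_joint prob_expn using fin by (subst expn_bind) auto
  finally show ?thesis .
qed

text \<open>The sent codeword fails the decoding test with vanishing probability as long as \<alpha>
  is below the mean information density.\<close>

lemma info_density_low:
  assumes fin: "finite (set_pmf Q)" "\<And>u. finite (set_pmf (K u))"
    and \<alpha>: "\<alpha> < expn (bind_pmf Q (\<lambda>u. map_pmf (Pair u) (K u))) (\<lambda>(u, y). log 2 (pmf (K u) y / pmf (bind_pmf Q K) y))"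
  shows "(\<lambda>n. expn (prod_law n (\<lambda>_. Q)) (\<lambda>u. measure_pmf.prob (prod_law n (\<lambda>i. K (u i)))
     {y. \<not> 2 powr (real n * \<alpha>) * pmf (prod_law n (\<lambda>_. bind_pmf Q K)) y < pmf (prod_law n (\<lambda>i. K (u i))) y})) \<longlonglongrightarrow> 0"
proof (rule tendsto_sandwich[OF _ _ tendsto_const])
  let ?J = "bind_pmf Q (\<lambda>u. map_pmf (Pair u) (K u))"
  let ?i = "\<lambda>u y. log 2 (pmf (K u) y / pmf (bind_pmf Q K) y)"
  show "(\<lambda>n. measure_pmf.prob (prod_law n (\<lambda>_. ?J)) {w. (\<Sum>k<n. case_prod ?i (w k)) \<le> real n * \<alpha>}) \<longlonglongrightarrow> 0"
    using fin \<alpha> by (intro iid_lower_tail) auto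
  show "\<forall>\<^sub>F n in sequentially. expn (prod_law n (\<lambda>_. Q)) (\<lambda>u. measure_pmf.prob (prod_law n (\<lambda>i. K (u i)))
     {y. \<not> 2 powr (real n * \<alpha>) * pmf (prod_law n (\<lambda>_. bind_pmf Q K)) y < pmf (prod_law n (\<lambda>i. K (u i))) y})
     \<le> measure_pmf.prob (prod_law n (\<lambda>_. ?J)) {w. (\<Sum>k<n. case_prod ?i (w k)) \<le> real n * \<alpha>}"
    using info_density_prod[of _ _ Q _ K]
    by (intro always_eventually allI info_density_tail[OF fin, where S = "\<lambda>x. x \<le> _"]) (auto simp: not_less)
qed (auto intro!: always_eventually expn_nonneg)

text \<open>The opposite tail: the part of the kernel cut off in soft covering vanishes once
  \<beta>, playing the role of \<alpha> here, exceeds the mean information density.\<close>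

lemma info_density_high:
  assumes fin: "finite (set_pmf Q)" "\<And>u. finite (set_pmf (K u))"
    and \<alpha>: "expn (bind_pmf Q (\<lambda>u. map_pmf (Pair u) (K u))) (\<lambda>(u, y). log 2 (pmf (K u) y / pmf (bind_pmf Q K) y)) < \<alpha>"
  shows "(\<lambda>n. expn (prod_law n (\<lambda>_. Q)) (\<lambda>u. measure_pmf.prob (prod_law n (\<lambda>i. K (u i)))
     {y. 2 powr (real n * \<alpha>) * pmf (prod_law n (\<lambda>_. bind_pmf Q K)) y < pmf (prod_law n (\<lambda>i. K (u i))) y})) \<longlonglongrightarrow> 0"
proof (rule tendsto_sandwich[OF _ _ tendsto_const])
  let ?J = "bind_pmf Q (\<lambda>u. map_pmf (Pair u) (K u))"
  let ?i = "\<lambda>u y. log 2 (pmf (K u) y / pmf (bind_pmf Q K) y)"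
  show "(\<lambda>n. measure_pmf.prob (prod_law n (\<lambda>_. ?J)) {w. real n * \<alpha> \<le> (\<Sum>k<n. case_prod ?i (w k))}) \<longlonglongrightarrow> 0"
    using fin \<alpha> by (intro iid_upper_tail) auto
  show "\<forall>\<^sub>F n in sequentially. expn (prod_law n (\<lambda>_. Q)) (\<lambda>u. measure_pmf.prob (prod_law n (\<lambda>i. K (u i)))
     {y. 2 powr (real n * \<alpha>) * pmf (prod_law n (\<lambda>_. bind_pmf Q K)) y < pmf (prod_law n (\<lambda>i. K (u i))) y})
     \<le> measure_pmf.prob (prod_law n (\<lambda>_. ?J)) {w. real n * \<alpha> \<le> (\<Sum>k<n. case_prod ?i (w k))}"
    using info_density_prod[of _ _ Q _ K]
    by (intro always_eventually allI info_density_tail[OF fin, where S = "\<lambda>x. _ \<le> x"]) (auto simp: less_imp_le)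
qed (auto intro!: always_eventually expn_nonneg)

lemma pmf_channel_joint:
  "pmf (bind_pmf Q (\<lambda>u. map_pmf (Pair u) (K u))) (u, y) = pmf Q u * pmf (K u) y"
proof -
  have "pmf (map_pmf (Pair v) (K v)) (u, y) = pmf (K u) y * indicator {u} v" for v
    by (auto simp: pmf_map vimage_def measure_pmf_single indicator_def)
  then show ?thesis
    by (simp add: pmf_bind measure_pmf_single)
qed

text \<open>Identifies the mean information density, in which the coding estimates are phrased, with
  the mutual information of the theorem.\<close>

lemma mutual_info_channel:
  fixes A :: "'w \<Rightarrow> 'a::countable" and B :: "'w \<Rightarrow> 'b::countable"
  assumes fin: "finite (set_pmf J)"
    and law: "map_pmf (\<lambda>w. (A w, B w)) J = bind_pmf Q (\<lambda>u. map_pmf (Pair u) (K u))"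
  shows "mutual_info J A B =
    expn (bind_pmf Q (\<lambda>u. map_pmf (Pair u) (K u))) (\<lambda>(u, y). log 2 (pmf (K u) y / pmf (bind_pmf Q K) y))"
proof -
  have "map_pmf A J = map_pmf fst (map_pmf (\<lambda>w. (A w, B w)) J)"
    by (simp add: map_pmf_comp)
  also have "\<dots> = Q"
    unfolding law by (simp add: map_bind_pmf map_pmf_comp bind_return_pmf')
  finally have A: "map_pmf A J = Q" .
  have "map_pmf B J = map_pmf snd (map_pmf (\<lambda>w. (A w, B w)) J)"
    by (simp add: map_pmf_comp)
  also have "\<dots> = bind_pmf Q K"
    unfolding law by (simp add: map_bind_pmf map_pmf_comp)
  finally have B: "map_pmf B J = bind_pmf Q K" .
  have "mutual_info J A B = expn J (\<lambda>w. log 2 (pmf (K (A w)) (B w) / pmf (bind_pmf Q K) (B w)))"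
    unfolding mutual_info_eq[OF fin] law pmf_channel_joint
  proof (rule expn_cong)
    fix w assume w: "w \<in> set_pmf J"
    show "log 2 (pmf Q (A w) * pmf (K (A w)) (B w) / (pmf (map_pmf A J) (A w) * pmf (map_pmf B J) (B w)))
        = log 2 (pmf (K (A w)) (B w) / pmf (bind_pmf Q K) (B w))"
      using pmf_map_pos[OF w, of A] unfolding A B by (simp add: less_imp_neq[symmetric])
  qed
  also have "\<dots> = expn (map_pmf (\<lambda>w. (A w, B w)) J) (\<lambda>(u, y). log 2 (pmf (K u) y / pmf (bind_pmf Q K) y))"
    by simp
  finally show ?thesis unfolding law .
qed

section \<open>Achievability\<close>

abbreviation comap :: "nat \<Rightarrow> ('a \<Rightarrow> 'b) \<Rightarrow> (nat \<Rightarrow> 'a) \<Rightarrow> nat \<Rightarrow> 'b" where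
  "comap n h w \<equiv> (\<lambda>i\<in>{..<n}. h (w i))"

lemma prod_law_comap: "map_pmf (comap n h) (prod_law n p) = prod_law n (\<lambda>i. map_pmf h (p i))"
  by (subst Pi_pmf_map_index[where d' = undefined]) (simp_all add: restrict_def)

lemma set_prod_law: "set_pmf (prod_law n p) = (\<Pi>\<^sub>E i\<in>{..<n}. set_pmf (p i))"
  by (auto simp: set_Pi_pmf PiE_dflt_def PiE_def Pi_def extensional_def)

lemma set_prod_law_subset: "set_pmf (prod_law n p) \<subseteq> seqs n"
  by (auto simp: set_prod_law PiE_def)

lemma finite_seqs [simp]: "finite (seqs n :: (nat \<Rightarrow> 'a::finite) set)"
  by (simp add: finite_PiE)

lemma pmf_map_inj_on:
  assumes "inj_on f S" "set_pmf p \<subseteq> S" "x \<in> S"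
  shows "pmf (map_pmf f p) (f x) = pmf p x"
proof -
  have "pmf (map_pmf f p) (f x) = measure_pmf.prob p (f -` {f x})"
    by (simp add: pmf_map)
  also have "\<dots> = measure_pmf.prob p {x}"
    using assms by (intro measure_pmf.finite_measure_eq_AE) (auto simp: AE_measure_pmf_iff dest: inj_onD)
  finally show ?thesis by (simp add: measure_pmf_single)
qed

text \<open>\<open>correction_kernel\<close> needs side information and reconstruction as a pair of
  sequences, whereas the constraint in \<open>achievable\<close> concerns a sequence of pairs.
  \<open>unzip\<close> and \<open>rezip\<close> translate; they are mutually inverse on extensional
  sequences only.\<close>

definition unzip :: "nat \<Rightarrow> (nat \<Rightarrow> 'a \<times> 'b) \<Rightarrow> (nat \<Rightarrow> 'a) \<times> (nat \<Rightarrow> 'b)" where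
  "unzip n w = (comap n fst w, comap n snd w)"

definition rezip :: "nat \<Rightarrow> (nat \<Rightarrow> 'a) \<times> (nat \<Rightarrow> 'b) \<Rightarrow> nat \<Rightarrow> 'a \<times> 'b" where
  "rezip n ab = (\<lambda>i\<in>{..<n}. (fst ab i, snd ab i))"

lemma rezip_unzip: "w \<in> seqs n \<Longrightarrow> rezip n (unzip n w) = w"
  by (auto simp: rezip_def unzip_def fun_eq_iff PiE_def extensional_def)

lemma unzip_rezip: "ab \<in> seqs n \<times> seqs n \<Longrightarrow> unzip n (rezip n ab) = ab"
  by (auto simp: rezip_def unzip_def fun_eq_iff PiE_def extensional_def)

lemma unzip_in: "unzip n w \<in> seqs n \<times> seqs n"
  by (auto simp: unzip_def)

lemma rezip_in: "rezip n ab \<in> seqs n"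
  by (auto simp: rezip_def)

lemma inj_on_unzip: "inj_on (unzip n) (seqs n)"
  by (rule inj_on_inverseI[of _ "rezip n"]) (rule rezip_unzip)

lemma bij_betw_unzip:
  "bij_betw (unzip n :: (nat \<Rightarrow> 'a \<times> 'b) \<Rightarrow> _) (seqs n) (seqs n \<times> seqs n)"
  unfolding bij_betw_def
proof
  show "(unzip n :: (nat \<Rightarrow> 'a \<times> 'b) \<Rightarrow> _) ` seqs n = seqs n \<times> seqs n"
  proof (rule subset_antisym[OF image_subsetI subsetI])
    fix ab :: "(nat \<Rightarrow> 'a) \<times> (nat \<Rightarrow> 'b)" assume "ab \<in> seqs n \<times> seqs n"
    from unzip_rezip[OF this] show "ab \<in> unzip n ` seqs n" by (rule image_eqI[OF sym rezip_in])
  qed (rule unzip_in)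
qed (rule inj_on_unzip)

text \<open>One channel use when the codeword letter \<open>u\<close> selects the Shannon strategy
  \<open>xf u\<close>. As U is independent of the state pair, the latter is drawn inside the kernel,
  and a code with causal side information becomes an ordinary memoryless channel with input
  \<open>u\<close>.\<close>

definition channel_kernel ::
  "('se \<times> 's) pmf \<Rightarrow> ('x \<Rightarrow> 's \<Rightarrow> ('y \<times> 'z) pmf) \<Rightarrow> ('u \<Rightarrow> 'se \<Rightarrow> 'x)
    \<Rightarrow> ('x \<Rightarrow> 'se \<Rightarrow> 'z \<Rightarrow> 's pmf) \<Rightarrow> 'u \<Rightarrow> ('se \<times> 's \<times> 'y \<times> 'z \<times> 's) pmf" where
  "channel_kernel P W xf V u = bind_pmf P (\<lambda>p. bind_pmf (W (xf u (fst p)) (snd p)) (\<lambda>q.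
     map_pmf (\<lambda>sh. (fst p, snd p, fst q, snd q, sh)) (V (xf u (fst p)) (fst p) (snd q))))"

lemma prod_law_channel_kernel:
  "prod_law n (\<lambda>i. channel_kernel P W xf V (u i)) = do {
     ses \<leftarrow> prod_law n (\<lambda>_. P);
     yz \<leftarrow> prod_law n (\<lambda>i. W (xf (u i) (fst (ses i))) (snd (ses i)));
     map_pmf (\<lambda>sh. \<lambda>i\<in>{..<n}. (fst (ses i), snd (ses i), fst (yz i), snd (yz i), sh i))
       (prod_law n (\<lambda>i. V (xf (u i) (fst (ses i))) (fst (ses i)) (snd (yz i)))) }"
  unfolding channel_kernel_def
  apply (subst Pi_pmf_bind[where d' = undefined], simp)
  apply (rule bind_pmf_cong[OF refl])
  apply (subst Pi_pmf_bind[where d' = undefined], simp)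
  apply (rule bind_pmf_cong[OF refl])
  apply (subst Pi_pmf_map_index[where d' = undefined], simp)
  apply (simp add: restrict_def)
  done

lemma finite_index_set [simp]: "finite (index_set n R)"
  by (simp add: index_set_def)

lemma card_index_set: "card (index_set n R) = nat \<lfloor>2 powr (real n * R)\<rfloor>"
  by (simp add: index_set_def)

text \<open>Since 2^(nR) is at least 1, rounding down costs at most a factor 2. This is the origin
  of the constant 4 in the achievability and of one of the lost bits in the converse.\<close>

lemma index_set_bounds:
  assumes "0 \<le> R"
  shows "1 \<le> card (index_set n R)" "real (card (index_set n R)) \<le> 2 powr (real n * R)"
    "2 powr (real n * R) / 2 \<le> real (card (index_set n R))" "index_set n R \<noteq> {}"
proof -
  let ?x = "2 powr (real n * R)"
  have x: "1 \<le> ?x" using assms by (intro ge_one_powr_ge_zero) auto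
  then have fl: "1 \<le> \<lfloor>?x\<rfloor>" by simp
  have c: "real (card (index_set n R)) = of_int \<lfloor>?x\<rfloor>"
    using fl by (simp add: card_index_set)
  show "1 \<le> card (index_set n R)" using fl by (simp add: card_index_set le_nat_iff)
  then show "index_set n R \<noteq> {}" by auto
  show "real (card (index_set n R)) \<le> ?x" unfolding c by simp
  show "?x / 2 \<le> real (card (index_set n R))"
    unfolding c using fl real_of_int_floor_add_one_gt[of ?x] by linarith
qed

lemma pmf_of_set_Times:
  assumes "finite A" "finite B" "A \<noteq> {}" "B \<noteq> {}"
  shows "pmf_of_set (A \<times> B) = pair_pmf (pmf_of_set A) (pmf_of_set B)"
proof (rule pmf_eqI)
  fix ab show "pmf (pmf_of_set (A \<times> B)) ab = pmf (pair_pmf (pmf_of_set A) (pmf_of_set B)) ab"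
    using assms by (cases ab) (simp add: pmf_pair card_cartesian_product indicator_def)
qed

lemma comap_restrict: "comap n h (\<lambda>i\<in>{..<n}. t i) = (\<lambda>i\<in>{..<n}. h (t i))"
  by (auto simp: restrict_def)

text \<open>The encoder uses only the current side information, so causality is automatic. The
  estimator simulates the memoryless reconstruction and then post-processes it by \<open>k\<close>,
  which may look at the side information; before this last stage the code is a uniform mixture of
  memoryless channel uses.\<close>

lemma code_law_channel_kernel:
  fixes n :: nat and c :: "nat \<times> nat \<Rightarrow> nat \<Rightarrow> 'u" and P :: "('se \<times> 's) pmf" and xf :: "'u \<Rightarrow> 'se \<Rightarrow> 'x"
    and V :: "'x \<Rightarrow> 'se \<Rightarrow> 'z \<Rightarrow> 's pmf" and k :: "(nat \<Rightarrow> 'se) \<Rightarrow> (nat \<Rightarrow> 's) \<Rightarrow> (nat \<Rightarrow> 's) pmf"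
  assumes R: "0 \<le> R" "0 \<le> Rc"
  defines "f \<equiv> \<lambda>i m g se. xf (c (m, g) i) (se i)"
    and "est \<equiv> \<lambda>g x se z. bind_pmf (prod_law n (\<lambda>i. V (x i) (se i) (z i))) (k se)"
  shows "code_law P W n R Rc f dec est =
    bind_pmf (pmf_of_set (index_set n R \<times> index_set n Rc)) (\<lambda>mg.
      bind_pmf (prod_law n (\<lambda>i. channel_kernel P W xf V (c mg i))) (\<lambda>w.
        map_pmf (\<lambda>sh. (fst mg, dec (comap n (\<lambda>(se, s, y, z, sh). y) w) (snd mg),
              comap n (\<lambda>(se, s, y, z, sh). se) w, comap n (\<lambda>(se, s, y, z, sh). s) w, sh))
          (k (comap n (\<lambda>(se, s, y, z, sh). se) w) (comap n (\<lambda>(se, s, y, z, sh). sh) w))))"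
proof -
  let ?I = "index_set n R" and ?G = "index_set n Rc"
  have ne: "?I \<noteq> {}" "?G \<noteq> {}" using index_set_bounds R by auto
  have prod: "pmf_of_set (?I \<times> ?G) = bind_pmf (pmf_of_set ?I) (\<lambda>m. bind_pmf (pmf_of_set ?G) (\<lambda>g. return_pmf (m, g)))"
    using ne by (simp add: pmf_of_set_Times pair_pmf_def)
  have inner: "do {
      yz \<leftarrow> prod_law n (\<lambda>i. W (encode n f m g (comap n fst ses) i) (comap n snd ses i));
      sh \<leftarrow> est g (encode n f m g (comap n fst ses)) (comap n fst ses) (comap n snd yz);
      return_pmf (m, dec (comap n fst yz) g, comap n fst ses, comap n snd ses, sh) } = do {
      yz \<leftarrow> prod_law n (\<lambda>i. W (xf (c (m, g) i) (fst (ses i))) (snd (ses i)));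
      sh0 \<leftarrow> prod_law n (\<lambda>i. V (xf (c (m, g) i) (fst (ses i))) (fst (ses i)) (snd (yz i)));
      map_pmf (\<lambda>sh. (m, dec (comap n fst yz) g, comap n fst ses, comap n snd ses, sh))
         (k (comap n fst ses) (comap n id sh0)) }" for m g and ses :: "nat \<Rightarrow> _"
  proof -
    have enc: "encode n f m g (comap n fst ses) i = xf (c (m, g) i) (fst (ses i))" if "i < n" for i
      using that by (simp add: encode_def f_def)
    have W: "prod_law n (\<lambda>i. W (encode n f m g (comap n fst ses) i) (comap n snd ses i))
        = prod_law n (\<lambda>i. W (xf (c (m, g) i) (fst (ses i))) (snd (ses i)))"
      by (rule Pi_pmf_cong) (auto simp: enc)
    have V: "prod_law n (\<lambda>i. V (encode n f m g (comap n fst ses) i) (comap n fst ses i) (comap n snd yz i))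
        = prod_law n (\<lambda>i. V (xf (c (m, g) i) (fst (ses i))) (fst (ses i)) (snd (yz i)))" for yz :: "nat \<Rightarrow> _"
      by (rule Pi_pmf_cong) (auto simp: enc)
    have id: "restrict sh {..<n} = sh" if "sh \<in> set_pmf (prod_law n p)" for sh p
      using that by (auto simp: fun_eq_iff pmf_prod_law_pos(3))
    show ?thesis
      unfolding W est_def V bind_assoc_pmf map_pmf_def
      by (intro bind_pmf_cong refl) (simp add: id)
  qed
  show ?thesis
    unfolding code_law_def Let_def inner prod prod_law_channel_kernel
    unfolding bind_assoc_pmf bind_return_pmf bind_map_pmf fst_conv snd_conv comap_restrict prod.case id_apply
    by (rule refl)
qed

lemma expn_pmf_of_set:
  "A \<noteq> {} \<Longrightarrow> finite A \<Longrightarrow> expn (pmf_of_set A) f = (\<Sum>x\<in>A. f x) / card A"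
  by (rule integral_pmf_of_set)

lemma expn_prod_law_component:
  assumes "i < n"
  shows "expn (prod_law n p) (\<lambda>w. f (w i)) = expn (p i) f"
proof -
  have "expn (prod_law n p) (\<lambda>w. f (w i)) = expn (map_pmf (\<lambda>w. w i) (prod_law n p)) f" by simp
  also have "map_pmf (\<lambda>w. w i) (prod_law n p) = p i"
    using assms by (simp add: Pi_pmf_component)
  finally show ?thesis .
qed

lemma finite_channel_kernel [simp]:
  fixes P :: "('se::finite \<times> 's::finite) pmf" and W :: "'x \<Rightarrow> 's \<Rightarrow> ('y::finite \<times> 'z::finite) pmf"
  shows "finite (set_pmf (channel_kernel P W xf V u))"
  by (rule finite_subset[OF subset_UNIV]) simp

lemma channel_kernel_fst:
  "map_pmf (\<lambda>(se, s, y, z, sh). se) (channel_kernel P W xf V u) = map_pmf fst P"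
  by (simp add: channel_kernel_def map_bind_pmf map_pmf_comp map_pmf_def[of fst P])

text \<open>For a fixed codebook. The correction touches only S_hat: the error probability stays,
  the law becomes exact, and the distortion grows by at most \<open>dmax\<close> times the
  probability of a change, which \<open>tv\<close> bounds.\<close>

lemma code_of_codebook:
  fixes P :: "('se::finite \<times> 's::finite) pmf" and W :: "'x::finite \<Rightarrow> 's \<Rightarrow> ('y::finite \<times> 'z::finite) pmf"
    and c :: "nat \<times> nat \<Rightarrow> nat \<Rightarrow> 'u" and dec :: "(nat \<Rightarrow> 'y) \<Rightarrow> nat \<Rightarrow> nat"
    and xf :: "'u \<Rightarrow> 'se \<Rightarrow> 'x" and V :: "'x \<Rightarrow> 'se \<Rightarrow> 'z \<Rightarrow> 's pmf" and n :: nat and R Rc :: real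
  assumes R: "0 \<le> R" "0 \<le> Rc" and n: "0 < n"
    and dec: "\<And>y g. dec y g \<in> index_set n R" and d: "\<And>s sh. 0 \<le> d s sh" "\<And>s sh. d s sh \<le> dmax"
  defines "M \<equiv> index_set n R \<times> index_set n Rc"
    and "K \<equiv> channel_kernel P W xf V"
  defines "tv \<equiv> \<Sum>w\<in>seqs n. \<bar>(\<Sum>mg\<in>M. pmf (prod_law n (\<lambda>i. map_pmf (\<lambda>(se, s, y, z, sh). (se, sh)) (K (c mg i)))) w) / card M
      - pmf (prod_law n (\<lambda>_. P)) w\<bar>"
  obtains f est where "is_code n R Rc dec est"
    "measure_pmf.prob (code_law P W n R Rc f dec est) {(m, mh, se, s, sh). m \<noteq> mh} =
       (\<Sum>mg\<in>M. measure_pmf.prob (prod_law n (\<lambda>i. map_pmf (\<lambda>(se, s, y, z, sh). y) (K (c mg i))))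
          {y. dec y (snd mg) \<noteq> fst mg}) / card M"
    "expn (code_law P W n R Rc f dec est) (\<lambda>(m, mh, se, s, sh). (\<Sum>i<n. d (s i) (sh i)) / real n)
       \<le> (\<Sum>mg\<in>M. (\<Sum>i<n. expn (K (c mg i)) (\<lambda>(se, s, y, z, sh). d s sh)) / n) / card M + dmax * tv"
    "map_pmf (\<lambda>(m, mh, se, s, sh). \<lambda>i\<in>{..<n}. (se i, sh i)) (code_law P W n R Rc f dec est) = prod_law n (\<lambda>_. P)"
proof -
  let ?se = "\<lambda>(se, s, y, z, sh). se" and ?s = "\<lambda>(se, s, y, z, sh). s" and ?y = "\<lambda>(se, s, y, z, sh). y"
    and ?sh = "\<lambda>(se, s, y, z, sh). sh" and ?a = "\<lambda>(se, s, y, z, sh). (se, sh)"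
  let ?K = "\<lambda>mg. prod_law n (\<lambda>i. K (c mg i))"
  have M: "finite M" "M \<noteq> {}" using index_set_bounds R by (auto simp: M_def)
  define pbar where "pbar = bind_pmf (pmf_of_set M) (\<lambda>mg. prod_law n (\<lambda>i. map_pmf ?a (K (c mg i))))"
  define p where "p = map_pmf (unzip n) pbar"
  define q where "q = map_pmf (unzip n) (prod_law n (\<lambda>_. P))"
  have pbar_sub: "set_pmf pbar \<subseteq> seqs n"
    unfolding pbar_def set_bind_pmf by (intro UN_least set_prod_law_subset)
  \<comment> \<open>Codewords are independent of the side information, so every codeword leaves it
    exactly i.i.d.; this is the premise of \<open>correction_kernel\<close>.\<close>
  have marg: "map_pmf fst p = map_pmf fst q"
  proof -
    have "map_pmf fst p = bind_pmf (pmf_of_set M) (\<lambda>mg. map_pmf (comap n fst) (prod_law n (\<lambda>i. map_pmf ?a (K (c mg i)))))"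
      by (simp add: p_def pbar_def map_pmf_comp map_bind_pmf unzip_def)
    also have "\<dots> = bind_pmf (pmf_of_set M) (\<lambda>mg. prod_law n (\<lambda>i. map_pmf fst P))"
      by (simp add: prod_law_comap map_pmf_comp case_prod_unfold K_def
          channel_kernel_fst[unfolded case_prod_unfold])
    also have "\<dots> = map_pmf fst q"
      by (simp add: q_def map_pmf_comp unzip_def prod_law_comap)
    finally show ?thesis .
  qed
  have p_sub: "set_pmf p \<subseteq> seqs n \<times> seqs n" and q_sub: "set_pmf q \<subseteq> seqs n \<times> seqs n"
    unfolding p_def q_def set_map_pmf by (intro image_subsetI unzip_in)+
  obtain k where k: "bind_pmf p (\<lambda>(a, b). map_pmf (Pair a) (k a b)) = q"
    "\<And>a b. set_pmf (k a b) \<subseteq> insert b (seqs n)"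
    "expn p (\<lambda>(a, b). measure_pmf.prob (k a b) (- {b})) \<le> (\<Sum>z\<in>seqs n \<times> seqs n. \<bar>pmf p z - pmf q z\<bar>)"
    using correction_kernel[OF finite_seqs finite_seqs p_sub q_sub marg] by blast
  have fin_k: "finite (set_pmf (k a b))" for a b
    by (rule finite_subset[OF k(2)]) simp
  have tv: "(\<Sum>z\<in>seqs n \<times> seqs n. \<bar>pmf p z - pmf q z\<bar>) = tv"
  proof -
    have "(\<Sum>z\<in>seqs n \<times> seqs n. \<bar>pmf p z - pmf q z\<bar>) = (\<Sum>w\<in>seqs n. \<bar>pmf p (unzip n w) - pmf q (unzip n w)\<bar>)"
      by (rule sum.reindex_bij_betw[OF bij_betw_unzip, symmetric])
    also have "\<dots> = tv"
      unfolding tv_def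
    proof (rule sum.cong[OF refl])
      fix w :: "nat \<Rightarrow> 'se \<times> 's" assume w: "w \<in> seqs n"
      have "pmf p (unzip n w) = pmf pbar w" "pmf q (unzip n w) = pmf (prod_law n (\<lambda>_. P)) w"
        unfolding p_def q_def
        by (rule pmf_map_inj_on[OF inj_on_unzip pbar_sub w], rule pmf_map_inj_on[OF inj_on_unzip set_prod_law_subset w])
      moreover have "pmf pbar w = (\<Sum>mg\<in>M. pmf (prod_law n (\<lambda>i. map_pmf ?a (K (c mg i)))) w) / card M"
        unfolding pbar_def using M by (simp add: pmf_bind_pmf_of_set)
      ultimately show "\<bar>pmf p (unzip n w) - pmf q (unzip n w)\<bar> =
        \<bar>(\<Sum>mg\<in>M. pmf (prod_law n (\<lambda>i. map_pmf ?a (K (c mg i)))) w) / card M - pmf (prod_law n (\<lambda>_. P)) w\<bar>"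
        by simp
    qed
    finally show ?thesis .
  qed
  define f where "f = (\<lambda>i m g se. xf (c (m, g) i) (se (i::nat)))"
  define est where "est = (\<lambda>(g::nat) x se z. bind_pmf (prod_law n (\<lambda>i. V (x i) (se i) (z i))) (k se))"
  let ?J = "code_law P W n R Rc f dec est"
  have J: "?J = bind_pmf (pmf_of_set M) (\<lambda>mg. bind_pmf (?K mg) (\<lambda>w.
        map_pmf (\<lambda>sh. (fst mg, dec (comap n ?y w) (snd mg), comap n ?se w, comap n ?s w, sh))
          (k (comap n ?se w) (comap n ?sh w))))"
    unfolding f_def est_def M_def K_def by (rule code_law_channel_kernel[OF R])
  have fin_K: "finite (set_pmf (?K mg))" for mg
    by (simp add: K_def)
  have p_eq: "p = bind_pmf (pmf_of_set M) (\<lambda>mg. map_pmf (\<lambda>w. (comap n ?se w, comap n ?sh w)) (?K mg))"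
    unfolding p_def pbar_def
    by (simp add: map_bind_pmf prod_law_comap[symmetric] map_pmf_comp unzip_def case_prod_unfold cong: restrict_cong)
  have "is_code n R Rc dec est"
  proof -
    have "set_pmf (est g x se z) \<subseteq> seqs n" for g x se z
    proof -
      have "set_pmf (k se sh) \<subseteq> seqs n" if "sh \<in> set_pmf (prod_law n (\<lambda>i. V (x i) (se i) (z i)))" for sh
        using k(2)[of se sh] that set_prod_law_subset[of n "\<lambda>i. V (x i) (se i) (z i)"] by blast
      then show ?thesis unfolding est_def set_bind_pmf by blast
    qed
    then show ?thesis using R dec by (auto simp: is_code_def simp del: PiE_iff)
  qed
  moreover have "measure_pmf.prob ?J {(m, mh, se, s, sh). m \<noteq> mh} =
       (\<Sum>mg\<in>M. measure_pmf.prob (prod_law n (\<lambda>i. map_pmf ?y (K (c mg i)))) {y. dec y (snd mg) \<noteq> fst mg}) / card M"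
  proof -
    have "measure_pmf.prob ?J {(m, mh, se, s, sh). m \<noteq> mh}
        = measure_pmf.prob (map_pmf (\<lambda>(m, mh, se, s, sh). m \<noteq> mh) ?J) {True}"
      by (auto intro!: arg_cong[of _ _ "measure_pmf.prob ?J"])
    also have "map_pmf (\<lambda>(m, mh, se, s, sh). m \<noteq> mh) ?J = bind_pmf (pmf_of_set M) (\<lambda>mg.
        map_pmf (\<lambda>y. fst mg \<noteq> dec y (snd mg)) (prod_law n (\<lambda>i. map_pmf ?y (K (c mg i)))))"
      unfolding J by (simp add: map_bind_pmf map_pmf_comp prod_law_comap[symmetric] map_pmf_def[symmetric])
    also have "measure_pmf.prob \<dots> {True} = (\<Sum>mg\<in>M. measure_pmf.prob (map_pmf (\<lambda>y. fst mg \<noteq> dec y (snd mg))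
         (prod_law n (\<lambda>i. map_pmf ?y (K (c mg i))))) {True}) / card M"
      using M by (simp add: measure_pmf_single pmf_bind_pmf_of_set)
    also have "\<dots> = (\<Sum>mg\<in>M. measure_pmf.prob (prod_law n (\<lambda>i. map_pmf ?y (K (c mg i)))) {y. dec y (snd mg) \<noteq> fst mg}) / card M"
      by (simp add: vimage_def eq_commute)
    finally show ?thesis .
  qed
  moreover have "map_pmf (\<lambda>(m, mh, se, s, sh). \<lambda>i\<in>{..<n}. (se i, sh i)) ?J = prod_law n (\<lambda>_. P)"
  proof -
    have "map_pmf (\<lambda>(m, mh, se, s, sh). \<lambda>i\<in>{..<n}. (se i, sh i)) ?J
        = map_pmf (rezip n) (map_pmf (\<lambda>(m, mh, se, s, sh). (se, sh)) ?J)"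
      by (simp add: map_pmf_comp rezip_def case_prod_unfold)
    also have "map_pmf (\<lambda>(m, mh, se, s, sh). (se, sh)) ?J = bind_pmf p (\<lambda>(a, b). map_pmf (Pair a) (k a b))"
      unfolding J p_eq by (simp add: map_bind_pmf map_pmf_comp bind_assoc_pmf bind_map_pmf)
    also have "map_pmf (rezip n) \<dots> = prod_law n (\<lambda>_. P)"
      unfolding k(1) q_def map_pmf_comp
      using set_prod_law_subset by (intro map_pmf_idI rezip_unzip) blast
    finally show ?thesis .
  qed
  moreover have "expn ?J (\<lambda>(m, mh, se, s, sh). (\<Sum>i<n. d (s i) (sh i)) / real n)
       \<le> (\<Sum>mg\<in>M. (\<Sum>i<n. expn (K (c mg i)) (\<lambda>(se, s, y, z, sh). d s sh)) / n) / card M + dmax * tv"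
  proof -
    have dm: "(\<Sum>i<n. d (s i) (sh i)) / real n \<le> dmax" for s sh
      using n sum_mono[of "{..<n}" "\<lambda>i. d (s i) (sh i)" "\<lambda>_. dmax"] d by (simp add: divide_le_eq mult.commute)
    have dmax: "0 \<le> dmax" using order_trans[OF d] .
    let ?D = "\<lambda>s sh. (\<Sum>i<n. d (s i) (sh i)) / real n"
    let ?pk = "\<lambda>w. measure_pmf.prob (k (comap n ?se w) (comap n ?sh w)) (- {comap n ?sh w})"
    have "expn ?J (\<lambda>(m, mh, se, s, sh). ?D s sh)
        = expn (pmf_of_set M) (\<lambda>mg. expn (?K mg) (\<lambda>w. expn (k (comap n ?se w) (comap n ?sh w)) (?D (comap n ?s w))))"
      unfolding J using M fin_K fin_k by (simp add: expn_bind)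
    also have "\<dots> \<le> expn (pmf_of_set M) (\<lambda>mg. expn (?K mg) (\<lambda>w. ?D (comap n ?s w) (comap n ?sh w) + dmax * ?pk w))"
    proof (intro expn_mono fin_K)
      fix w :: "nat \<Rightarrow> 'se \<times> 's \<times> 'y \<times> 'z \<times> 's"
      let ?k = "k (comap n ?se w) (comap n ?sh w)"
      let ?D' = "?D (comap n ?s w)"
      \<comment> \<open>Without a change the distortion is that of the simulated reconstruction;
        after a change it is bounded by \<open>dmax\<close>.\<close>
      have "expn ?k ?D' \<le> expn ?k (\<lambda>sh. ?D' (comap n ?sh w) + (dmax - ?D' (comap n ?sh w)) * indicator (- {comap n ?sh w}) sh)"
        using dm by (intro expn_mono fin_k) (auto simp: indicator_def)
      also have "\<dots> = ?D' (comap n ?sh w) + (dmax - ?D' (comap n ?sh w)) * ?pk w"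
        using fin_k by (simp add: expn_add)
      also have "\<dots> \<le> ?D' (comap n ?sh w) + dmax * ?pk w"
        using d(1) by (intro add_left_mono mult_right_mono) (auto intro!: sum_nonneg divide_nonneg_nonneg)
      finally show "expn ?k ?D' \<le> ?D' (comap n ?sh w) + dmax * ?pk w" .
    qed (use M in auto)
    also have "\<dots> = expn (pmf_of_set M) (\<lambda>mg. expn (?K mg) (\<lambda>w. ?D (comap n ?s w) (comap n ?sh w)))
        + dmax * expn (pmf_of_set M) (\<lambda>mg. expn (?K mg) ?pk)"
      using fin_K M by (simp add: expn_add)
    also have "expn (pmf_of_set M) (\<lambda>mg. expn (?K mg) ?pk) = expn p (\<lambda>(a, b). measure_pmf.prob (k a b) (- {b}))"
      unfolding p_eq using fin_K M by (simp add: expn_bind)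
    also have "dmax * \<dots> \<le> dmax * tv"
      using k(3) dmax unfolding tv by (rule mult_left_mono)
    also have "expn (pmf_of_set M) (\<lambda>mg. expn (?K mg) (\<lambda>w. ?D (comap n ?s w) (comap n ?sh w)))
      = (\<Sum>mg\<in>M. (\<Sum>i<n. expn (K (c mg i)) (\<lambda>(se, s, y, z, sh). d s sh)) / n) / card M"
    proof -
      have "expn (?K mg) (\<lambda>w. ?D (comap n ?s w) (comap n ?sh w))
        = (\<Sum>i<n. expn (K (c mg i)) (\<lambda>(se, s, y, z, sh). d s sh)) / n" for mg
      proof -
        have "expn (?K mg) (\<lambda>w. ?D (comap n ?s w) (comap n ?sh w))
            = (\<Sum>i<n. expn (?K mg) (\<lambda>w. d (?s (w i)) (?sh (w i)))) / n"
          using fin_K by (simp add: expn_sum)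
        also have "\<dots> = (\<Sum>i<n. expn (K (c mg i)) (\<lambda>w. d (?s w) (?sh w))) / n"
          using expn_prod_law_component[of _ n "\<lambda>i. K (c mg i)" "\<lambda>w. d (?s w) (?sh w)"] by simp
        finally show ?thesis by (simp add: case_prod_unfold)
      qed
      then show ?thesis by (simp only: expn_pmf_of_set[OF M(2,1)])
    qed
    finally show ?thesis by simp
  qed
  ultimately show thesis using that by blast
qed

section \<open>Choice of one good codebook\<close>

lemma pairwise_codebook_Pi_pmf:
  assumes "finite I" "finite (set_pmf Q)"
  shows "pairwise_codebook Q I (Pi_pmf I dflt (\<lambda>_. Q))"
proof -
  have "map_pmf (\<lambda>c. (c i, c j)) (Pi_pmf I dflt (\<lambda>_. Q)) = pair_pmf Q Q" if ij: "i \<in> I" "j \<in> I" "i \<noteq> j" for i j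
  proof -
    have "map_pmf (\<lambda>c. (c i, c j)) (Pi_pmf (insert i (I - {i})) dflt (\<lambda>_. Q)) = map_pmf (\<lambda>(y, f). (y, f j)) (pair_pmf Q (Pi_pmf (I - {i}) dflt (\<lambda>_. Q)))"
      using assms ij by (subst Pi_pmf_insert) (simp_all add: map_pmf_comp case_prod_unfold)
    also have "\<dots> = pair_pmf (map_pmf id Q) (map_pmf (\<lambda>f. f j) (Pi_pmf (I - {i}) dflt (\<lambda>_. Q)))"
      by (subst map_pair[symmetric]) simp
    also have "\<dots> = pair_pmf Q Q"
      using assms ij by (simp add: Pi_pmf_component)
    finally show ?thesis using ij by (simp add: insert_absorb)
  qed
  then show ?thesis
    using assms by (simp add: pairwise_codebook_def Pi_pmf_component)
qed

lemma pairwise_codebook_map: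
  assumes "pairwise_codebook Q M C" "inj_on h I" "h ` I \<subseteq> M"
  shows "pairwise_codebook Q I (map_pmf (\<lambda>c i. c (h i)) C)"
proof -
  have "map_pmf (\<lambda>c. (c (h i), c (h j))) C = pair_pmf Q Q" if "i \<in> I" "j \<in> I" "i \<noteq> j" for i j
  proof -
    have "h i \<in> M" "h j \<in> M" "h i \<noteq> h j" using assms(2,3) that by (auto dest: inj_onD)
    then show ?thesis using assms(1) by (simp add: pairwise_codebook_def)
  qed
  then show ?thesis
    using assms by (auto simp: pairwise_codebook_def map_pmf_comp image_subset_iff)
qed

lemma powr_nat_mult: "0 < x \<Longrightarrow> x powr (real n * a) = (x powr a) ^ n"
  by (simp add: powr_powr[symmetric] powr_realpow mult.commute[of "real n"])

lemma exists_le_expn: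
  assumes "finite (set_pmf p)"
  shows "\<exists>x\<in>set_pmf p. f x \<le> expn p f"
proof (rule ccontr)
  assume "\<not> ?thesis"
  then have *: "\<And>x. x \<in> set_pmf p \<Longrightarrow> expn p f < f x" by (auto simp: not_le)
  have "(\<Sum>x\<in>set_pmf p. pmf p x * expn p f) < (\<Sum>x\<in>set_pmf p. pmf p x * f x)"
    using assms set_pmf_not_empty * by (intro sum_strict_mono) (auto simp: pmf_positive_iff)
  then show False
    using assms by (simp add: expn_finite sum_distrib_right[symmetric] sum_pmf_eq_1)
qed

text \<open>The case \<open>R = 0\<close> is separate: with a single message there is nothing to
  decode, so no gap below I(U; Y) is asked for, which matters when this information is 0.\<close>

lemma achievable_single_letter:
  fixes P :: "('se::finite \<times> 's::finite) pmf" and W :: "'x::finite \<Rightarrow> 's \<Rightarrow> ('y::finite \<times> 'z::finite) pmf"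
    and Q :: "'u pmf" and xf :: "'u \<Rightarrow> 'se \<Rightarrow> 'x" and V :: "'x \<Rightarrow> 'se \<Rightarrow> 'z \<Rightarrow> 's pmf"
  defines "K \<equiv> channel_kernel P W xf V"
  defines "Ky \<equiv> \<lambda>u. map_pmf (\<lambda>(se, s, y, z, sh). y) (K u)"
    and "Ka \<equiv> \<lambda>u. map_pmf (\<lambda>(se, s, y, z, sh). (se, sh)) (K u)"
  assumes Q: "finite (set_pmf Q)" and dp: "bind_pmf Q Ka = P" and d: "\<And>s sh. 0 \<le> d s sh"
    and R: "0 \<le> R" "0 \<le> Rc"
    and Iy: "R = 0 \<or> R < expn (bind_pmf Q (\<lambda>u. map_pmf (Pair u) (Ky u)))
        (\<lambda>(u, y). log 2 (pmf (Ky u) y / pmf (bind_pmf Q Ky) y))"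
    and Ia: "expn (bind_pmf Q (\<lambda>u. map_pmf (Pair u) (Ka u)))
        (\<lambda>(u, a). log 2 (pmf (Ka u) a / pmf (bind_pmf Q Ka) a)) < R + Rc"
    and D: "expn (bind_pmf Q K) (\<lambda>(se, s, y, z, sh). d s sh) < D"
  shows "achievable P W d R Rc D"
  unfolding achievable_def
proof (intro allI impI)
  fix \<epsilon> :: real assume \<epsilon>: "0 < \<epsilon>"
  \<comment> \<open>The sum of all values is a crude upper bound of the distortion; finiteness is
    all that matters.\<close>
  define dmax where "dmax = (\<Sum>(s, sh)\<in>UNIV. d s sh)"
  have dmax: "d s sh \<le> dmax" for s sh
    unfolding dmax_def using member_le_sum[of "(s, sh)" UNIV "\<lambda>(s, sh). d s sh"] d by auto
  have dmax0: "0 \<le> dmax" using order_trans[OF d dmax] .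
  define D0 where "D0 = expn (bind_pmf Q K) (\<lambda>(se, s, y, z, sh). d s sh)"
  have D0: "0 \<le> D0" unfolding D0_def by (intro expn_nonneg) (auto simp: d)
  have Dpos: "0 < D" using D0 D by (simp add: D0_def)
  have fK: "finite (set_pmf (K u))" "finite (set_pmf (Ky u))" "finite (set_pmf (Ka u))" for u
    by (simp_all add: K_def Ky_def Ka_def)
  \<comment> \<open>Covering threshold strictly between I(U; S_hat, S_e) and the total rate;
    likewise \<alpha> below lies between \<open>R\<close> and I(U; Y) as the decoding
    threshold.\<close>
  obtain \<beta> where \<beta>: "expn (bind_pmf Q (\<lambda>u. map_pmf (Pair u) (Ka u)))
        (\<lambda>(u, a). log 2 (pmf (Ka u) a / pmf (bind_pmf Q Ka) a)) < \<beta>" "\<beta> < R + Rc"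
    using dense[OF Ia] by blast
  obtain \<alpha> where \<alpha>: "R \<noteq> 0 \<Longrightarrow> \<alpha> < expn (bind_pmf Q (\<lambda>u. map_pmf (Pair u) (Ky u)))
        (\<lambda>(u, y). log 2 (pmf (Ky u) y / pmf (bind_pmf Q Ky) y))" "R \<noteq> 0 \<Longrightarrow> R < \<alpha>"
    using Iy dense by (cases "R = 0") blast+
  define low where "low = (\<lambda>n. expn (prod_law n (\<lambda>_. Q)) (\<lambda>u. measure_pmf.prob (prod_law n (\<lambda>i. Ky (u i)))
     {y. \<not> 2 powr (real n * \<alpha>) * pmf (prod_law n (\<lambda>_. bind_pmf Q Ky)) y < pmf (prod_law n (\<lambda>i. Ky (u i))) y}))"
  define high where "high = (\<lambda>n. expn (prod_law n (\<lambda>_. Q)) (\<lambda>u. measure_pmf.prob (prod_law n (\<lambda>i. Ka (u i)))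
     {y. 2 powr (real n * \<beta>) * pmf (prod_law n (\<lambda>_. bind_pmf Q Ka)) y < pmf (prod_law n (\<lambda>i. Ka (u i))) y}))"
  define a where "a = (\<lambda>n. if R = 0 then 0 else low n + (2 powr (R - \<alpha>)) ^ n)"
  \<comment> \<open>The 4 stems from rounding down both index sets, each by at most a factor
    2.\<close>
  define b where "b = (\<lambda>n. 2 * high n + sqrt (4 * (2 powr (\<beta> - (R + Rc))) ^ n))"
  have a_lim: "a \<longlonglongrightarrow> 0"
  proof (cases "R = 0")
    case False
    have "low \<longlonglongrightarrow> 0" unfolding low_def by (rule info_density_low[OF Q fK(2) \<alpha>(1)[OF False]])
    moreover have "(\<lambda>n. (2 powr (R - \<alpha>)) ^ n) \<longlonglongrightarrow> 0"
      using \<alpha>(2)[OF False] powr_less_mono[of "R - \<alpha>" 0 2] by (intro LIMSEQ_power_zero) auto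
    ultimately have "(\<lambda>n. low n + (2 powr (R - \<alpha>)) ^ n) \<longlonglongrightarrow> 0 + 0" by (rule tendsto_add)
    then show ?thesis using False by (simp add: a_def)
  qed (simp add: a_def)
  have b_lim: "b \<longlonglongrightarrow> 0"
  proof -
    have "high \<longlonglongrightarrow> 0" unfolding high_def by (rule info_density_high[OF Q fK(3) \<beta>(1)])
    moreover have "(\<lambda>n. (2 powr (\<beta> - (R + Rc))) ^ n) \<longlonglongrightarrow> 0"
      using \<beta>(2) powr_less_mono[of "\<beta> - (R + Rc)" 0 2] by (intro LIMSEQ_power_zero) auto
    ultimately have "b \<longlonglongrightarrow> 2 * 0 + sqrt (4 * 0)"
      unfolding b_def
      by (intro tendsto_add tendsto_mult[OF tendsto_const] tendsto_real_sqrt)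
    then show ?thesis by simp
  qed
  \<comment> \<open>The three criteria are merged into one mean. The weight D / \<epsilon> on the
    error is chosen so that a total below D forces the error below \<epsilon> and, at the same time,
    the distortion with its correction below D.\<close>
  have "(\<lambda>n. D0 + dmax * b n + D / \<epsilon> * a n) \<longlonglongrightarrow> D0 + dmax * 0 + D / \<epsilon> * 0"
    by (intro tendsto_intros a_lim b_lim)
  then have "\<forall>\<^sub>F n in sequentially. D0 + dmax * b n + D / \<epsilon> * a n < D"
    using D by (intro order_tendstoD(2)) (auto simp: D0_def)
  then show "\<forall>\<^sub>F n in sequentially. \<exists>f dec est.
        is_code n R Rc dec est \<and>
        (let J = code_law P W n R Rc f dec est in
           measure_pmf.prob J {(m, mh, se, s, sh). m \<noteq> mh} \<le> \<epsilon> \<and>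
           measure_pmf.expectation J (\<lambda>(m, mh, se, s, sh). (\<Sum>i<n. d (s i) (sh i)) / real n) \<le> D \<and>
           map_pmf (\<lambda>(m, mh, se, s, sh). \<lambda>i\<in>{..<n}. (se i, sh i)) J = prod_law n (\<lambda>_. P))"
    using eventually_gt_at_top[of 0]
  proof eventually_elim
    case (elim n)
    let ?I = "index_set n R" and ?G = "index_set n Rc" and ?Q = "prod_law n (\<lambda>_. Q)"
    let ?Ky = "\<lambda>u. prod_law n (\<lambda>i. Ky (u i))" and ?Ka = "\<lambda>u. prod_law n (\<lambda>i. Ka (u i))"
    define M where "M = ?I \<times> ?G"
    have M: "finite M" "M \<noteq> {}" using index_set_bounds R by (auto simp: M_def)
    have cardM: "0 < real (card M)" using M by (simp add: card_gt_0_iff)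
    define T where "T = (\<lambda>u y. 2 powr (real n * \<alpha>) * pmf (bind_pmf ?Q ?Ky) y < pmf (?Ky u) y)"
    define dec where "dec = (\<lambda>c y (g::nat). threshold_dec T ?I (\<lambda>m. c (m, g)) y)"
    have dec_in: "dec c y g \<in> ?I" for c y g
      unfolding dec_def by (rule threshold_dec_in) (use index_set_bounds R in auto)
    define F1 where "F1 = (\<lambda>c. (\<Sum>mg\<in>M. measure_pmf.prob (?Ky (c mg)) {y. dec c y (snd mg) \<noteq> fst mg}) / card M)"
    define F2 where "F2 = (\<lambda>c. \<Sum>w\<in>seqs n. \<bar>(\<Sum>mg\<in>M. pmf (?Ka (c mg)) w) / card M - pmf (prod_law n (\<lambda>_. P)) w\<bar>)"
    define F3 where "F3 = (\<lambda>c. (\<Sum>mg\<in>M. (\<Sum>i<n. expn (K (c mg i)) (\<lambda>(se, s, y, z, sh). d s sh)) / n) / card M)"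
    define C where "C = Pi_pmf M undefined (\<lambda>_. ?Q)"
    have fQ: "finite (set_pmf ?Q)" using Q by simp
    have C: "pairwise_codebook ?Q M C"
      unfolding C_def by (rule pairwise_codebook_Pi_pmf[OF M(1) fQ])
    then have fC: "finite (set_pmf C)" by (simp add: pairwise_codebook_def)
    have EF1: "expn C F1 \<le> a n"
    proof (cases "R = 0")
      case True
      then have I: "?I = {1}" by (simp add: index_set_def)
      have "F1 c = 0" for c
        using dec_in[of c] unfolding F1_def M_def I by (auto intro!: sum.neutral)
      then have "F1 = (\<lambda>_. 0)" by (rule ext)
      then show ?thesis by (simp add: a_def True)
    next
      case False
      have each: "expn C (\<lambda>c. measure_pmf.prob (?Ky (c mg)) {y. dec c y (snd mg) \<noteq> fst mg}) \<le> a n" if mgM: "mg \<in> M" for mg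
      proof -
        obtain m g where mg: "mg = (m, g)" "m \<in> ?I" "g \<in> ?G" using mgM by (auto simp: M_def)
        \<comment> \<open>Once the common randomness \<open>g\<close> is fixed, the decoder compares
          only the codewords indexed by (m, g), which again form a pairwise independent
          codebook.\<close>
        have "expn C (\<lambda>c. measure_pmf.prob (?Ky (c mg)) {y. dec c y (snd mg) \<noteq> fst mg})
            = expn (map_pmf (\<lambda>c m. c (m, g)) C) (\<lambda>c. measure_pmf.prob (?Ky (c m)) {y. threshold_dec T ?I c y \<noteq> m})"
          by (simp add: dec_def mg)
        also have "\<dots> \<le> expn ?Q (\<lambda>u. measure_pmf.prob (?Ky u) {y. \<not> T u y}) + card ?I / 2 powr (real n * \<alpha>)"
          by (rule random_coding) (use mg fK T_def in \<open>auto intro!: pairwise_codebook_map[OF C] simp: M_def inj_on_def\<close>)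
        also have "expn ?Q (\<lambda>u. measure_pmf.prob (?Ky u) {y. \<not> T u y}) = low n"
          by (simp add: low_def T_def prod_law_kernel)
        also have "card ?I / 2 powr (real n * \<alpha>) \<le> 2 powr (real n * R) / 2 powr (real n * \<alpha>)"
          using index_set_bounds(2)[OF R(1)] by (intro divide_right_mono) auto
        also have "\<dots> = 2 powr (real n * (R - \<alpha>))"
          by (simp add: powr_diff right_diff_distrib)
        also have "\<dots> = (2 powr (R - \<alpha>)) ^ n" by (rule powr_nat_mult) simp
        finally show ?thesis using False by (simp add: a_def)
      qed
      have "expn C F1 = (\<Sum>mg\<in>M. expn C (\<lambda>c. measure_pmf.prob (?Ky (c mg)) {y. dec c y (snd mg) \<noteq> fst mg})) / card M"
        unfolding F1_def using fC by (simp add: expn_sum)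
      also have "\<dots> \<le> (\<Sum>mg\<in>M. a n) / card M"
        using each cardM by (intro divide_right_mono sum_mono) auto
      finally show ?thesis using cardM by simp
    qed
    have EF2: "expn C F2 \<le> b n"
    proof -
      have bindQ: "bind_pmf ?Q ?Ka = prod_law n (\<lambda>_. P)"
        by (simp add: prod_law_kernel[symmetric] dp)
      have "expn C F2 \<le> 2 * expn ?Q (\<lambda>u. measure_pmf.prob (?Ka u) {w. 2 powr (real n * \<beta>) * pmf (bind_pmf ?Q ?Ka) w < pmf (?Ka u) w})
          + sqrt (2 powr (real n * \<beta>) / card M)"
        unfolding F2_def bindQ[symmetric]
        by (rule soft_covering[OF C M finite_seqs set_prod_law_subset]) simp
      also have "expn ?Q (\<lambda>u. measure_pmf.prob (?Ka u) {w. 2 powr (real n * \<beta>) * pmf (bind_pmf ?Q ?Ka) w < pmf (?Ka u) w}) = high n"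
        by (simp add: high_def prod_law_kernel)
      also have "2 powr (real n * \<beta>) / card M \<le> 4 * (2 powr (\<beta> - (R + Rc))) ^ n"
      proof -
        have "2 powr (real n * R) / 2 * (2 powr (real n * Rc) / 2) \<le> real (card ?I) * real (card ?G)"
          using index_set_bounds(3) R by (intro mult_mono) auto
        then have L: "2 powr (real n * (R + Rc)) / 4 \<le> real (card M)"
          by (simp add: M_def card_cartesian_product powr_add distrib_left)
        have "2 powr (real n * \<beta>) / card M \<le> 2 powr (real n * \<beta>) / (2 powr (real n * (R + Rc)) / 4)"
          using L cardM by (intro divide_left_mono) auto
        also have "\<dots> = 4 * 2 powr (real n * (\<beta> - (R + Rc)))"
          by (simp add: powr_diff right_diff_distrib)
        also have "2 powr (real n * (\<beta> - (R + Rc))) = (2 powr (\<beta> - (R + Rc))) ^ n"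
          by (rule powr_nat_mult) simp
        finally show ?thesis .
      qed
      finally show ?thesis by (simp add: b_def)
    qed
    have EF3: "expn C F3 = D0"
    proof -
      have each: "expn C (\<lambda>c. (\<Sum>i<n. expn (K (c mg i)) (\<lambda>(se, s, y, z, sh). d s sh)) / n) = D0" if "mg \<in> M" for mg
      proof -
        have "expn C (\<lambda>c. (\<Sum>i<n. expn (K (c mg i)) (\<lambda>(se, s, y, z, sh). d s sh)) / n)
            = expn ?Q (\<lambda>u. (\<Sum>i<n. expn (K (u i)) (\<lambda>(se, s, y, z, sh). d s sh)) / n)"
          by (rule codebook_expn[OF C that, of "\<lambda>u. (\<Sum>i<n. expn (K (u i)) (\<lambda>(se, s, y, z, sh). d s sh)) / n"])
        also have "\<dots> = (\<Sum>i<n. expn ?Q (\<lambda>u. expn (K (u i)) (\<lambda>(se, s, y, z, sh). d s sh))) / n"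
          using fQ by (simp add: expn_sum)
        also have "\<dots> = (\<Sum>i<n. D0) / n"
          using expn_prod_law_component[of _ n "\<lambda>_. Q" "\<lambda>u. expn (K u) (\<lambda>(se, s, y, z, sh). d s sh)"] Q fK
          by (simp add: D0_def expn_bind)
        finally show ?thesis using elim by simp
      qed
      have "expn C F3 = (\<Sum>mg\<in>M. expn C (\<lambda>c. (\<Sum>i<n. expn (K (c mg i)) (\<lambda>(se, s, y, z, sh). d s sh)) / n)) / card M"
        unfolding F3_def using fC by (simp add: expn_sum)
      also have "\<dots> = D0" using each cardM by simp
      finally show ?thesis .
    qed
    have F0: "0 \<le> F1 c" "0 \<le> F2 c" "0 \<le> F3 c" for c
      unfolding F1_def F2_def F3_def
      by (auto intro!: sum_nonneg divide_nonneg_nonneg expn_nonneg simp: d)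
    obtain c where c: "F3 c + dmax * F2 c + D / \<epsilon> * F1 c \<le> expn C (\<lambda>c. F3 c + dmax * F2 c + D / \<epsilon> * F1 c)"
      using exists_le_expn[OF fC, of "\<lambda>c. F3 c + dmax * F2 c + D / \<epsilon> * F1 c"] by blast
    also have "\<dots> = expn C F3 + dmax * expn C F2 + D / \<epsilon> * expn C F1"
      using fC by (simp add: expn_add)
    also have "\<dots> \<le> D0 + dmax * b n + D / \<epsilon> * a n"
      using EF1 EF2 EF3 dmax0 Dpos \<epsilon> by (intro add_mono mult_left_mono) auto
    also have "\<dots> < D" by (rule elim)
    finally have total: "F3 c + dmax * F2 c + D / \<epsilon> * F1 c < D" .
    have "0 \<le> D / \<epsilon> * F1 c" using F0 Dpos \<epsilon> by simp
    then have dist: "F3 c + dmax * F2 c \<le> D" using total by linarith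
    have "0 \<le> F3 c + dmax * F2 c" using F0 dmax0 by simp
    then have "D / \<epsilon> * F1 c < D" using total by linarith
    then have err: "F1 c \<le> \<epsilon>" using Dpos \<epsilon> by (simp add: field_simps)
    obtain f est where fe: "is_code n R Rc (dec c) est"
      "measure_pmf.prob (code_law P W n R Rc f (dec c) est) {(m, mh, se, s, sh). m \<noteq> mh} = F1 c"
      "expn (code_law P W n R Rc f (dec c) est) (\<lambda>(m, mh, se, s, sh). (\<Sum>i<n. d (s i) (sh i)) / real n) \<le> F3 c + dmax * F2 c"
      "map_pmf (\<lambda>(m, mh, se, s, sh). \<lambda>i\<in>{..<n}. (se i, sh i)) (code_law P W n R Rc f (dec c) est) = prod_law n (\<lambda>_. P)"
      by (rule code_of_codebook[where c = c and d = d and dmax = dmax and dec = "dec c" and P = P and W = W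
            and xf = xf and V = V, OF R elim(2) dec_in d dmax])
        (rule that; simp only: F1_def F2_def F3_def M_def Ka_def Ky_def K_def)
    show ?case
      unfolding Let_def using fe(1,4) err order_trans[OF fe(3) dist]
      by (intro exI[of _ f] exI[of _ "dec c"] exI[of _ est] conjI) (simp_all only: fe(2))
  qed
qed

section \<open>From the random-coding estimates to the region\<close>

lemma mutual_info_inj:
  fixes A :: "'w \<Rightarrow> 'a::countable" and B :: "'w \<Rightarrow> 'b::countable"
    and h :: "'a \<Rightarrow> 'c::countable" and k :: "'b \<Rightarrow> 'd::countable"
  assumes fin: "finite (set_pmf J)" and "inj_on h (A ` set_pmf J)" "inj_on k (B ` set_pmf J)"
  shows "mutual_info J (\<lambda>w. h (A w)) (\<lambda>w. k (B w)) = mutual_info J A B"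
proof -
  have "inj_on (map_prod h k) ((\<lambda>w. (A w, B w)) ` set_pmf J)"
    using assms(2,3) by (auto simp: inj_on_def)
  from ent_inj[OF this] show ?thesis
    using assms by (simp add: mutual_info_ent ent_inj)
qed

text \<open>U is independent of the state pair, so it can be drawn first.\<close>

lemma single_letter_law_channel_kernel:
  "single_letter_law P W Q xf V =
    bind_pmf Q (\<lambda>u. map_pmf (\<lambda>(se, s, y, z, sh). (se, s, u, xf u se, y, z, sh)) (channel_kernel P W xf V u))"
proof -
  have "single_letter_law P W Q xf V = bind_pmf P (\<lambda>p. bind_pmf Q (\<lambda>u.
      bind_pmf (W (xf u (fst p)) (snd p)) (\<lambda>q. bind_pmf (V (xf u (fst p)) (fst p) (snd q)) (\<lambda>sh.
        return_pmf (fst p, snd p, u, xf u (fst p), fst q, snd q, sh)))))"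
    by (simp add: single_letter_law_def case_prod_unfold Let_def)
  also have "\<dots> = bind_pmf Q (\<lambda>u. bind_pmf P (\<lambda>p.
      bind_pmf (W (xf u (fst p)) (snd p)) (\<lambda>q. bind_pmf (V (xf u (fst p)) (fst p) (snd q)) (\<lambda>sh.
        return_pmf (fst p, snd p, u, xf u (fst p), fst q, snd q, sh)))))"
    by (rule bind_commute_pmf)
  finally show ?thesis
    by (simp add: channel_kernel_def map_bind_pmf map_pmf_comp map_pmf_def[symmetric] bind_return_pmf
        case_prod_unfold)
qed

lemma single_letter_quantities:
  fixes P :: "('se::finite \<times> 's::finite) pmf" and W :: "'x::finite \<Rightarrow> 's \<Rightarrow> ('y::finite \<times> 'z::finite) pmf"
    and Q :: "nat pmf"
  defines "K \<equiv> \<lambda>xf V. channel_kernel P W xf V"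
  defines "Ky \<equiv> \<lambda>xf V u. map_pmf (\<lambda>(se, s, y, z, sh). y) (K xf V u)"
    and "Ka \<equiv> \<lambda>xf V u. map_pmf (\<lambda>(se, s, y, z, sh). (se, sh)) (K xf V u)"
  assumes Q: "finite (set_pmf Q)" and J: "J = single_letter_law P W Q xf V"
  shows "finite (set_pmf J)"
    "map_pmf (\<lambda>(se, s, u, x, y, z, sh). (se, sh)) J = bind_pmf Q (Ka xf V)"
    "mutual_info J (\<lambda>(se, s, u, x, y, z, sh). u) (\<lambda>(se, s, u, x, y, z, sh). y) =
       expn (bind_pmf Q (\<lambda>u. map_pmf (Pair u) (Ky xf V u)))
        (\<lambda>(u, y). log 2 (pmf (Ky xf V u) y / pmf (bind_pmf Q (Ky xf V)) y))"
    "mutual_info J (\<lambda>(se, s, u, x, y, z, sh). u) (\<lambda>(se, s, u, x, y, z, sh). (sh, se)) =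
       expn (bind_pmf Q (\<lambda>u. map_pmf (Pair u) (Ka xf V u)))
        (\<lambda>(u, a). log 2 (pmf (Ka xf V u) a / pmf (bind_pmf Q (Ka xf V)) a))"
    "expn J (\<lambda>(se, s, u, x, y, z, sh). d s sh) = expn (bind_pmf Q (K xf V)) (\<lambda>(se, s, y, z, sh). d s sh)"
proof -
  have J': "J = bind_pmf Q (\<lambda>u. map_pmf (\<lambda>(se, s, y, z, sh). (se, s, u, xf u se, y, z, sh)) (K xf V u))"
    unfolding J K_def by (rule single_letter_law_channel_kernel)
  show fin: "finite (set_pmf J)"
    unfolding J' using Q by (simp add: K_def)
  show "map_pmf (\<lambda>(se, s, u, x, y, z, sh). (se, sh)) J = bind_pmf Q (Ka xf V)"
    unfolding J' Ka_def by (simp add: map_bind_pmf map_pmf_comp case_prod_unfold)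
  have "map_pmf (\<lambda>w. (case w of (se, s, u, x, y, z, sh) \<Rightarrow> u, case w of (se, s, u, x, y, z, sh) \<Rightarrow> y)) J
      = bind_pmf Q (\<lambda>u. map_pmf (Pair u) (Ky xf V u))"
    unfolding J' Ky_def by (simp add: map_bind_pmf map_pmf_comp case_prod_unfold)
  from mutual_info_channel[OF fin this]
  show "mutual_info J (\<lambda>(se, s, u, x, y, z, sh). u) (\<lambda>(se, s, u, x, y, z, sh). y) =
       expn (bind_pmf Q (\<lambda>u. map_pmf (Pair u) (Ky xf V u)))
        (\<lambda>(u, y). log 2 (pmf (Ky xf V u) y / pmf (bind_pmf Q (Ky xf V)) y))" .
  have "map_pmf (\<lambda>w. (case w of (se, s, u, x, y, z, sh) \<Rightarrow> u, case w of (se, s, u, x, y, z, sh) \<Rightarrow> (se, sh))) J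
      = bind_pmf Q (\<lambda>u. map_pmf (Pair u) (Ka xf V u))"
    unfolding J' Ka_def by (simp add: map_bind_pmf map_pmf_comp case_prod_unfold)
  from mutual_info_channel[OF fin this]
  have "mutual_info J (\<lambda>(se, s, u, x, y, z, sh). u) (\<lambda>(se, s, u, x, y, z, sh). (se, sh)) =
       expn (bind_pmf Q (\<lambda>u. map_pmf (Pair u) (Ka xf V u)))
        (\<lambda>(u, a). log 2 (pmf (Ka xf V u) a / pmf (bind_pmf Q (Ka xf V)) a))" .
  moreover have "mutual_info J (\<lambda>(se, s, u, x, y, z, sh). u) (\<lambda>(se, s, u, x, y, z, sh). (sh, se))
      = mutual_info J (\<lambda>(se, s, u, x, y, z, sh). u) (\<lambda>(se, s, u, x, y, z, sh). (se, sh))"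
    using mutual_info_inj[OF fin, of id "\<lambda>(se, s, u, x, y, z, sh). u" prod.swap "\<lambda>(se, s, u, x, y, z, sh). (se, sh)"]
    by (simp add: case_prod_unfold)
  ultimately show "mutual_info J (\<lambda>(se, s, u, x, y, z, sh). u) (\<lambda>(se, s, u, x, y, z, sh). (sh, se)) =
       expn (bind_pmf Q (\<lambda>u. map_pmf (Pair u) (Ka xf V u)))
        (\<lambda>(u, a). log 2 (pmf (Ka xf V u) a / pmf (bind_pmf Q (Ka xf V)) a))" by simp
  show "expn J (\<lambda>(se, s, u, x, y, z, sh). d s sh) = expn (bind_pmf Q (K xf V)) (\<lambda>(se, s, y, z, sh). d s sh)"
    unfolding J' using Q by (simp add: expn_bind K_def case_prod_unfold)
qed

text \<open>The strict inequalities of \<open>achievable_single_letter\<close> are bought with a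
  slack \<delta> that tends to 0. Lowering \<open>R\<close> uses up one \<delta> of the total rate,
  hence the surplus \<open>2 * \<delta>\<close> in \<open>Rc\<close>; the cut at 0 keeps the rate
  admissible.\<close>

lemma direct_part:
  fixes P :: "('se::finite \<times> 's::finite) pmf" and W :: "'x::finite \<Rightarrow> 's \<Rightarrow> ('y::finite \<times> 'z::finite) pmf"
  assumes d: "\<And>s sh. 0 \<le> d s sh" and R: "0 \<le> R" "0 \<le> Rc" and J: "J \<in> P_DE' P W"
    and Iy: "R \<le> mutual_info J (\<lambda>(se, s, u, x, y, z, sh). u) (\<lambda>(se, s, u, x, y, z, sh). y)"
    and Ia: "mutual_info J (\<lambda>(se, s, u, x, y, z, sh). u) (\<lambda>(se, s, u, x, y, z, sh). (sh, se)) \<le> R + Rc"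
    and D: "expn J (\<lambda>(se, s, u, x, y, z, sh). d s sh) \<le> D"
  shows "(R, Rc) \<in> capacity_distortion_region P W d D"
proof -
  obtain Q xf V where Q: "finite (set_pmf Q)" and Jeq: "J = single_letter_law P W Q xf V"
    and marg: "map_pmf (\<lambda>(se, s, u, x, y, z, sh). (se, sh)) J = P"
    using J by (auto simp: P_DE'_def P_tilde_def)
  note sl = single_letter_quantities[OF Q Jeq]
  have ach: "achievable P W d (max 0 (R - \<delta>)) (Rc + 2 * \<delta>) (D + \<delta>)" if \<delta>: "0 < \<delta>" for \<delta>
  proof (rule achievable_single_letter[OF Q])
    show "bind_pmf Q (\<lambda>u. map_pmf (\<lambda>(se, s, y, z, sh). (se, sh)) (channel_kernel P W xf V u)) = P"
      using sl(2) marg by simp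
  next
    show "max 0 (R - \<delta>) = 0 \<or> max 0 (R - \<delta>) < expn (bind_pmf Q (\<lambda>u. map_pmf (Pair u)
            (map_pmf (\<lambda>(se, s, y, z, sh). y) (channel_kernel P W xf V u))))
         (\<lambda>(u, y). log 2 (pmf (map_pmf (\<lambda>(se, s, y, z, sh). y) (channel_kernel P W xf V u)) y /
           pmf (bind_pmf Q (\<lambda>u. map_pmf (\<lambda>(se, s, y, z, sh). y) (channel_kernel P W xf V u))) y))"
      using Iy \<delta> unfolding sl(3) by linarith
  next
    show "expn (bind_pmf Q (\<lambda>u. map_pmf (Pair u)
            (map_pmf (\<lambda>(se, s, y, z, sh). (se, sh)) (channel_kernel P W xf V u))))
         (\<lambda>(u, a). log 2 (pmf (map_pmf (\<lambda>(se, s, y, z, sh). (se, sh)) (channel_kernel P W xf V u)) a /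
           pmf (bind_pmf Q (\<lambda>u. map_pmf (\<lambda>(se, s, y, z, sh). (se, sh)) (channel_kernel P W xf V u))) a))
        < max 0 (R - \<delta>) + (Rc + 2 * \<delta>)"
      using Ia \<delta> unfolding sl(4) by linarith
  next
    show "expn (bind_pmf Q (channel_kernel P W xf V)) (\<lambda>(se, s, y, z, sh). d s sh) < D + \<delta>"
      using D \<delta> unfolding sl(5) by linarith
  qed (use d R \<delta> in auto)
  let ?\<delta> = "\<lambda>k::nat. inverse (real (Suc k))"
  have "(\<lambda>k. (max 0 (R - ?\<delta> k), Rc + 2 * ?\<delta> k, D + ?\<delta> k)) \<longlonglongrightarrow> (max 0 (R - 0), Rc + 2 * 0, D + 0)"
    by (intro tendsto_intros LIMSEQ_inverse_real_of_nat)
  moreover have "(max 0 (R - 0), Rc + 2 * 0, D + 0) = (R, Rc, D)" using R by simp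
  ultimately have "(R, Rc, D) \<in> closure {(R', Rc', D'). achievable P W d R' Rc' D'}"
    unfolding closure_sequential using ach
    by (intro exI[of _ "\<lambda>k. (max 0 (R - ?\<delta> k), Rc + 2 * ?\<delta> k, D + ?\<delta> k)"]) auto
  then show ?thesis by (simp add: capacity_distortion_region_def)
qed

section \<open>The joint law of a causal code\<close>

text \<open>
  The auxiliary variable \<open>U\<^sub>i = (M, \<Gamma>, S\<^sub>e\<^sup>i\<^sup>-\<^sup>1)\<close> of the converse enters only through the map from the current
  side information to the current input. Using this map as auxiliary variable keeps its alphabet
  \<open>'se \<Rightarrow> 'x\<close> finite, so that no cardinality bound is needed.
\<close>

definition strat ::
  "(nat \<Rightarrow> nat \<Rightarrow> nat \<Rightarrow> (nat \<Rightarrow> 'se) \<Rightarrow> 'x) \<Rightarrow> nat \<times> nat \<Rightarrow> (nat \<Rightarrow> 'se \<times> 's) \<Rightarrow> nat \<Rightarrow> 'se \<Rightarrow> 'x" where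
  "strat f mg r i = (\<lambda>a. f i (fst mg) (snd mg) ((\<lambda>j\<in>{..<i}. fst (r j))(i := a)))"

lemma strat_cong: "(\<And>j. j < i \<Longrightarrow> fst (r j) = fst (r' j)) \<Longrightarrow> strat f mg r i = strat f mg r' i"
  by (simp add: strat_def cong: restrict_cong)

lemma encode_strat:
  assumes "i < n"
  shows "encode n f (fst mg) (snd mg) (comap n fst r) i = strat f mg r i (fst (r i))"
proof -
  have "restrict (comap n fst r) {..i} = (\<lambda>j\<in>{..<i}. fst (r j))(i := fst (r i))"
    using assms by (auto simp: fun_eq_iff)
  then show ?thesis using assms by (simp add: encode_def strat_def)
qed

text \<open>The sample space of the converse: the raw variables of which \<open>code_law\<close>
  keeps only functions, with the inputs expressed through strategies.\<close>

definition process_law ::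
  "('se \<times> 's) pmf \<Rightarrow> ('x \<Rightarrow> 's \<Rightarrow> ('y \<times> 'z) pmf) \<Rightarrow> nat
    \<Rightarrow> (nat \<Rightarrow> nat \<Rightarrow> nat \<Rightarrow> (nat \<Rightarrow> 'se) \<Rightarrow> 'x)
    \<Rightarrow> (nat \<Rightarrow> (nat \<Rightarrow> 'x) \<Rightarrow> (nat \<Rightarrow> 'se) \<Rightarrow> (nat \<Rightarrow> 'z) \<Rightarrow> (nat \<Rightarrow> 's) pmf) \<Rightarrow> (nat \<times> nat) set
    \<Rightarrow> ((nat \<times> nat) \<times> (nat \<Rightarrow> 'se \<times> 's) \<times> (nat \<Rightarrow> 'y \<times> 'z) \<times> (nat \<Rightarrow> 's)) pmf" where
  "process_law P W n f est M = do {
     mg \<leftarrow> pmf_of_set M;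
     ses \<leftarrow> prod_law n (\<lambda>_. P);
     yz \<leftarrow> prod_law n (\<lambda>i. W (strat f mg ses i (fst (ses i))) (snd (ses i)));
     map_pmf (\<lambda>sh. (mg, ses, yz, sh))
       (est (snd mg) (encode n f (fst mg) (snd mg) (comap n fst ses)) (comap n fst ses) (comap n snd yz)) }"

lemma code_law_process_law:
  assumes R: "0 \<le> R" "0 \<le> Rc"
  shows "code_law P W n R Rc f dec est =
    map_pmf (\<lambda>(mg, ses, yz, sh). (fst mg, dec (comap n fst yz) (snd mg), comap n fst ses, comap n snd ses, sh))
      (process_law P W n f est (index_set n R \<times> index_set n Rc))"
proof -
  have W: "prod_law n (\<lambda>i. W (encode n f m g (comap n fst ses) i) (comap n snd ses i))
      = prod_law n (\<lambda>i. W (strat f (m, g) ses i (fst (ses i))) (snd (ses i)))" for m g and ses :: "nat \<Rightarrow> _"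
    by (rule Pi_pmf_cong) (auto simp: encode_strat[of _ n f "(m, g)", simplified])
  have M: "pmf_of_set (index_set n R \<times> index_set n Rc) = pair_pmf (pmf_of_set (index_set n R)) (pmf_of_set (index_set n Rc))"
    using index_set_bounds R by (intro pmf_of_set_Times) auto
  show ?thesis
    unfolding code_law_def process_law_def Let_def W M pair_pmf_def map_pmf_def bind_assoc_pmf bind_return_pmf
      prod.case fst_conv snd_conv by (rule refl)
qed

definition prefix_law ::
  "('se \<times> 's) pmf \<Rightarrow> ('x \<Rightarrow> 's \<Rightarrow> ('y \<times> 'z) pmf)
    \<Rightarrow> (nat \<Rightarrow> nat \<Rightarrow> nat \<Rightarrow> (nat \<Rightarrow> 'se) \<Rightarrow> 'x) \<Rightarrow> (nat \<times> nat) set \<Rightarrow> nat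
    \<Rightarrow> ((nat \<times> nat) \<times> (nat \<Rightarrow> 'se \<times> 's) \<times> (nat \<Rightarrow> 'y \<times> 'z)) pmf" where
  "prefix_law P W f M k = do {
     mg \<leftarrow> pmf_of_set M;
     ses \<leftarrow> prod_law k (\<lambda>_. P);
     yz \<leftarrow> prod_law k (\<lambda>i. W (strat f mg ses i (fst (ses i))) (snd (ses i)));
     return_pmf (mg, ses, yz) }"

lemma prod_law_restrict:
  assumes "k \<le> n"
  shows "map_pmf (\<lambda>w. restrict w {..<k}) (prod_law n p) = prod_law k p"
  using Pi_pmf_subset[of "{..<n}" "{..<k}" undefined p] assms by (simp add: restrict_def)

text \<open>This is causality: inputs before time \<open>k\<close> depend only on states before time
  \<open>k\<close>, so the past can be generated without the future. The estimator acts at the end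
  and drops out.\<close>

lemma process_law_prefix:
  assumes k: "k \<le> n"
  shows "map_pmf (\<lambda>(mg, ses, yz, sh). (mg, restrict ses {..<k}, restrict yz {..<k})) (process_law P W n f est M)
    = prefix_law P W f M k"
proof -
  let ?h = "\<lambda>mg ses. bind_pmf (prod_law k (\<lambda>i. W (strat f mg ses i (fst (ses i))) (snd (ses i)))) (\<lambda>yz. return_pmf (mg, ses, yz))"
  have W: "prod_law k (\<lambda>i. W (strat f mg ses i (fst (ses i))) (snd (ses i)))
     = prod_law k (\<lambda>i. W (strat f mg (restrict ses {..<k}) i (fst (restrict ses {..<k} i))) (snd (restrict ses {..<k} i)))"
    for mg and ses :: "nat \<Rightarrow> _"
  proof (rule Pi_pmf_cong)
    fix i assume i: "i \<in> {..<k}"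
    have "strat f mg ses i = strat f mg (restrict ses {..<k}) i"
      using i by (intro strat_cong) auto
    then show "W (strat f mg ses i (fst (ses i))) (snd (ses i))
       = W (strat f mg (restrict ses {..<k}) i (fst (restrict ses {..<k} i))) (snd (restrict ses {..<k} i))"
      using i by simp
  qed auto
  have "map_pmf (\<lambda>(mg, ses, yz, sh). (mg, restrict ses {..<k}, restrict yz {..<k})) (process_law P W n f est M)
    = bind_pmf (pmf_of_set M) (\<lambda>mg. bind_pmf (prod_law n (\<lambda>_. P)) (\<lambda>ses.
        map_pmf (\<lambda>yz. (mg, restrict ses {..<k}, restrict yz {..<k}))
          (prod_law n (\<lambda>i. W (strat f mg ses i (fst (ses i))) (snd (ses i))))))"
    by (simp add: process_law_def map_bind_pmf map_pmf_comp) (simp add: map_pmf_def)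
  also have "\<dots> = bind_pmf (pmf_of_set M) (\<lambda>mg. bind_pmf (prod_law n (\<lambda>_. P)) (\<lambda>ses. ?h mg (restrict ses {..<k})))"
  proof (intro bind_pmf_cong refl)
    fix mg and ses :: "nat \<Rightarrow> _"
    have "map_pmf (\<lambda>yz. (mg, restrict ses {..<k}, restrict yz {..<k}))
          (prod_law n (\<lambda>i. W (strat f mg ses i (fst (ses i))) (snd (ses i))))
        = map_pmf (\<lambda>yz. (mg, restrict ses {..<k}, yz)) (map_pmf (\<lambda>yz. restrict yz {..<k})
          (prod_law n (\<lambda>i. W (strat f mg ses i (fst (ses i))) (snd (ses i)))))"
      by (simp add: map_pmf_comp)
    also have "\<dots> = ?h mg (restrict ses {..<k})"
      unfolding prod_law_restrict[OF k] W[of mg ses] by (simp add: map_pmf_def)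
    finally show "map_pmf (\<lambda>yz. (mg, restrict ses {..<k}, restrict yz {..<k}))
          (prod_law n (\<lambda>i. W (strat f mg ses i (fst (ses i))) (snd (ses i)))) = ?h mg (restrict ses {..<k})" .
  qed
  also have "\<dots> = bind_pmf (pmf_of_set M) (\<lambda>mg. bind_pmf (map_pmf (\<lambda>w. restrict w {..<k}) (prod_law n (\<lambda>_. P))) (?h mg))"
    by (simp add: bind_map_pmf)
  also have "\<dots> = prefix_law P W f M k"
    unfolding prod_law_restrict[OF k] prefix_law_def ..
  finally show ?thesis .
qed

lemma Pi_pmf_split:
  assumes "finite A" "i \<in> A"
  shows "Pi_pmf A d p = bind_pmf (Pi_pmf (A - {i}) d p) (\<lambda>r. map_pmf (\<lambda>a. r(i := a)) (p i))"
    and "Pi_pmf A d p = bind_pmf (p i) (\<lambda>a. map_pmf (\<lambda>r. r(i := a)) (Pi_pmf (A - {i}) d p))"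
proof -
  have A: "A = insert i (A - {i})" using assms by auto
  show *: "Pi_pmf A d p = bind_pmf (p i) (\<lambda>a. map_pmf (\<lambda>r. r(i := a)) (Pi_pmf (A - {i}) d p))"
    using assms by (subst A, subst Pi_pmf_insert) (auto simp: pair_pmf_def map_bind_pmf map_pmf_def bind_assoc_pmf bind_return_pmf)
  show "Pi_pmf A d p = bind_pmf (Pi_pmf (A - {i}) d p) (\<lambda>r. map_pmf (\<lambda>a. r(i := a)) (p i))"
    unfolding * map_pmf_def by (rule bind_commute_pmf)
qed

text \<open>Shannon's channel from strategies to receiver outputs, with the state averaged
  out.\<close>

definition output_kernel :: "('se \<times> 's) pmf \<Rightarrow> ('x \<Rightarrow> 's \<Rightarrow> ('y \<times> 'z) pmf) \<Rightarrow> ('se \<Rightarrow> 'x) \<Rightarrow> 'y pmf" where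
  "output_kernel P W u = bind_pmf P (\<lambda>p. map_pmf fst (W (u (fst p)) (snd p)))"

text \<open>The past determines the current strategy, while the current state pair is independent of
  the past. Hence the past influences the next output through the strategy alone.\<close>

lemma prefix_law_Suc:
  "map_pmf (\<lambda>(mg, ses, yz). ((mg, restrict ses {..<i}, restrict yz {..<i}), fst (yz i))) (prefix_law P W f M (Suc i)) =
    bind_pmf (prefix_law P W f M i) (\<lambda>b. map_pmf (Pair b) (output_kernel P W (strat f (fst b) (fst (snd b)) i)))"
proof -
  have lt: "{..<Suc i} - {i} = {..<i}" by auto
  have split1: "prod_law (Suc i) p = bind_pmf (prod_law i p) (\<lambda>r. map_pmf (\<lambda>a. r(i := a)) (p i))" for p :: "nat \<Rightarrow> 'q pmf"
    using Pi_pmf_split(1)[of "{..<Suc i}" i undefined p] by (simp add: lt)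
  have restr: "restrict r {..<i} = r" if "r \<in> set_pmf (prod_law i p)" for r p
    using that by (auto simp: fun_eq_iff pmf_prod_law_pos(3))
  have W: "prod_law i (\<lambda>j. W (strat f mg (r(i := p)) j (fst ((r(i := p)) j))) (snd ((r(i := p)) j)))
      = prod_law i (\<lambda>j. W (strat f mg r j (fst (r j))) (snd (r j)))" for mg r p
  proof (rule Pi_pmf_cong)
    fix j assume j: "j \<in> {..<i}"
    have "strat f mg (r(i := p)) j = strat f mg r j"
      using j by (intro strat_cong) auto
    then show "W (strat f mg (r(i := p)) j (fst ((r(i := p)) j))) (snd ((r(i := p)) j))
       = W (strat f mg r j (fst (r j))) (snd (r j))"
      using j by simp
  qed auto
  have st: "strat f mg (r(i := p)) i = strat f mg r i" for mg r p
    by (rule strat_cong) auto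
  have "map_pmf (\<lambda>(mg, ses, yz). ((mg, restrict ses {..<i}, restrict yz {..<i}), fst (yz i))) (prefix_law P W f M (Suc i))
    = bind_pmf (pmf_of_set M) (\<lambda>mg. bind_pmf (prod_law i (\<lambda>_. P)) (\<lambda>r. bind_pmf P (\<lambda>p.
        bind_pmf (prod_law i (\<lambda>j. W (strat f mg r j (fst (r j))) (snd (r j)))) (\<lambda>t.
          map_pmf (\<lambda>q. ((mg, restrict (r(i := p)) {..<i}, restrict (t(i := q)) {..<i}), fst q)) (W (strat f mg r i (fst p)) (snd p))))))"
    unfolding prefix_law_def split1
    by (simp add: map_bind_pmf bind_map_pmf map_pmf_comp W st bind_assoc_pmf map_pmf_def bind_return_pmf del: fun_upd_apply)
       (simp add: bind_return_pmf)
  also have "\<dots> = bind_pmf (pmf_of_set M) (\<lambda>mg. bind_pmf (prod_law i (\<lambda>_. P)) (\<lambda>r. bind_pmf P (\<lambda>p.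
        bind_pmf (prod_law i (\<lambda>j. W (strat f mg r j (fst (r j))) (snd (r j)))) (\<lambda>t.
          map_pmf (\<lambda>q. ((mg, r, t), fst q)) (W (strat f mg r i (fst p)) (snd p))))))"
    by (intro bind_pmf_cong refl map_pmf_cong) (simp add: restr)
  \<comment> \<open>The current state pair is drawn after the earlier outputs, which do not depend
    on it.\<close>
  also have "\<dots> = bind_pmf (pmf_of_set M) (\<lambda>mg. bind_pmf (prod_law i (\<lambda>_. P)) (\<lambda>r. 
        bind_pmf (prod_law i (\<lambda>j. W (strat f mg r j (fst (r j))) (snd (r j)))) (\<lambda>t. bind_pmf P (\<lambda>p.
          map_pmf (\<lambda>q. ((mg, r, t), fst q)) (W (strat f mg r i (fst p)) (snd p))))))"
    by (intro bind_pmf_cong refl bind_commute_pmf)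
  also have "\<dots> = bind_pmf (prefix_law P W f M i) (\<lambda>b. map_pmf (Pair b) (output_kernel P W (strat f (fst b) (fst (snd b)) i)))"
    unfolding prefix_law_def output_kernel_def
    by (simp add: bind_assoc_pmf bind_return_pmf map_bind_pmf map_pmf_comp)
  finally show ?thesis .
qed

lemma process_law_output:
  assumes i: "i < n"
  defines "pre \<equiv> \<lambda>(mg, ses, yz, sh). (mg, restrict ses {..<i}, restrict yz {..<i})"
  shows "map_pmf (\<lambda>w. (pre w, fst ((fst (snd (snd w))) i))) (process_law P W n f est M) =
    bind_pmf (map_pmf pre (process_law P W n f est M))
      (\<lambda>b. map_pmf (Pair b) (output_kernel P W (strat f (fst b) (fst (snd b)) i)))"
proof -
  let ?pre = "\<lambda>(mg, ses, yz, sh). (mg, restrict ses {..<Suc i}, restrict yz {..<Suc i})"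
  have rr: "restrict (restrict w {..<Suc i}) {..<i} = restrict w {..<i}" for w :: "nat \<Rightarrow> 'q"
    by (auto simp: fun_eq_iff)
  have "map_pmf (\<lambda>w. (pre w, fst ((fst (snd (snd w))) i))) (process_law P W n f est M)
    = map_pmf (\<lambda>(mg, ses, yz). ((mg, restrict ses {..<i}, restrict yz {..<i}), fst (yz i)))
        (map_pmf ?pre (process_law P W n f est M))"
    unfolding map_pmf_comp by (rule map_pmf_cong) (auto simp: pre_def rr)
  also have "map_pmf ?pre (process_law P W n f est M) = prefix_law P W f M (Suc i)"
    using i by (intro process_law_prefix) auto
  finally show ?thesis
    unfolding prefix_law_Suc pre_def using i by (subst process_law_prefix) auto
qed

text \<open>The variable \<open>c\<close> is a strategy together with an estimator that may depend on the rest of the block.\<close>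

definition gen_law ::
  "('se \<times> 's) pmf \<Rightarrow> ('x \<Rightarrow> 's \<Rightarrow> ('y \<times> 'z) pmf) \<Rightarrow> (('se \<Rightarrow> 'x) \<times> ('se \<Rightarrow> 'z \<Rightarrow> 's pmf)) pmf
    \<Rightarrow> ('se \<times> 's \<times> ('se \<Rightarrow> 'x) \<times> 'y \<times> 'z \<times> 's) pmf" where
  "gen_law P W C = bind_pmf C (\<lambda>c. bind_pmf P (\<lambda>p. bind_pmf (W (fst c (fst p)) (snd p)) (\<lambda>q.
     map_pmf (\<lambda>sh. (fst p, snd p, fst c, fst q, snd q, sh)) (snd c (fst p) (snd q)))))"

text \<open>All states other than the \<open>i\<close>-th are drawn first and fix the strategy. The
  rest of the block then collapses into the estimator \<kappa>, which also takes the current side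
  information \<open>a\<close>, because later inputs depend on it.\<close>

lemma process_law_component:
  fixes f :: "nat \<Rightarrow> nat \<Rightarrow> nat \<Rightarrow> (nat \<Rightarrow> 'se::finite) \<Rightarrow> 'x" and P :: "('se \<times> 's::finite) pmf"
  assumes i: "i < n" and M: "finite M" "M \<noteq> {}"
  obtains C where "finite (set_pmf C)"
    "map_pmf (\<lambda>(mg, ses, yz, sh). (fst (ses i), snd (ses i), strat f mg ses i, fst (yz i), snd (yz i), sh i))
      (process_law P W n f est M) = gen_law P W C"
proof -
  let ?A = "{..<n} - {i}"
  \<comment> \<open>The state at \<open>i\<close> is overwritten by \<open>undefined\<close>, and
    below the receiver's output too: neither the strategies nor the estimator read them, so \<kappa>
    depends only on side information and feedback.\<close>
  let ?e = "\<lambda>r a. r(i := (a, undefined))"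
  define \<kappa> where "\<kappa> = (\<lambda>mg r a z. bind_pmf (Pi_pmf ?A undefined (\<lambda>j. W (strat f mg (?e r a) j (fst (r j))) (snd (r j))))
     (\<lambda>t. map_pmf (\<lambda>sh. sh i) (est (snd mg) (encode n f (fst mg) (snd mg) (comap n fst (?e r a))) (comap n fst (?e r a))
         (comap n snd (t(i := (undefined, z)))))))"
  define C where "C = bind_pmf (pmf_of_set M) (\<lambda>mg. map_pmf (\<lambda>r. (strat f mg r i, \<kappa> mg r)) (Pi_pmf ?A undefined (\<lambda>_. P)))"
  have fin: "finite (set_pmf C)" unfolding C_def using M by simp
  have s1: "prod_law n p = bind_pmf (Pi_pmf ?A undefined p) (\<lambda>r. map_pmf (\<lambda>a. r(i := a)) (p i))"
    and s2: "prod_law n p = bind_pmf (p i) (\<lambda>a. map_pmf (\<lambda>r. r(i := a)) (Pi_pmf ?A undefined p))"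
    for p :: "nat \<Rightarrow> 'q pmf"
    using i by (intro Pi_pmf_split; simp)+
  have st: "strat f mg (r(i := p)) i = strat f mg r i" for mg r p
    by (rule strat_cong) auto
  have W: "Pi_pmf ?A undefined (\<lambda>j. W (strat f mg (r(i := p)) j (fst ((r(i := p)) j))) (snd ((r(i := p)) j)))
      = Pi_pmf ?A undefined (\<lambda>j. W (strat f mg (?e r (fst p)) j (fst (r j))) (snd (r j)))" for mg r p
  proof (rule Pi_pmf_cong)
    fix j assume j: "j \<in> ?A"
    have "strat f mg (r(i := p)) j = strat f mg (?e r (fst p)) j"
      by (intro strat_cong) auto
    then show "W (strat f mg (r(i := p)) j (fst ((r(i := p)) j))) (snd ((r(i := p)) j))
       = W (strat f mg (?e r (fst p)) j (fst (r j))) (snd (r j))"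
      using j by simp
  qed auto
  have c1: "comap n fst (r(i := p)) = comap n fst (?e r (fst p))" for r and p :: "'se \<times> 's"
    by (auto simp: fun_eq_iff)
  have c2: "comap n snd (t(i := q)) = comap n snd (t(i := (undefined, snd q)))" for t and q :: "'y \<times> 'z"
    by (auto simp: fun_eq_iff)
  have "map_pmf (\<lambda>(mg, ses, yz, sh). (fst (ses i), snd (ses i), strat f mg ses i, fst (yz i), snd (yz i), sh i))
      (process_law P W n f est M)
    = bind_pmf (pmf_of_set M) (\<lambda>mg. bind_pmf (Pi_pmf ?A undefined (\<lambda>_. P)) (\<lambda>r. bind_pmf P (\<lambda>p.
       bind_pmf (W (strat f mg (r(i := p)) i (fst p)) (snd p)) (\<lambda>q.
       bind_pmf (Pi_pmf ?A undefined (\<lambda>j. W (strat f mg (r(i := p)) j (fst ((r(i := p)) j))) (snd ((r(i := p)) j)))) (\<lambda>t.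
       map_pmf (\<lambda>sh. (fst p, snd p, strat f mg (r(i := p)) i, fst q, snd q, sh i))
        (est (snd mg) (encode n f (fst mg) (snd mg) (comap n fst (r(i := p)))) (comap n fst (r(i := p))) (comap n snd (t(i := q)))))))))"
    unfolding process_law_def s1[of "\<lambda>_. P"] s2[of "\<lambda>i. W (_ i) (_ i)"]
    unfolding map_bind_pmf bind_assoc_pmf bind_map_pmf map_pmf_comp prod.case fun_upd_same ..
  also have "\<dots> = bind_pmf (pmf_of_set M) (\<lambda>mg. bind_pmf (Pi_pmf ?A undefined (\<lambda>_. P)) (\<lambda>r. bind_pmf P (\<lambda>p.
       bind_pmf (W (strat f mg r i (fst p)) (snd p)) (\<lambda>q. map_pmf (\<lambda>sh. (fst p, snd p, strat f mg r i, fst q, snd q, sh))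
         (\<kappa> mg r (fst p) (snd q))))))"
  proof (intro bind_pmf_cong refl)
    fix mg r p q
      show "bind_pmf (Pi_pmf ?A undefined (\<lambda>j. W (strat f mg (r(i := p)) j (fst ((r(i := p)) j))) (snd ((r(i := p)) j)))) (\<lambda>t.
       map_pmf (\<lambda>sh. (fst p, snd p, strat f mg (r(i := p)) i, fst q, snd q, sh i))
        (est (snd mg) (encode n f (fst mg) (snd mg) (comap n fst (r(i := p)))) (comap n fst (r(i := p))) (comap n snd (t(i := q)))))
       = map_pmf (\<lambda>sh. (fst p, snd p, strat f mg r i, fst q, snd q, sh)) (\<kappa> mg r (fst p) (snd q))"
        unfolding \<kappa>_def W[of mg r p] c1[of r p] c2[of _ q] st map_bind_pmf map_pmf_comp ..
  qed (simp add: st)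
  also have "\<dots> = gen_law P W C"
    unfolding gen_law_def C_def by (simp add: bind_assoc_pmf bind_map_pmf)
  finally show thesis using fin that by blast
qed

section \<open>Single-letterization\<close>

lemma ent_seq_Suc:
  "ent J (\<lambda>w. (B w, \<lambda>j\<in>{..<Suc i}. g w j)) = ent J (\<lambda>w. ((B w, \<lambda>j\<in>{..<i}. g w j), g w i))"
proof -
  let ?h = "\<lambda>(b, r). ((b, restrict r {..<i}), r i)"
  let ?X = "\<lambda>w. (B w, \<lambda>j\<in>{..<Suc i}. g w j)"
  have rr: "restrict (\<lambda>j\<in>{..<Suc i}. g w j) {..<i} = (\<lambda>j\<in>{..<i}. g w j)" for w
    by (auto simp: fun_eq_iff)
  have "inj_on ?h (?X ` set_pmf J)"
  proof (rule inj_onI)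
    fix a a' assume "a \<in> ?X ` set_pmf J" "a' \<in> ?X ` set_pmf J" and eq: "?h a = ?h a'"
    then obtain w w' where a: "a = ?X w" "a' = ?X w'" by auto
    have "B w = B w'" "restrict (g w) {..<i} = restrict (g w') {..<i}" "g w i = g w' i"
      using eq unfolding a prod.case rr by auto
    moreover from this have "restrict (g w) {..<Suc i} = restrict (g w') {..<Suc i}"
      by (auto simp: fun_eq_iff less_Suc_eq restrict_def) metis+
    ultimately show "a = a'" unfolding a by simp
  qed
  from ent_inj[OF this] show ?thesis by (simp only: prod.case rr) simp
qed

lemma ent_chain:
  fixes n :: nat
  shows "ent J (\<lambda>w. (B w, \<lambda>j\<in>{..<n}. g w j)) = ent J B +
    (\<Sum>i<n. ent J (\<lambda>w. ((B w, \<lambda>j\<in>{..<i}. g w j), g w i)) - ent J (\<lambda>w. (B w, \<lambda>j\<in>{..<i}. g w j)))"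
proof (induction n)
  case 0
  have "ent J (\<lambda>w. (\<lambda>b. (b, \<lambda>_. undefined)) (B w)) = ent J B"
    by (rule ent_inj) (auto simp: inj_on_def)
  then show ?case by (simp add: restrict_def)
next
  case (Suc n)
  then show ?case unfolding sum.lessThan_Suc ent_seq_Suc by linarith
qed

lemma ent_map_le: 
  assumes "finite (set_pmf J)"
  shows "ent J (\<lambda>w. f (X w)) \<le> ent J X"
  unfolding ent_def
proof (rule expn_mono[OF assms])
  fix w assume w: "w \<in> set_pmf J"
  have "pmf (map_pmf X J) (X w) \<le> pmf (map_pmf (\<lambda>w. f (X w)) J) (f (X w))"
    unfolding pmf_map by (intro measure_pmf.finite_measure_mono) auto
  then show "- log 2 (pmf (map_pmf (\<lambda>w. f (X w)) J) (f (X w))) \<le> - log 2 (pmf (map_pmf X J) (X w))"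
    using pmf_map_pos[OF w, of X] by simp
qed

text \<open>The equality case of Gibbs' inequality: the guess is the true conditional law.\<close>

lemma ent_cond_eq:
  assumes fin: "finite (set_pmf J)"
    and law: "map_pmf (\<lambda>w. (B w, Y w)) J = bind_pmf (map_pmf B J) (\<lambda>b. map_pmf (Pair b) (K b))"
  shows "ent J (\<lambda>w. (B w, Y w)) - ent J B = expn J (\<lambda>w. - log 2 (pmf (K (B w)) (Y w)))"
  unfolding ent_def expn_diff[OF fin, symmetric] law
proof (rule expn_cong)
  fix w assume w: "w \<in> set_pmf J"
  have eq: "pmf (bind_pmf (map_pmf B J) (\<lambda>b. map_pmf (Pair b) (K b))) (B w, Y w)
      = pmf (map_pmf B J) (B w) * pmf (K (B w)) (Y w)"
    by (rule pmf_channel_joint)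
  have "0 < pmf (map_pmf (\<lambda>w. (B w, Y w)) J) (B w, Y w)"
    using pmf_map_pos[OF w, of "\<lambda>w. (B w, Y w)"] by simp
  then have "0 < pmf (map_pmf B J) (B w) * pmf (K (B w)) (Y w)"
    unfolding law eq .
  then have "0 < pmf (K (B w)) (Y w)"
    using pmf_map_pos[OF w, of B] zero_less_mult_pos by blast
  then show "- log 2 (pmf (bind_pmf (map_pmf B J) (\<lambda>b. map_pmf (Pair b) (K b))) (B w, Y w)) -
      - log 2 (pmf (map_pmf B J) (B w)) = - log 2 (pmf (K (B w)) (Y w))"
    unfolding eq using pmf_map_pos[OF w, of B] by (simp add: log_mult)
qed

text \<open>Total probability as resampling: a fresh \<open>c'\<close> drawn given the value
  \<open>h c\<close> is jointly distributed with \<open>h c\<close> as \<open>c\<close> itself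
  is.\<close>

lemma bind_cond_pmf_same:
  "bind_pmf C (\<lambda>c. bind_pmf (cond_pmf C {c'. h c' = h c}) (\<lambda>c'. g (h c) c')) = bind_pmf C (\<lambda>c. g (h c) c)"
proof -
  have ne: "set_pmf C \<inter> {c'. h c' = h c} \<noteq> {}" if "c \<in> set_pmf C" for c
    using that by auto
  have "bind_pmf C (\<lambda>c. cond_pmf C {c'. h c' = h c}) = C"
  proof (rule bind_cond_pmf_cancel)
    fix y assume "y \<in> set_pmf C"
    then show "set_pmf C \<inter> {x. h y = h x} \<noteq> {}" by auto
  next
    fix x y assume "h y = h x"
    then show "measure_pmf.prob C {y. h y = h x} = measure_pmf.prob C {x. h y = h x}"
      by (simp add: eq_commute)
  qed (rule ne)
  then have "bind_pmf C (\<lambda>c. g (h c) c) = bind_pmf (bind_pmf C (\<lambda>c. cond_pmf C {c'. h c' = h c})) (\<lambda>c. g (h c) c)"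
    by simp
  also have "\<dots> = bind_pmf C (\<lambda>c. bind_pmf (cond_pmf C {c'. h c' = h c}) (\<lambda>c'. g (h c') c'))"
    by (rule bind_assoc_pmf)
  also have "\<dots> = bind_pmf C (\<lambda>c. bind_pmf (cond_pmf C {c'. h c' = h c}) (\<lambda>c'. g (h c) c'))"
    by (intro bind_pmf_cong refl) (auto simp: set_cond_pmf[OF ne])
  finally show ?thesis ..
qed

text \<open>
  The estimator of a code may use more than the current input, side information and feedback.
  Forgetting the rest preserves the joint law with the state, which given these three variables is independent
  of everything else, and does not increase \<open>I(U; S_hat, S\<^sub>e)\<close>. The default covers inputs of probability 0.
\<close>

definition averaged_estimator ::
  "(('se \<Rightarrow> 'x) \<times> ('se \<Rightarrow> 'z \<Rightarrow> 's pmf)) pmf \<Rightarrow> 'x \<Rightarrow> 'se \<Rightarrow> 'z \<Rightarrow> 's pmf" where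
  "averaged_estimator C x se z = (if set_pmf C \<inter> {c. fst c se = x} \<noteq> {}
     then bind_pmf (cond_pmf C {c. fst c se = x}) (\<lambda>c. snd c se z) else return_pmf undefined)"

abbreviation strategy_kernel ::
  "('se \<times> 's) pmf \<Rightarrow> ('x \<Rightarrow> 's \<Rightarrow> ('y \<times> 'z) pmf) \<Rightarrow> ('x \<Rightarrow> 'se \<Rightarrow> 'z \<Rightarrow> 's pmf) \<Rightarrow> ('se \<Rightarrow> 'x) \<Rightarrow>
    ('se \<times> 's \<times> 'y \<times> 'z \<times> 's) pmf" where
  "strategy_kernel P W V \<equiv> channel_kernel P W (\<lambda>u. u) V"

text \<open>For a fixed state pair, \<open>c\<close> acts only through its input and its estimator,
  so resampling \<open>c\<close> given the input replaces the estimator by its average. Only the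
  input \<open>u se\<close> is kept on both sides: the joint law of the whole strategy and the
  reconstruction may change.\<close>

lemma gen_law_averaged:
  "map_pmf (\<lambda>(se, s, u, y, z, sh). (se, s, u se, y, z, sh)) (gen_law P W C) =
    bind_pmf (map_pmf fst C) (\<lambda>u. map_pmf (\<lambda>(se, s, y, z, sh). (se, s, u se, y, z, sh))
      (strategy_kernel P W (averaged_estimator C) u))"
proof -
  let ?V = "averaged_estimator C"
  let ?G = "\<lambda>p x k. bind_pmf (W x (snd p)) (\<lambda>q. map_pmf (\<lambda>sh. (fst p, snd p, x, fst q, snd q, sh)) (k (snd q)))"
  have V: "?V (fst c se) se z = bind_pmf (cond_pmf C {c'. fst c' se = fst c se}) (\<lambda>c. snd c se z)"
    if "c \<in> set_pmf C" for c se z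
    using that by (auto simp: averaged_estimator_def)
  have "map_pmf (\<lambda>(se, s, u, y, z, sh). (se, s, u se, y, z, sh)) (gen_law P W C)
      = bind_pmf C (\<lambda>c. bind_pmf P (\<lambda>p. ?G p (fst c (fst p)) (snd c (fst p))))"
    by (simp add: gen_law_def map_bind_pmf map_pmf_comp)
  also have "\<dots> = bind_pmf P (\<lambda>p. bind_pmf C (\<lambda>c. ?G p (fst c (fst p)) (snd c (fst p))))"
    by (rule bind_commute_pmf)
  also have "\<dots> = bind_pmf P (\<lambda>p. bind_pmf C (\<lambda>c. ?G p (fst c (fst p)) (?V (fst c (fst p)) (fst p))))"
  proof (rule bind_pmf_cong[OF refl])
    fix p
    have "bind_pmf C (\<lambda>c. ?G p (fst c (fst p)) (snd c (fst p)))
        = bind_pmf C (\<lambda>c. bind_pmf (cond_pmf C {c'. fst c' (fst p) = fst c (fst p)})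
            (\<lambda>c'. ?G p (fst c (fst p)) (snd c' (fst p))))"
      by (rule bind_cond_pmf_same[of C "\<lambda>c. fst c (fst p)" "\<lambda>x c. ?G p x (snd c (fst p))", symmetric])
    also have "\<dots> = bind_pmf C (\<lambda>c. ?G p (fst c (fst p)) (?V (fst c (fst p)) (fst p)))"
    proof (rule bind_pmf_cong[OF refl])
      fix c assume c: "c \<in> set_pmf C"
      show "bind_pmf (cond_pmf C {c'. fst c' (fst p) = fst c (fst p)}) (\<lambda>c'. ?G p (fst c (fst p)) (snd c' (fst p)))
        = ?G p (fst c (fst p)) (?V (fst c (fst p)) (fst p))"
        unfolding V[OF c] map_bind_pmf by (rule bind_commute_pmf)
    qed
    finally show "bind_pmf C (\<lambda>c. ?G p (fst c (fst p)) (snd c (fst p)))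
        = bind_pmf C (\<lambda>c. ?G p (fst c (fst p)) (?V (fst c (fst p)) (fst p)))" .
  qed
  also have "\<dots> = bind_pmf C (\<lambda>c. bind_pmf P (\<lambda>p. ?G p (fst c (fst p)) (?V (fst c (fst p)) (fst p))))"
    by (rule bind_commute_pmf)
  also have "\<dots> = bind_pmf (map_pmf fst C) (\<lambda>u. map_pmf (\<lambda>(se, s, y, z, sh). (se, s, u se, y, z, sh))
      (strategy_kernel P W ?V u))"
    by (simp add: channel_kernel_def bind_map_pmf map_bind_pmf map_pmf_comp)
  finally show ?thesis .
qed

text \<open>Guarantees positive arguments of the logarithms when the averaged kernel serves as the
  guess in Gibbs' inequality.\<close>

lemma gen_law_support:
  assumes "(se, s, u, y, z, sh) \<in> set_pmf (gen_law P W C)"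
  shows "(se, s, y, z, sh) \<in> set_pmf (strategy_kernel P W (averaged_estimator C) u)"
proof -
  from assms obtain c where c: "c \<in> set_pmf C" "u = fst c" "(se, s) \<in> set_pmf P" "(y, z) \<in> set_pmf (W (u se) s)"
    "sh \<in> set_pmf (snd c se z)"
    by (fastforce simp: gen_law_def)
  have ne: "set_pmf C \<inter> {c. fst c se = u se} \<noteq> {}" using c by auto
  have "sh \<in> set_pmf (averaged_estimator C (u se) se z)"
    using c ne by (auto simp: averaged_estimator_def set_cond_pmf[OF ne])
  with c show ?thesis
    by (auto simp: channel_kernel_def intro!: bexI[of _ "(se, s)"] bexI[of _ "(y, z)"])
qed

lemma channel_kernel_output:
  "map_pmf (\<lambda>(se, s, y, z, sh). y) (strategy_kernel P W V u) = output_kernel P W u"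
  by (simp add: channel_kernel_def output_kernel_def map_bind_pmf map_pmf_comp) (simp add: map_pmf_def)

text \<open>The receiver's output does not involve the estimator, so here, unlike in
  \<open>gen_law_averaged\<close>, the whole strategy can be kept.\<close>

lemma gen_law_input_output:
  "map_pmf (\<lambda>(se, s, u, y, z, sh). (u, y)) (gen_law P W C) =
    bind_pmf (map_pmf fst C) (\<lambda>u. map_pmf (Pair u) (output_kernel P W u))"
  by (simp add: gen_law_def output_kernel_def map_bind_pmf map_pmf_comp bind_map_pmf map_pmf_const)
     (simp add: map_pmf_def)

text \<open>At side information \<open>se\<close> a strategy enters only through its input there.
  Hence the log-likelihood of side information and reconstruction is a function of variables whose
  joint law \<open>gen_law_averaged\<close> preserves.\<close>

lemma pmf_strategy_kernel_local:
  "pmf (map_pmf (\<lambda>(se, s, y, z, sh). (se, sh)) (strategy_kernel P W V u)) (se, sh) =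
   pmf (map_pmf (\<lambda>(se, s, y, z, sh). (se, sh)) (strategy_kernel P W V (\<lambda>_. u se))) (se, sh)"
proof -
  let ?H = "\<lambda>x p. bind_pmf (W x (snd p)) (\<lambda>q. map_pmf (Pair (fst p)) (V x (fst p) (snd q)))"
  have eq: "map_pmf (\<lambda>(se, s, y, z, sh). (se, sh)) (strategy_kernel P W V u) = bind_pmf P (\<lambda>p. ?H (u (fst p)) p)" for u
    by (simp add: channel_kernel_def map_bind_pmf map_pmf_comp)
  have "pmf (?H (u (fst p)) p) (se, sh) = pmf (?H (u se) p) (se, sh)" for p
  proof (cases "fst p = se")
    case False
    then have zero: "pmf (?H x p) (se, sh) = 0" for x
      unfolding pmf_eq_0_set_pmf by auto
    show ?thesis by (simp only: zero)
  qed simp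
  then show ?thesis unfolding eq pmf_bind by simp
qed

section \<open>Entropy bounds for a fixed code\<close>

lemma log2_prod:
  "finite A \<Longrightarrow> (\<And>i. i \<in> A \<Longrightarrow> 0 < g i) \<Longrightarrow> log 2 (\<Prod>i\<in>A. g i) = (\<Sum>i\<in>A. log 2 (g i))"
  by (induction A rule: finite_induct) (auto simp: log_mult prod_pos less_imp_neq[symmetric])

locale causal_code =
  fixes P :: "('se::finite \<times> 's::finite) pmf" and W :: "'x::finite \<Rightarrow> 's \<Rightarrow> ('y::finite \<times> 'z::finite) pmf"
    and n :: nat and R Rc :: real and f :: "nat \<Rightarrow> nat \<Rightarrow> nat \<Rightarrow> (nat \<Rightarrow> 'se) \<Rightarrow> 'x"
    and dec :: "(nat \<Rightarrow> 'y) \<Rightarrow> nat \<Rightarrow> nat"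
    and est :: "nat \<Rightarrow> (nat \<Rightarrow> 'x) \<Rightarrow> (nat \<Rightarrow> 'se) \<Rightarrow> (nat \<Rightarrow> 'z) \<Rightarrow> (nat \<Rightarrow> 's) pmf"
  assumes code: "is_code n R Rc dec est" and n: "0 < n"
    and exact: "map_pmf (\<lambda>(m, mh, se, s, sh). \<lambda>i\<in>{..<n}. (se i, sh i)) (code_law P W n R Rc f dec est)
      = prod_law n (\<lambda>_. P)"
begin

definition M :: "(nat \<times> nat) set" where "M = index_set n R \<times> index_set n Rc"

definition \<Omega> where "\<Omega> = process_law P W n f est M"

abbreviation "msg w \<equiv> fst w"
abbreviation "states w \<equiv> fst (snd w)"
abbreviation "outs w \<equiv> fst (snd (snd w))"
abbreviation "recon w \<equiv> snd (snd (snd w))"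
abbreviation "str w i \<equiv> strat f (msg w) (states w) i"
abbreviation "act w i \<equiv> (fst (states w i), recon w i)"

lemma rates: "0 \<le> R" "0 \<le> Rc"
  using code by (auto simp: is_code_def)

lemma finite_M: "finite M" "M \<noteq> {}"
  using index_set_bounds rates by (auto simp: M_def)

lemma card_M: "0 < real (card M)" "real (card M) = real (card (index_set n R)) * real (card (index_set n Rc))"
  using finite_M by (simp_all add: card_gt_0_iff) (simp add: M_def card_cartesian_product)

lemma code_law_\<Omega>:
  "code_law P W n R Rc f dec est =
    map_pmf (\<lambda>w. (fst (msg w), dec (comap n fst (outs w)) (snd (msg w)), comap n fst (states w),
      comap n snd (states w), recon w)) \<Omega>"
  unfolding code_law_process_law[OF rates] \<Omega>_def M_def by (simp add: case_prod_unfold)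

lemma fin: "finite (set_pmf \<Omega>)"
proof -
  have fin_est: "finite (set_pmf (est (snd mg) (encode n f (fst mg) (snd mg) (comap n fst r)) (comap n fst r) (comap n snd t)))"
    if "mg \<in> M" for mg r t
  proof (rule finite_subset[OF _ finite_seqs])
    have "snd mg \<in> index_set n Rc" using that by (auto simp: M_def)
    moreover have "encode n f (fst mg) (snd mg) (comap n fst r) \<in> seqs n" "comap n fst r \<in> seqs n" "comap n snd t \<in> seqs n"
      unfolding encode_def by auto
    moreover have "\<forall>g\<in>index_set n Rc. \<forall>x\<in>seqs n. \<forall>se\<in>seqs n. \<forall>z\<in>seqs n. set_pmf (est g x se z) \<subseteq> seqs n"
      using code unfolding is_code_def by (elim conjE)
    ultimately show "set_pmf (est (snd mg) (encode n f (fst mg) (snd mg) (comap n fst r)) (comap n fst r) (comap n snd t)) \<subseteq> seqs n"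
      by (simp only: Ball_def)
  qed
  then show ?thesis
    unfolding \<Omega>_def process_law_def using finite_M
    by (auto intro!: finite_imageI fin_est[of "(_, _)", simplified])
qed

lemma msg_in: "w \<in> set_pmf \<Omega> \<Longrightarrow> msg w \<in> M"
  unfolding \<Omega>_def process_law_def using finite_M by (auto simp: set_pmf_of_set)

lemma msg_law: "map_pmf fst \<Omega> = pmf_of_set M"
  unfolding \<Omega>_def process_law_def
  by (simp add: map_bind_pmf map_pmf_comp bind_return_pmf')

lemma ent_msg: "ent \<Omega> fst = log 2 (card M)"
proof -
  have "ent \<Omega> fst = expn \<Omega> (\<lambda>_. log 2 (card M))"
    unfolding ent_def msg_law
    by (rule expn_cong) (use finite_M msg_in in \<open>simp add: log_divide card_gt_0_iff\<close>)
  then show ?thesis by simp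
qed

lemma act_law: "map_pmf (\<lambda>w. \<lambda>i\<in>{..<n}. act w i) \<Omega> = prod_law n (\<lambda>_. P)"
  unfolding exact[symmetric] code_law_\<Omega> map_pmf_comp prod.case
  by (intro map_pmf_cong refl) (auto simp: fun_eq_iff)

lemma ent_act: "ent \<Omega> (\<lambda>w. \<lambda>i\<in>{..<n}. act w i) = (\<Sum>i<n. expn \<Omega> (\<lambda>w. - log 2 (pmf P (act w i))))"
proof -
  have "ent \<Omega> (\<lambda>w. \<lambda>i\<in>{..<n}. act w i) = expn \<Omega> (\<lambda>w. \<Sum>i<n. - log 2 (pmf P (act w i)))"
    unfolding ent_def act_law
  proof (rule expn_cong)
    fix w assume w: "w \<in> set_pmf \<Omega>"
    then have "(\<lambda>i\<in>{..<n}. act w i) \<in> set_pmf (prod_law n (\<lambda>_. P))"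
      unfolding act_law[symmetric] by auto
    from pmf_prod_law_pos[OF this]
    have "pmf (prod_law n (\<lambda>_. P)) (\<lambda>i\<in>{..<n}. act w i) = (\<Prod>i<n. pmf P (act w i))"
      "\<And>i. i < n \<Longrightarrow> 0 < pmf P (act w i)"
      by (auto simp: pmf_positive_iff)
    then show "- log 2 (pmf (prod_law n (\<lambda>_. P)) (\<lambda>i\<in>{..<n}. act w i)) = (\<Sum>i<n. - log 2 (pmf P (act w i)))"
      unfolding sum_negf by (subst log2_prod[symmetric]) auto
  qed
  then show ?thesis using fin by (simp add: expn_sum)
qed

text \<open>Given the messages and all past states and outputs, including the feedback, the
  conditional law of the output is known exactly. Passing to the receiver's own past can only raise
  the entropy.\<close>

lemma output_entropy_ge:
  assumes "i < n"
  shows "expn \<Omega> (\<lambda>w. - log 2 (pmf (output_kernel P W (str w i)) (fst (outs w i))))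
    \<le> ent \<Omega> (\<lambda>w. ((msg w, \<lambda>j\<in>{..<i}. fst (outs w j)), fst (outs w i))) - ent \<Omega> (\<lambda>w. (msg w, \<lambda>j\<in>{..<i}. fst (outs w j)))"
proof -
  let ?pre = "\<lambda>w. (msg w, restrict (states w) {..<i}, restrict (outs w) {..<i})"
  let ?f = "\<lambda>(mg, r, t). (mg, comap i fst t)"
  have st: "strat f mg (restrict r {..<i}) i = strat f mg r i" for mg r
    by (rule strat_cong) auto
  have "map_pmf (\<lambda>w. (?pre w, fst (outs w i))) \<Omega> =
      bind_pmf (map_pmf ?pre \<Omega>) (\<lambda>b. map_pmf (Pair b) (output_kernel P W (strat f (fst b) (fst (snd b)) i)))"
    using process_law_output[OF assms, where f = f and P = P and W = W and est = est and M = M] by (simp add: \<Omega>_def case_prod_unfold)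
  from ent_cond_eq[OF fin this]
  have "ent \<Omega> (\<lambda>w. (?pre w, fst (outs w i))) - ent \<Omega> ?pre
      = expn \<Omega> (\<lambda>w. - log 2 (pmf (output_kernel P W (str w i)) (fst (outs w i))))"
    by (simp add: st)
  moreover have "ent \<Omega> (\<lambda>w. (?pre w, fst (outs w i))) - ent \<Omega> ?pre
      \<le> ent \<Omega> (\<lambda>w. (?f (?pre w), fst (outs w i))) - ent \<Omega> (\<lambda>w. ?f (?pre w))"
    by (rule ent_cond_mono[OF fin])
  moreover have f: "?f (?pre w) = (msg w, \<lambda>j\<in>{..<i}. fst (outs w j))" for w
    by (auto simp: fun_eq_iff)
  ultimately show ?thesis unfolding f by linarith
qed

definition err :: real where
  "err = measure_pmf.prob (code_law P W n R Rc f dec est) {(m, mh, se, s, sh). m \<noteq> mh}"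

text \<open>Fano's inequality as an instance of Gibbs' inequality, conditionally on the common
  randomness and the received sequence.\<close>

lemma fano:
  "ent \<Omega> (\<lambda>w. (msg w, \<lambda>j\<in>{..<n}. fst (outs w j))) - ent \<Omega> (\<lambda>w. (snd (msg w), \<lambda>j\<in>{..<n}. fst (outs w j)))
    \<le> 1 + err * log 2 (card (index_set n R))"
proof -
  let ?I = "index_set n R"
  let ?Y = "\<lambda>w. (snd (msg w), \<lambda>j\<in>{..<n}. fst (outs w j))" and ?X = "\<lambda>w. fst (msg w)"
  \<comment> \<open>Half of the mass on the decoded message and half uniform: a correct decision
    costs at most one bit, a wrong one a further log of the number of messages.\<close>
  let ?q = "\<lambda>(g, y) m. (if m = dec y g then 1 / 2 else 0) + 1 / (2 * real (card ?I))"
  have I: "0 < real (card ?I)" using index_set_bounds(1)[OF rates(1), of n] by simp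
  have "ent \<Omega> (\<lambda>w. (?Y w, ?X w)) - ent \<Omega> ?Y \<le> expn \<Omega> (\<lambda>w. - log 2 (?q (?Y w) (?X w)))"
  proof (rule ent_cond_le[OF fin])
    fix w assume w: "w \<in> set_pmf \<Omega>"
    have "?X ` set_pmf \<Omega> \<subseteq> ?I" using msg_in by (auto simp: M_def)
    then have "(\<Sum>m\<in>?X ` set_pmf \<Omega>. ?q (?Y w) m) \<le> (\<Sum>m\<in>?I. ?q (?Y w) m)"
      by (intro sum_mono2) auto
    also have "\<dots> \<le> 1 / 2 + 1 / 2"
      using I by (auto simp: sum.distrib sum.delta)
    finally show "(\<Sum>m\<in>?X ` set_pmf \<Omega>. ?q (?Y w) m) \<le> 1" by simp
  qed (use I in \<open>auto intro!: add_pos_nonneg add_nonneg_pos\<close>)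
  also have "\<dots> \<le> expn \<Omega> (\<lambda>w. 1 + indicator {w. ?X w \<noteq> dec (comap n fst (outs w)) (snd (msg w))} w * log 2 (card ?I))"
  proof (rule expn_mono[OF fin])
    fix w
    have L: "0 \<le> log 2 (card ?I)" using index_set_bounds(1)[OF rates(1), of n] by simp
    show "- log 2 (?q (?Y w) (?X w)) \<le> 1 + indicator {w. ?X w \<noteq> dec (comap n fst (outs w)) (snd (msg w))} w * log 2 (card ?I)"
    proof (cases "?X w = dec (comap n fst (outs w)) (snd (msg w))")
      case True
      have "log 2 (1 / 2) \<le> log 2 (1 / 2 + 1 / (2 * real (card ?I)))" using I by (intro log_mono) auto
      then show ?thesis using True by (simp add: log_divide)
    next
      case False
      have "log 2 (1 / (2 * real (card ?I))) = - 1 - log 2 (card ?I)"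
        using I index_set_bounds(4)[OF rates(1)] by (simp add: log_divide log_mult)
      then show ?thesis using False by simp
    qed
  qed
  also have "\<dots> = 1 + err * log 2 (card ?I)"
  proof -
    have "err = measure_pmf.prob \<Omega> {w. ?X w \<noteq> dec (comap n fst (outs w)) (snd (msg w))}"
      unfolding err_def code_law_\<Omega> measure_map_pmf by (intro arg_cong[of _ _ "measure_pmf.prob \<Omega>"]) auto
    then show ?thesis using fin by (simp add: expn_add)
  qed
  also have "ent \<Omega> (\<lambda>w. (?Y w, ?X w)) = ent \<Omega> (\<lambda>w. (msg w, \<lambda>j\<in>{..<n}. fst (outs w j)))"
  proof -
    let ?h = "\<lambda>(mg, y). ((snd mg, y), fst mg)"
    have "ent \<Omega> (\<lambda>w. ?h (msg w, \<lambda>j\<in>{..<n}. fst (outs w j))) = ent \<Omega> (\<lambda>w. (msg w, \<lambda>j\<in>{..<n}. fst (outs w j)))"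
      by (rule ent_inj) (auto simp: inj_on_def)
    then show ?thesis by simp
  qed
  finally show ?thesis .
qed

text \<open>H(M, \<Gamma>) plus the output entropies is at most H(M, \<Gamma>, Y^n), which Fano's
  inequality compares with H(\<Gamma>, Y^n). The latter is at most H(\<Gamma>) plus the cost of
  describing each output by \<open>Yb\<close>; H(\<Gamma>) cancels. Taking one \<open>Yb\<close> for
  all times, later the time-averaged output law, already performs the averaging.\<close>

lemma message_bound:
  fixes Yb :: "'y pmf"
  assumes Yb: "\<And>w i. w \<in> set_pmf \<Omega> \<Longrightarrow> i < n \<Longrightarrow> fst (outs w i) \<in> set_pmf Yb"
  shows "(1 - err) * log 2 (card (index_set n R)) \<le> 1 +
    (\<Sum>i<n. expn \<Omega> (\<lambda>w. - log 2 (pmf Yb (fst (outs w i)))) -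
      expn \<Omega> (\<lambda>w. - log 2 (pmf (output_kernel P W (str w i)) (fst (outs w i)))))"
proof -
  let ?y = "\<lambda>w. \<lambda>j\<in>{..<n}. fst (outs w j)"
  let ?I = "index_set n R" and ?G = "index_set n Rc"
  have G: "0 < real (card ?G)" and I: "0 < real (card ?I)"
    using index_set_bounds(1)[OF rates(1), of n] index_set_bounds(1)[OF rates(2), of n] by simp_all
  have out_pos: "pmf (prod_law n (\<lambda>_. Yb)) (?y w) = (\<Prod>i<n. pmf Yb (fst (outs w i)))" for w
    by (simp add: pmf_Pi)
  have "ent \<Omega> (\<lambda>w. (snd (msg w), ?y w)) - ent \<Omega> (\<lambda>w. snd (msg w))
      \<le> expn \<Omega> (\<lambda>w. - log 2 (pmf (prod_law n (\<lambda>_. Yb)) (?y w)))"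
  proof (rule ent_cond_le[OF fin])
    show "0 < pmf (prod_law n (\<lambda>_. Yb)) (?y w)" if "w \<in> set_pmf \<Omega>" for w
      unfolding out_pos using Yb[OF that] by (intro prod_pos) (auto simp: pmf_positive_iff)
    show "(\<Sum>y\<in>?y ` set_pmf \<Omega>. pmf (prod_law n (\<lambda>_. Yb)) y) \<le> 1" for w
      using fin by (subst measure_measure_pmf_finite[symmetric]) auto
  qed auto
  also have "\<dots> = (\<Sum>i<n. expn \<Omega> (\<lambda>w. - log 2 (pmf Yb (fst (outs w i)))))"
    unfolding expn_sum[OF fin, symmetric] out_pos
    unfolding sum_negf
    by (rule expn_cong, subst log2_prod) (use Yb in \<open>auto simp: pmf_positive_iff\<close>)
  finally have 1: "ent \<Omega> (\<lambda>w. (snd (msg w), ?y w)) \<le> ent \<Omega> (\<lambda>w. snd (msg w)) +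
      (\<Sum>i<n. expn \<Omega> (\<lambda>w. - log 2 (pmf Yb (fst (outs w i)))))" by simp
  have "ent \<Omega> (\<lambda>w. snd (msg w)) \<le> expn \<Omega> (\<lambda>w. - log 2 (1 / real (card ?G)))"
  proof (rule ent_le[OF fin])
    have "(\<lambda>w. snd (msg w)) ` set_pmf \<Omega> \<subseteq> ?G" using msg_in by (auto simp: M_def)
    then have "card ((\<lambda>w. snd (msg w)) ` set_pmf \<Omega>) \<le> card ?G" by (intro card_mono) auto
    then show "(\<Sum>g\<in>(\<lambda>w. snd (msg w)) ` set_pmf \<Omega>. 1 / real (card ?G)) \<le> 1" using G by simp
  qed (use G in auto)
  then have 2: "ent \<Omega> (\<lambda>w. snd (msg w)) \<le> log 2 (card ?G)"
    using G index_set_bounds(4)[OF rates(2)] by (simp add: log_divide)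
  have 3: "ent \<Omega> (\<lambda>w. (msg w, ?y w)) \<ge> ent \<Omega> fst +
      (\<Sum>i<n. expn \<Omega> (\<lambda>w. - log 2 (pmf (output_kernel P W (str w i)) (fst (outs w i)))))"
    unfolding ent_chain[where J = \<Omega> and B = fst and n = n] by (intro add_left_mono sum_mono output_entropy_ge) simp
  have "log 2 (card M) = log 2 (card ?I) + log 2 (card ?G)"
    unfolding card_M(2) using I G index_set_bounds(4) rates by (simp add: log_mult)
  then show ?thesis
    using 1 2 3 fano unfolding ent_msg sum_subtractf by (simp add: algebra_simps)
qed

text \<open>Chain rule for H(M, \<Gamma>, S_e^n, S_hat^n). The messages and the earlier side
  information determine the strategy, so a kernel of the strategy is an admissible guess in Gibbs'
  inequality, although the true conditional law is more complicated. Exactness of the reconstruction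
  gives the value of \<open>ent_act\<close> subtracted against it.\<close>

lemma total_rate_bound:
  fixes Ka :: "('se \<Rightarrow> 'x) \<Rightarrow> ('se \<times> 's) pmf"
  assumes Ka: "\<And>w i. w \<in> set_pmf \<Omega> \<Longrightarrow> i < n \<Longrightarrow> act w i \<in> set_pmf (Ka (str w i))"
  shows "(\<Sum>i<n. expn \<Omega> (\<lambda>w. - log 2 (pmf P (act w i))) - expn \<Omega> (\<lambda>w. - log 2 (pmf (Ka (str w i)) (act w i))))
    \<le> log 2 (card M)"
proof -
  let ?a = "\<lambda>w. \<lambda>j\<in>{..<n}. act w j"
  have step: "ent \<Omega> (\<lambda>w. ((msg w, \<lambda>j\<in>{..<i}. act w j), act w i)) - ent \<Omega> (\<lambda>w. (msg w, \<lambda>j\<in>{..<i}. act w j))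
      \<le> expn \<Omega> (\<lambda>w. - log 2 (pmf (Ka (str w i)) (act w i)))" if i: "i < n" for i
  proof -
    let ?q = "\<lambda>(mg, r). pmf (Ka (strat f mg r i))"
    have st: "strat f (msg w) (\<lambda>j\<in>{..<i}. act w j) i = str w i" for w
      by (rule strat_cong) auto
    have "ent \<Omega> (\<lambda>w. ((msg w, \<lambda>j\<in>{..<i}. act w j), act w i)) - ent \<Omega> (\<lambda>w. (msg w, \<lambda>j\<in>{..<i}. act w j))
      \<le> expn \<Omega> (\<lambda>w. - log 2 (?q (msg w, \<lambda>j\<in>{..<i}. act w j) (act w i)))"
    proof (rule ent_cond_le[OF fin])
      show "0 < ?q (msg w, \<lambda>j\<in>{..<i}. act w j) (act w i)" if "w \<in> set_pmf \<Omega>" for w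
        using Ka[OF that i] by (simp add: st pmf_positive_iff)
      show "(\<Sum>a\<in>(\<lambda>w. act w i) ` set_pmf \<Omega>. ?q (msg w, \<lambda>j\<in>{..<i}. act w j) a) \<le> 1" for w
        using fin unfolding prod.case by (subst measure_measure_pmf_finite[symmetric]) auto
    qed auto
    then show ?thesis by (simp add: st)
  qed
  have "ent \<Omega> (\<lambda>w. (msg w, ?a w)) \<le> ent \<Omega> fst + (\<Sum>i<n. expn \<Omega> (\<lambda>w. - log 2 (pmf (Ka (str w i)) (act w i))))"
    unfolding ent_chain[where J = \<Omega> and B = fst and n = n] by (intro add_left_mono sum_mono step) simp
  moreover have "ent \<Omega> ?a \<le> ent \<Omega> (\<lambda>w. (msg w, ?a w))"
    using ent_map_le[OF fin, of snd "\<lambda>w. (msg w, ?a w)"] by simp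
  ultimately show ?thesis
    unfolding ent_msg ent_act sum_subtractf by simp
qed

end

abbreviation strategy_act ::
  "('se \<times> 's) pmf \<Rightarrow> ('x \<Rightarrow> 's \<Rightarrow> ('y \<times> 'z) pmf) \<Rightarrow> ('x \<Rightarrow> 'se \<Rightarrow> 'z \<Rightarrow> 's pmf) \<Rightarrow> ('se \<Rightarrow> 'x) \<Rightarrow> ('se \<times> 's) pmf" where
  "strategy_act P W V u \<equiv> map_pmf (\<lambda>(se, s, y, z, sh). (se, sh)) (strategy_kernel P W V u)"

context causal_code
begin

abbreviation "sample w i \<equiv>
  (fst (states w i), snd (states w i), str w i, fst (outs w i), snd (outs w i), recon w i)"

lemma act_component_law:
  assumes "i < n"
  shows "map_pmf (\<lambda>w. act w i) \<Omega> = P"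
proof -
  have "map_pmf (\<lambda>w. act w i) \<Omega> = map_pmf (\<lambda>a. a i) (map_pmf (\<lambda>w. \<lambda>i\<in>{..<n}. act w i) \<Omega>)"
    using assms by (simp add: map_pmf_comp)
  also have "\<dots> = P"
    unfolding act_law using assms by (simp add: Pi_pmf_component)
  finally show ?thesis .
qed

lemma single_letter:
  obtains Q :: "('se \<Rightarrow> 'x) pmf" and V where
    "bind_pmf Q (strategy_act P W V) = P"
    "\<And>d. expn (bind_pmf Q (strategy_kernel P W V)) (\<lambda>(se, s, y, z, sh). d s sh) =
       expn (code_law P W n R Rc f dec est) (\<lambda>(m, mh, se, s, sh). (\<Sum>i<n. d (s i) (sh i)) / real n)"
    "real n * expn (bind_pmf Q (\<lambda>u. map_pmf (Pair u) (strategy_act P W V u)))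
       (\<lambda>(u, a). log 2 (pmf (strategy_act P W V u) a / pmf P a)) \<le> log 2 (card M)"
    "(1 - err) * log 2 (card (index_set n R)) \<le> 1 + real n *
       expn (bind_pmf Q (\<lambda>u. map_pmf (Pair u) (output_kernel P W u)))
       (\<lambda>(u, y). log 2 (pmf (output_kernel P W u) y / pmf (bind_pmf Q (output_kernel P W)) y))"
proof -
  have "\<forall>i. \<exists>C. i < n \<longrightarrow> finite (set_pmf C) \<and> map_pmf (\<lambda>w. sample w i) \<Omega> = gen_law P W C"
  proof
    fix i show "\<exists>C. i < n \<longrightarrow> finite (set_pmf C) \<and> map_pmf (\<lambda>w. sample w i) \<Omega> = gen_law P W C"
    proof (cases "i < n")
      case True
      obtain C where "finite (set_pmf C)" "map_pmf (\<lambda>(mg, ses, yz, sh). (fst (ses i), snd (ses i), strat f mg ses i, fst (yz i), snd (yz i), sh i))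
         (process_law P W n f est M) = gen_law P W C"
        by (rule process_law_component[OF True finite_M])
      then show ?thesis by (intro exI[of _ C]) (simp add: \<Omega>_def case_prod_unfold)
    qed simp
  qed
  from choice[OF this] obtain Ci where "\<forall>i. i < n \<longrightarrow> finite (set_pmf (Ci i)) \<and> map_pmf (\<lambda>w. sample w i) \<Omega> = gen_law P W (Ci i)" ..
  then have Ci: "\<And>i. i < n \<Longrightarrow> finite (set_pmf (Ci i))" "\<And>i. i < n \<Longrightarrow> map_pmf (\<lambda>w. sample w i) \<Omega> = gen_law P W (Ci i)"
    by auto
  let ?T = "pmf_of_set {..<n}"
  have T: "{..<n} \<noteq> {}" "finite {..<n}" using n by auto
  \<comment> \<open>Random time: \<open>gen_law\<close> is linear in its last argument, so mixing
    over positions yields one single-letter law.\<close>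
  define C where "C = bind_pmf ?T Ci"
  define G where "G = gen_law P W C"
  define Q where "Q = map_pmf fst C"
  define V where "V = averaged_estimator C"
  let ?Ka = "strategy_act P W V" and ?Oy = "output_kernel P W"
  have G_eq: "G = bind_pmf ?T (\<lambda>i. map_pmf (\<lambda>w. sample w i) \<Omega>)"
  proof -
    have "G = bind_pmf ?T (\<lambda>i. gen_law P W (Ci i))"
      by (simp add: G_def C_def gen_law_def bind_assoc_pmf)
    also have "\<dots> = bind_pmf ?T (\<lambda>i. map_pmf (\<lambda>w. sample w i) \<Omega>)"
      by (intro bind_pmf_cong refl) (use Ci(2) T in auto)
    finally show ?thesis .
  qed
  have fC: "finite (set_pmf C)" unfolding C_def using Ci(1) T by auto
  have fQ: "finite (set_pmf Q)" unfolding Q_def using fC by simp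
  have fG: "finite (set_pmf G)" unfolding G_eq using fin T by auto
  have avg: "expn G \<phi> = (\<Sum>i<n. expn \<Omega> (\<lambda>w. \<phi> (sample w i))) / n" for \<phi>
    unfolding G_eq using T fin by (simp add: expn_bind expn_pmf_of_set)
  have avg': "(\<Sum>i<n. expn \<Omega> (\<lambda>w. \<phi> (sample w i))) = real n * expn G \<phi>" for \<phi>
    unfolding avg using n by simp
  have supp: "sample w i \<in> set_pmf G" if "w \<in> set_pmf \<Omega>" "i < n" for w i
    unfolding G_eq using that T by auto
  have key: "map_pmf (\<lambda>(se, s, u, y, z, sh). (se, s, u se, y, z, sh)) G =
     bind_pmf Q (\<lambda>u. map_pmf (\<lambda>(se, s, y, z, sh). (se, s, u se, y, z, sh)) (strategy_kernel P W V u))"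
    unfolding G_def Q_def V_def by (rule gen_law_averaged)
  have Ka_supp: "(se, sh) \<in> set_pmf (?Ka u)" if "(se, s, u, y, z, sh) \<in> set_pmf G" for se s u y z sh
    using gen_law_support[OF that[unfolded G_def]] by (force simp: V_def)
  have marg: "map_pmf (\<lambda>(se, s, u, y, z, sh). (se, sh)) G = P"
  proof -
    have "map_pmf (\<lambda>(se, s, u, y, z, sh). (se, sh)) G = bind_pmf ?T (\<lambda>i. map_pmf (\<lambda>w. act w i) \<Omega>)"
      unfolding G_eq by (simp add: map_bind_pmf map_pmf_comp)
    also have "\<dots> = bind_pmf ?T (\<lambda>i. P)"
      by (intro bind_pmf_cong refl act_component_law) (use T in auto)
    finally show ?thesis by simp
  qed
  have 1: "bind_pmf Q ?Ka = P"
  proof -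
    have "bind_pmf Q ?Ka = map_pmf (\<lambda>(se, s, x, y, z, sh). (se, sh))
        (bind_pmf Q (\<lambda>u. map_pmf (\<lambda>(se, s, y, z, sh). (se, s, u se, y, z, sh)) (strategy_kernel P W V u)))"
      by (simp add: map_bind_pmf map_pmf_comp case_prod_unfold)
    also have "\<dots> = P"
      unfolding key[symmetric] using marg by (simp add: map_pmf_comp case_prod_unfold)
    finally show ?thesis .
  qed
  have 2: "expn (bind_pmf Q (strategy_kernel P W V)) (\<lambda>(se, s, y, z, sh). d s sh) =
       expn (code_law P W n R Rc f dec est) (\<lambda>(m, mh, se, s, sh). (\<Sum>i<n. d (s i) (sh i)) / real n)" for d
  proof -
    have "expn (bind_pmf Q (strategy_kernel P W V)) (\<lambda>(se, s, y, z, sh). d s sh)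
      = expn (bind_pmf Q (\<lambda>u. map_pmf (\<lambda>(se, s, y, z, sh). (se, s, u se, y, z, sh)) (strategy_kernel P W V u)))
          (\<lambda>(se, s, x, y, z, sh). d s sh)"
      using fQ by (simp add: expn_bind case_prod_unfold)
    also have "\<dots> = expn G (\<lambda>(se, s, u, y, z, sh). d s sh)"
      unfolding key[symmetric] by (simp add: case_prod_unfold)
    also have "\<dots> = (\<Sum>i<n. expn \<Omega> (\<lambda>w. d (snd (states w i)) (recon w i))) / n"
      unfolding avg by simp
    also have "\<dots> = expn (code_law P W n R Rc f dec est) (\<lambda>(m, mh, se, s, sh). (\<Sum>i<n. d (s i) (sh i)) / real n)"
      unfolding code_law_\<Omega> using fin by (simp add: expn_sum)
    finally show ?thesis .
  qed
  have 3: "real n * expn (bind_pmf Q (\<lambda>u. map_pmf (Pair u) (?Ka u)))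
       (\<lambda>(u, a). log 2 (pmf (?Ka u) a / pmf P a)) \<le> log 2 (card M)"
  proof -
    \<comment> \<open>The constant strategy with value \<open>x\<close> stands in for
      \<open>u\<close>; by locality of the kernel nothing changes, and the function now depends only
      on the tuple in \<open>key\<close>.\<close>
    let ?\<psi> = "\<lambda>(se, s, x, y, z, sh). log 2 (pmf (?Ka (\<lambda>_. x)) (se, sh) / pmf P (se, sh))"
    have "expn (bind_pmf Q (\<lambda>u. map_pmf (Pair u) (?Ka u))) (\<lambda>(u, a). log 2 (pmf (?Ka u) a / pmf P a))
        = expn (bind_pmf Q (\<lambda>u. map_pmf (\<lambda>(se, s, y, z, sh). (se, s, u se, y, z, sh)) (strategy_kernel P W V u))) ?\<psi>"
      using fQ pmf_strategy_kernel_local[of P W V] by (simp add: expn_bind case_prod_unfold)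
    also have "\<dots> = expn G (\<lambda>(se, s, u, y, z, sh). log 2 (pmf (?Ka u) (se, sh) / pmf P (se, sh)))"
      unfolding key[symmetric] using pmf_strategy_kernel_local[of P W V] by (simp add: case_prod_unfold)
    also have "\<dots> = expn G (\<lambda>(se, s, u, y, z, sh). - log 2 (pmf P (se, sh)) - - log 2 (pmf (?Ka u) (se, sh)))"
    proof (rule expn_cong, clarify)
      fix se s u y z sh assume g: "(se, s, u, y, z, sh) \<in> set_pmf G"
      then have "(se, sh) \<in> set_pmf P"
        unfolding marg[symmetric] by force
      then show "log 2 (pmf (?Ka u) (se, sh) / pmf P (se, sh)) = - log 2 (pmf P (se, sh)) - - log 2 (pmf (?Ka u) (se, sh))"
        using Ka_supp[OF g] unfolding set_pmf_iff by (simp add: log_divide)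
    qed
    also have "real n * \<dots> = (\<Sum>i<n. expn \<Omega> (\<lambda>w. - log 2 (pmf P (act w i))) - expn \<Omega> (\<lambda>w. - log 2 (pmf (?Ka (str w i)) (act w i))))"
      unfolding avg'[symmetric] using fin by (simp add: expn_diff)
    also have "\<dots> \<le> log 2 (card M)"
    proof (rule total_rate_bound)
      fix w i assume "w \<in> set_pmf \<Omega>" "i < n"
      from Ka_supp[OF supp[OF this]] show "act w i \<in> set_pmf (?Ka (str w i))" .
    qed
    finally show ?thesis .
  qed
  have 4: "(1 - err) * log 2 (card (index_set n R)) \<le> 1 + real n *
       expn (bind_pmf Q (\<lambda>u. map_pmf (Pair u) (?Oy u))) (\<lambda>(u, y). log 2 (pmf (?Oy u) y / pmf (bind_pmf Q ?Oy) y))"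
  proof -
    let ?Yb = "bind_pmf Q ?Oy"
    have law: "map_pmf (\<lambda>(se, s, u, y, z, sh). (u, y)) G = bind_pmf Q (\<lambda>u. map_pmf (Pair u) (?Oy u))"
      unfolding G_def Q_def by (rule gen_law_input_output)
    have uy: "u \<in> set_pmf Q \<and> y \<in> set_pmf (?Oy u)" if "(se, s, u, y, z, sh) \<in> set_pmf G" for se s u y z sh
    proof -
      have "(u, y) \<in> set_pmf (map_pmf (\<lambda>(se, s, u, y, z, sh). (u, y)) G)" using that by force
      then show ?thesis unfolding law by auto
    qed
    have "expn (bind_pmf Q (\<lambda>u. map_pmf (Pair u) (?Oy u))) (\<lambda>(u, y). log 2 (pmf (?Oy u) y / pmf ?Yb y))
        = expn G (\<lambda>(se, s, u, y, z, sh). log 2 (pmf (?Oy u) y / pmf ?Yb y))"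
      unfolding law[symmetric] by (simp add: case_prod_unfold)
    also have "\<dots> = expn G (\<lambda>(se, s, u, y, z, sh). - log 2 (pmf ?Yb y) - - log 2 (pmf (?Oy u) y))"
    proof (rule expn_cong, clarify)
      fix se s u y z sh assume g: "(se, s, u, y, z, sh) \<in> set_pmf G"
      from uy[OF g] have "y \<in> set_pmf (?Oy u)" "y \<in> set_pmf ?Yb" by auto
      then have "pmf (?Oy u) y \<noteq> 0" "pmf ?Yb y \<noteq> 0" by (simp_all only: set_pmf_iff not_False_eq_True)
      then show "log 2 (pmf (?Oy u) y / pmf ?Yb y) = - log 2 (pmf ?Yb y) - - log 2 (pmf (?Oy u) y)"
        by (simp add: log_divide)
    qed
    also have "real n * \<dots> = (\<Sum>i<n. expn \<Omega> (\<lambda>w. - log 2 (pmf ?Yb (fst (outs w i)))) -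
        expn \<Omega> (\<lambda>w. - log 2 (pmf (?Oy (str w i)) (fst (outs w i)))))"
      unfolding avg'[symmetric] using fin by (simp add: expn_diff)
    finally have "real n * expn (bind_pmf Q (\<lambda>u. map_pmf (Pair u) (?Oy u))) (\<lambda>(u, y). log 2 (pmf (?Oy u) y / pmf ?Yb y))
        = (\<Sum>i<n. expn \<Omega> (\<lambda>w. - log 2 (pmf ?Yb (fst (outs w i)))) -
        expn \<Omega> (\<lambda>w. - log 2 (pmf (?Oy (str w i)) (fst (outs w i)))))" .
    moreover have "(1 - err) * log 2 (card (index_set n R)) \<le> 1 + (\<Sum>i<n. expn \<Omega> (\<lambda>w. - log 2 (pmf ?Yb (fst (outs w i)))) -
        expn \<Omega> (\<lambda>w. - log 2 (pmf (?Oy (str w i)) (fst (outs w i)))))"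
    proof (rule message_bound)
      fix w i assume "w \<in> set_pmf \<Omega>" "i < n"
      from uy[OF supp[OF this]] show "fst (outs w i) \<in> set_pmf ?Yb" by auto
    qed
    ultimately show ?thesis by simp
  qed
  show thesis by (rule that[OF 1 2 3 4])
qed

end

section \<open>Compactness of the single-letter laws\<close>

text \<open>Mutual information as a functional of input law and channel, the form in which
  continuity can be stated.\<close>

definition info_rate :: "'u pmf \<Rightarrow> ('u \<Rightarrow> 'a pmf) \<Rightarrow> real" where
  "info_rate Q K = expn (bind_pmf Q (\<lambda>u. map_pmf (Pair u) (K u))) (\<lambda>(u, a). log 2 (pmf (K u) a / pmf (bind_pmf Q K) a))"

lemma info_rate_map:
  assumes "finite (set_pmf Q)" "\<And>u. finite (set_pmf (K u))"
  shows "info_rate (map_pmf e Q) K = info_rate Q (\<lambda>u. K (e u))"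
  using assms by (simp add: info_rate_def bind_map_pmf expn_bind)

lemma achievable_single_letter_bounds:
  fixes P :: "('se::finite \<times> 's::finite) pmf" and W :: "'x::finite \<Rightarrow> 's \<Rightarrow> ('y::finite \<times> 'z::finite) pmf"
  assumes ach: "achievable P W d R Rc D" and \<epsilon>: "0 < \<epsilon>" "\<epsilon> < 1"
  shows "0 \<le> R \<and> 0 \<le> Rc \<and> (\<exists>Q V. bind_pmf Q (strategy_act P W V) = P \<and>
    expn (bind_pmf Q (strategy_kernel P W V)) (\<lambda>(se, s, y, z, sh). d s sh) \<le> D \<and>
    info_rate Q (strategy_act P W V) \<le> R + Rc \<and> (1 - \<epsilon>) * R \<le> info_rate Q (output_kernel P W) + \<epsilon>)"
proof -
  define good where "good = (\<lambda>n. \<exists>f dec est.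
        is_code n R Rc dec est \<and>
        (let J = code_law P W n R Rc f dec est in
           measure_pmf.prob J {(m, mh, se, s, sh). m \<noteq> mh} \<le> \<epsilon> \<and>
           measure_pmf.expectation J (\<lambda>(m, mh, se, s, sh). (\<Sum>i<n. d (s i) (sh i)) / real n) \<le> D \<and>
           map_pmf (\<lambda>(m, mh, se, s, sh). \<lambda>i\<in>{..<n}. (se i, sh i)) J = prod_law n (\<lambda>_. P)))"
  have "\<forall>\<^sub>F n in sequentially. good n"
    using ach[unfolded achievable_def, rule_format, OF \<epsilon>(1)] unfolding good_def .
  \<comment> \<open>Two bits are to be absorbed into n \<epsilon>: one from Fano's inequality, one
    from rounding the number of messages.\<close>
  moreover have "\<forall>\<^sub>F n in sequentially. 2 / \<epsilon> \<le> real n"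
    using filterlim_real_sequentially unfolding filterlim_at_top by blast
  ultimately have "\<forall>\<^sub>F n in sequentially. good n \<and> 2 / \<epsilon> \<le> real n"
    by (rule eventually_conj)
  then have "\<exists>n. good n \<and> 2 / \<epsilon> \<le> real n"
    by (rule eventually_happens'[OF sequentially_bot])
  then obtain n where good: "good n" and n2: "2 / \<epsilon> \<le> real n" by auto
  have "0 < 2 / \<epsilon>" using \<epsilon> by simp
  then have n0: "0 < n" using n2 by (cases n) auto
  from good[unfolded good_def] obtain f dec est where code: "is_code n R Rc dec est"
    and err: "measure_pmf.prob (code_law P W n R Rc f dec est) {(m, mh, se, s, sh). m \<noteq> mh} \<le> \<epsilon>"
    and dist: "expn (code_law P W n R Rc f dec est) (\<lambda>(m, mh, se, s, sh). (\<Sum>i<n. d (s i) (sh i)) / real n) \<le> D"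
    and exact: "map_pmf (\<lambda>(m, mh, se, s, sh). \<lambda>i\<in>{..<n}. (se i, sh i)) (code_law P W n R Rc f dec est) = prod_law n (\<lambda>_. P)"
    by (auto simp: Let_def)
  interpret causal_code P W n R Rc f dec est
    by unfold_locales (rule code n0 exact)+
  obtain Q V where QV: "bind_pmf Q (strategy_act P W V) = P"
    "\<And>d. expn (bind_pmf Q (strategy_kernel P W V)) (\<lambda>(se, s, y, z, sh). d s sh) =
       expn (code_law P W n R Rc f dec est) (\<lambda>(m, mh, se, s, sh). (\<Sum>i<n. d (s i) (sh i)) / real n)"
    "real n * expn (bind_pmf Q (\<lambda>u. map_pmf (Pair u) (strategy_act P W V u)))
       (\<lambda>(u, a). log 2 (pmf (strategy_act P W V u) a / pmf P a)) \<le> log 2 (card M)"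
    "(1 - err) * log 2 (card (index_set n R)) \<le> 1 + real n *
       expn (bind_pmf Q (\<lambda>u. map_pmf (Pair u) (output_kernel P W u)))
       (\<lambda>(u, y). log 2 (pmf (output_kernel P W u) y / pmf (bind_pmf Q (output_kernel P W)) y))"
    by (rule single_letter) (rule that; assumption)
  let ?I = "index_set n R" and ?G = "index_set n Rc"
  have I: "1 \<le> real (card ?I)" and G: "1 \<le> real (card ?G)"
    using index_set_bounds(1)[OF rates(1), of n] index_set_bounds(1)[OF rates(2), of n] by linarith+
  have lI: "log 2 (card ?I) \<le> real n * R" and lG: "log 2 (card ?G) \<le> real n * Rc"
    using index_set_bounds(2)[OF rates(1), of n] index_set_bounds(2)[OF rates(2), of n] I G
    by (simp_all add: log_le_iff)
  have lI': "real n * R - 1 \<le> log 2 (card ?I)"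
  proof -
    have "log 2 (2 powr (real n * R) / 2) \<le> log 2 (card ?I)"
      using index_set_bounds(3)[OF rates(1), of n] I by (intro log_mono) auto
    then show ?thesis by (simp add: log_divide)
  qed
  have "real n * info_rate Q (strategy_act P W V) \<le> log 2 (card M)"
    using QV(3) unfolding info_rate_def QV(1) .
  also have "\<dots> = log 2 (card ?I) + log 2 (card ?G)"
    unfolding card_M(2) using I G by (intro log_mult_pos) auto
  also have "\<dots> \<le> real n * (R + Rc)" using lI lG by (simp add: distrib_left)
  finally have Ia: "info_rate Q (strategy_act P W V) \<le> R + Rc" using n by simp
  have "(1 - \<epsilon>) * (real n * R - 1) \<le> (1 - \<epsilon>) * log 2 (card ?I)"
    using lI' \<epsilon> by (intro mult_left_mono) auto
  also have "\<dots> \<le> (1 - err) * log 2 (card ?I)"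
    using err I unfolding err_def[symmetric] by (intro mult_right_mono) auto
  also have "\<dots> \<le> 1 + real n * info_rate Q (output_kernel P W)"
    using QV(4) unfolding info_rate_def .
  finally have "real n * ((1 - \<epsilon>) * R) \<le> 2 + real n * info_rate Q (output_kernel P W)"
    using \<epsilon> by (simp add: algebra_simps)
  also have "2 \<le> real n * \<epsilon>" using n2 \<epsilon> by (simp add: field_simps)
  finally have "real n * ((1 - \<epsilon>) * R) \<le> real n * (info_rate Q (output_kernel P W) + \<epsilon>)"
    by (simp add: distrib_left)
  then have "(1 - \<epsilon>) * R \<le> info_rate Q (output_kernel P W) + \<epsilon>" using n by simp
  then show ?thesis
    using rates QV(1) QV(2)[of d] dist Ia by (intro conjI exI[of _ Q] exI[of _ V]) auto
qed

section \<open>Limits of laws on finite alphabets\<close>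

definition pconv :: "(nat \<Rightarrow> 'a pmf) \<Rightarrow> 'a pmf \<Rightarrow> bool" where
  "pconv p q \<longleftrightarrow> (\<forall>a. (\<lambda>k. pmf (p k) a) \<longlonglongrightarrow> pmf q a)"

lemma pconv_const: "pconv (\<lambda>_. p) p"
  by (simp add: pconv_def)

lemma expn_UNIV: "expn p g = (\<Sum>a\<in>UNIV. pmf p a * g a)" for p :: "'a::finite pmf"
  by (rule expn_superset) auto

lemma pconv_bind:
  fixes Q :: "nat \<Rightarrow> 'a::finite pmf"
  assumes "pconv Q Q'" "\<And>a. pconv (\<lambda>k. K k a) (K' a)"
  shows "pconv (\<lambda>k. bind_pmf (Q k) (K k)) (bind_pmf Q' K')"
  using assms unfolding pconv_def pmf_bind expn_UNIV by (auto intro!: tendsto_intros)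

lemma pconv_map:
  fixes Q :: "nat \<Rightarrow> 'a::finite pmf"
  shows "pconv Q Q' \<Longrightarrow> pconv (\<lambda>k. map_pmf h (Q k)) (map_pmf h Q')"
  unfolding map_pmf_def by (intro pconv_bind pconv_const)

lemma pconv_expn:
  fixes Q :: "nat \<Rightarrow> 'a::finite pmf"
  shows "pconv Q Q' \<Longrightarrow> (\<lambda>k. expn (Q k) g) \<longlonglongrightarrow> expn Q' g"
  unfolding pconv_def expn_UNIV by (auto intro!: tendsto_intros)

lemma pconv_unique: "pconv p q \<Longrightarrow> pconv p q' \<Longrightarrow> q = q'"
  unfolding pconv_def by (auto intro!: pmf_eqI dest: LIMSEQ_unique)

lemma pconv_subseq: "pconv p q \<Longrightarrow> strict_mono r \<Longrightarrow> pconv (\<lambda>k. p (r k)) q"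
  unfolding pconv_def using LIMSEQ_subseq_LIMSEQ[of _ _ r] by (auto simp: comp_def)

text \<open>Bolzano-Weierstrass for the vector of all masses. The finite index makes a kernel a
  single point, so that one subsequence serves all its rows.\<close>

lemma pmf_seq_compact:
  fixes p :: "nat \<Rightarrow> 'i::finite \<Rightarrow> 'a::finite pmf"
  obtains r q where "strict_mono (r :: nat \<Rightarrow> nat)" "\<And>i. pconv (\<lambda>k. p (r k) i) (q i)"
proof -
  define v where "v = (\<lambda>k. (\<chi> ia. pmf (p k (fst ia)) (snd ia)) :: real ^ ('i \<times> 'a))"
  have "range v \<subseteq> cbox 0 1"
    by (auto simp: v_def mem_box_cart pmf_le_1)
  then have "bounded (range v)" by (rule bounded_subset[OF bounded_cbox])
  then obtain l r where r: "strict_mono (r :: nat \<Rightarrow> nat)" and l: "(v \<circ> r) \<longlonglongrightarrow> l"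
    using bounded_imp_convergent_subsequence by blast
  have lim: "(\<lambda>k. pmf (p (r k) i) a) \<longlonglongrightarrow> l $ (i, a)" for i a
    using tendsto_vec_nth[OF l, of "(i, a)"] by (simp add: v_def)
  have "\<exists>q. \<forall>a. pmf q a = l $ (i, a)" for i
  proof -
    have "\<exists>q. \<forall>a. pmf q a = (if a \<in> UNIV then l $ (i, a) else 0)"
    proof (rule exists_pmf)
      show "0 \<le> l $ (i, a)" for a
        using lim[of i a] by (rule LIMSEQ_le_const) auto
      have "(\<lambda>k. \<Sum>a\<in>UNIV. pmf (p (r k) i) a) \<longlonglongrightarrow> (\<Sum>a\<in>UNIV. l $ (i, a))"
        by (intro tendsto_sum lim)
      moreover have "(\<Sum>a\<in>UNIV. pmf (p (r k) i) a) = 1" for k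
        by (rule sum_pmf_eq_1) auto
      ultimately show "(\<Sum>a\<in>UNIV. l $ (i, a)) = 1"
        using LIMSEQ_unique[OF _ tendsto_const] by simp
    qed simp
    then show ?thesis by simp
  qed
  then have "\<forall>i. \<exists>q. \<forall>a. pmf q a = l $ (i, a)" by blast
  from choice[OF this] obtain q where "\<And>i a. pmf (q i) a = l $ (i, a)" by blast
  then have "pconv (\<lambda>k. p (r k) i) (q i)" for i
    using lim by (simp add: pconv_def)
  then show thesis using r that by blast
qed

text \<open>Since \<open>log 2 0 = 0\<close>, \<open>xlog\<close> is continuous on \<open>[0, \<infinity>)\<close>.\<close>

definition xlog :: "real \<Rightarrow> real" where "xlog t = t * log 2 t"

lemma tendsto_xlog:
  assumes "(f \<longlongrightarrow> l) F" "\<And>k. 0 \<le> f k" "0 \<le> l"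
  shows "((\<lambda>k. xlog (f k)) \<longlongrightarrow> xlog l) F"
proof (cases "l = 0")
  case False
  then show ?thesis
    unfolding xlog_def using assms by (intro tendsto_mult tendsto_log tendsto_const) auto
next
  case True
  \<comment> \<open>From ln x \<le> x at x = 1 / sqrt t; the square root leaves a bound that still
    tends to 0 with t.\<close>
  have bound: "\<bar>xlog t\<bar> \<le> 2 * sqrt t / ln 2" if t: "0 \<le> t" "t \<le> 1" for t
  proof (cases "t = 0")
    case False
    then have s: "0 < sqrt t" using t by simp
    have "ln (1 / sqrt t) \<le> 1 / sqrt t"
      using ln_le_minus_one[of "1 / sqrt t"] s by simp
    then have "- ln t \<le> 2 / sqrt t"
      using s t False by (simp add: ln_div ln_sqrt)
    then have "t * (- ln t) \<le> t * (2 / sqrt t)"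
      using t by (intro mult_left_mono) auto
    also have "\<dots> = 2 * sqrt t"
      using t s by (simp add: field_simps)
    finally have "t * (- ln t) / ln 2 \<le> 2 * sqrt t / ln 2"
      by (intro divide_right_mono) auto
    moreover have "xlog t = - (t * (- ln t) / ln 2)" by (simp add: xlog_def log_def)
    moreover have "0 \<le> t * (- ln t) / ln 2"
      using t False by (intro divide_nonneg_nonneg mult_nonneg_nonneg) auto
    ultimately show ?thesis by simp
  qed (simp add: xlog_def)
  have f0: "(f \<longlongrightarrow> 0) F" using assms(1) True by simp
  have "\<forall>\<^sub>F k in F. f k < 1" using f0 by (rule order_tendstoD) simp
  then have "\<forall>\<^sub>F k in F. norm (xlog (f k)) \<le> 2 * sqrt (f k) / ln 2"
    by eventually_elim (use bound assms(2) in auto)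
  moreover have "((\<lambda>k. 2 * sqrt (f k) / ln 2) \<longlongrightarrow> 2 * sqrt 0 / ln 2) F"
    by (intro tendsto_intros f0) auto
  then have "((\<lambda>k. 2 * sqrt (f k) / ln 2) \<longlongrightarrow> 0) F" by simp
  ultimately have "((\<lambda>k. xlog (f k)) \<longlongrightarrow> 0) F"
    by (rule Lim_null_comparison)
  then show ?thesis by (simp add: True xlog_def)
qed

text \<open>Output entropy minus conditional output entropy. This form has no quotient of masses,
  whose logarithm could not be controlled where the output mass tends to 0.\<close>

lemma info_rate_xlog:
  fixes Q :: "'u::finite pmf" and K :: "'u \<Rightarrow> 'a::finite pmf"
  shows "info_rate Q K = (\<Sum>u\<in>UNIV. pmf Q u * (\<Sum>a\<in>UNIV. xlog (pmf (K u) a))) - (\<Sum>a\<in>UNIV. xlog (pmf (bind_pmf Q K) a))"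
proof -
  have b: "pmf (bind_pmf Q K) a = (\<Sum>u\<in>UNIV. pmf Q u * pmf (K u) a)" for a
    by (simp add: pmf_bind expn_UNIV)
  have "info_rate Q K = (\<Sum>u\<in>UNIV. pmf Q u * (\<Sum>a\<in>UNIV. pmf (K u) a * log 2 (pmf (K u) a / pmf (bind_pmf Q K) a)))"
    unfolding info_rate_def by (simp add: expn_bind) (simp add: expn_UNIV)
  also have "\<dots> = (\<Sum>u\<in>UNIV. \<Sum>a\<in>UNIV. pmf Q u * xlog (pmf (K u) a) - pmf Q u * pmf (K u) a * log 2 (pmf (bind_pmf Q K) a))"
    unfolding sum_distrib_left
  proof (intro sum.cong refl)
    fix u a
    show "pmf Q u * (pmf (K u) a * log 2 (pmf (K u) a / pmf (bind_pmf Q K) a)) =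
      pmf Q u * xlog (pmf (K u) a) - pmf Q u * pmf (K u) a * log 2 (pmf (bind_pmf Q K) a)"
    proof (cases "pmf Q u = 0 \<or> pmf (K u) a = 0")
      case False
      then have "a \<in> set_pmf (bind_pmf Q K)" by (auto simp: set_pmf_iff)
      then have "pmf (bind_pmf Q K) a \<noteq> 0" by (simp only: set_pmf_iff not_False_eq_True)
      then show ?thesis using False by (simp add: xlog_def log_divide algebra_simps)
    qed (auto simp: xlog_def)
  qed
  also have "\<dots> = (\<Sum>u\<in>UNIV. pmf Q u * (\<Sum>a\<in>UNIV. xlog (pmf (K u) a))) - (\<Sum>a\<in>UNIV. xlog (pmf (bind_pmf Q K) a))"
  proof -
    have "(\<Sum>u\<in>UNIV. \<Sum>a\<in>UNIV. pmf Q u * pmf (K u) a * log 2 (pmf (bind_pmf Q K) a)) = (\<Sum>a\<in>UNIV. xlog (pmf (bind_pmf Q K) a))"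
      by (subst sum.swap) (simp add: xlog_def b sum_distrib_right)
    then show ?thesis by (simp add: sum_subtractf sum_distrib_left)
  qed
  finally show ?thesis .
qed

lemma pconv_info_rate:
  fixes Q :: "nat \<Rightarrow> 'u::finite pmf" and K :: "nat \<Rightarrow> 'u \<Rightarrow> 'a::finite pmf"
  assumes "pconv Q Q'" "\<And>u. pconv (\<lambda>k. K k u) (K' u)"
  shows "(\<lambda>k. info_rate (Q k) (K k)) \<longlonglongrightarrow> info_rate Q' K'"
  unfolding info_rate_xlog
  using assms pconv_bind[OF assms]
  by (intro tendsto_intros tendsto_xlog) (auto simp: pconv_def)

text \<open>Each approximating triple brings its own strategy law and estimator. Both range over
  compact sets independent of the blocklength, so a limit exists along a subsequence, and all
  constraints, including exactness, survive in it.\<close>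

lemma converse_part:
  fixes P :: "('se::finite \<times> 's::finite) pmf" and W :: "'x::finite \<Rightarrow> 's \<Rightarrow> ('y::finite \<times> 'z::finite) pmf"
  assumes "(R, Rc) \<in> capacity_distortion_region P W d D"
  obtains Q V where "0 \<le> R" "0 \<le> Rc" "bind_pmf Q (strategy_act P W V) = P"
    "expn (bind_pmf Q (strategy_kernel P W V)) (\<lambda>(se, s, y, z, sh). d s sh) \<le> D"
    "info_rate Q (strategy_act P W V) \<le> R + Rc" "R \<le> info_rate Q (output_kernel P W)"
proof -
  from assms obtain x where x: "\<And>k::nat. x k \<in> {(R', Rc', D'). achievable P W d R' Rc' D'}" "x \<longlonglongrightarrow> (R, Rc, D)"
    by (auto simp: capacity_distortion_region_def closure_sequential)
  define Rk where "Rk = (\<lambda>k. fst (x k))"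
  define Rck where "Rck = (\<lambda>k. fst (snd (x k)))"
  define Dk where "Dk = (\<lambda>k. snd (snd (x k)))"
  have ach: "achievable P W d (Rk k) (Rck k) (Dk k)" for k
    using x(1)[of k] by (simp add: Rk_def Rck_def Dk_def case_prod_unfold)
  have lim: "Rk \<longlonglongrightarrow> R" "Rck \<longlonglongrightarrow> Rc" "Dk \<longlonglongrightarrow> D"
    unfolding Rk_def Rck_def Dk_def
    using tendsto_fst[OF x(2)] tendsto_fst[OF tendsto_snd[OF x(2)]] tendsto_snd[OF tendsto_snd[OF x(2)]] by simp_all
  \<comment> \<open>Shifted by 2 so that already the first value is strictly below 1.\<close>
  define \<epsilon> where "\<epsilon> = (\<lambda>k. inverse (real (Suc (Suc k))))"
  have \<epsilon>: "0 < \<epsilon> k" "\<epsilon> k < 1" for k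
    by (simp_all add: \<epsilon>_def inverse_less_1_iff)
  have \<epsilon>_lim: "\<epsilon> \<longlonglongrightarrow> 0"
    unfolding \<epsilon>_def by (rule LIMSEQ_Suc[OF LIMSEQ_inverse_real_of_nat])
  note bounds = achievable_single_letter_bounds[OF ach \<epsilon>]
  have R0: "0 \<le> R" by (rule LIMSEQ_le_const[OF lim(1)]) (use bounds in blast)
  have Rc0: "0 \<le> Rc" by (rule LIMSEQ_le_const[OF lim(2)]) (use bounds in blast)
  have "\<forall>k. \<exists>QV. bind_pmf (fst QV) (strategy_act P W (snd QV)) = P \<and>
    expn (bind_pmf (fst QV) (strategy_kernel P W (snd QV))) (\<lambda>(se, s, y, z, sh). d s sh) \<le> Dk k \<and>
    info_rate (fst QV) (strategy_act P W (snd QV)) \<le> Rk k + Rck k \<and>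
    (1 - \<epsilon> k) * Rk k \<le> info_rate (fst QV) (output_kernel P W) + \<epsilon> k"
  proof
    fix k
    from bounds[of k k] show "\<exists>QV. bind_pmf (fst QV) (strategy_act P W (snd QV)) = P \<and>
    expn (bind_pmf (fst QV) (strategy_kernel P W (snd QV))) (\<lambda>(se, s, y, z, sh). d s sh) \<le> Dk k \<and>
    info_rate (fst QV) (strategy_act P W (snd QV)) \<le> Rk k + Rck k \<and>
    (1 - \<epsilon> k) * Rk k \<le> info_rate (fst QV) (output_kernel P W) + \<epsilon> k"
      by (elim conjE exE, intro exI[of _ "(_, _)"]) (simp only: fst_conv snd_conv simp_thms)
  qed
  from choice[OF this] obtain QV where QV:
    "\<And>k. bind_pmf (fst (QV k)) (strategy_act P W (snd (QV k))) = P"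
    "\<And>k. expn (bind_pmf (fst (QV k)) (strategy_kernel P W (snd (QV k)))) (\<lambda>(se, s, y, z, sh). d s sh) \<le> Dk k"
    "\<And>k. info_rate (fst (QV k)) (strategy_act P W (snd (QV k))) \<le> Rk k + Rck k"
    "\<And>k. (1 - \<epsilon> k) * Rk k \<le> info_rate (fst (QV k)) (output_kernel P W) + \<epsilon> k"
    by blast
  \<comment> \<open>The strategy law is a family with one member, the estimator a family indexed by
    its three arguments; the second extraction refines the first.\<close>
  obtain r1 q where r1: "strict_mono r1" and q: "\<And>i::unit. pconv (\<lambda>k. fst (QV (r1 k))) (q i)"
    using pmf_seq_compact[of "\<lambda>k (_::unit). fst (QV k)"] by blast
  obtain r2 v where r2: "strict_mono r2" and
    v: "\<And>i. pconv (\<lambda>k. (\<lambda>(x, se, z). snd (QV (r1 (r2 k))) x se z) i) (v i)"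
    using pmf_seq_compact[of "\<lambda>k (x, se, z). snd (QV (r1 k)) x se z"] by blast
  define Q where "Q = q ()"
  define V where "V = (\<lambda>x se z. v (x, se, z))"
  define r where "r = (\<lambda>k. r1 (r2 k))"
  have r: "strict_mono r" unfolding r_def using r1 r2 by (simp add: strict_mono_def)
  define Qk where "Qk = (\<lambda>k. fst (QV (r k)))"
  define Vk where "Vk = (\<lambda>k. snd (QV (r k)))"
  have cQ: "pconv Qk Q"
    unfolding Q_def Qk_def r_def by (rule pconv_subseq[OF q r2])
  have cV: "pconv (\<lambda>k. Vk k x se z) (V x se z)" for x se z
    using v[of "(x, se, z)"] by (simp add: V_def Vk_def r_def)
  have cK: "pconv (\<lambda>k. strategy_kernel P W (Vk k) u) (strategy_kernel P W V u)" for u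
    unfolding channel_kernel_def by (intro pconv_bind pconv_const pconv_map cV)
  have cA: "pconv (\<lambda>k. strategy_act P W (Vk k) u) (strategy_act P W V u)" for u
    by (intro pconv_map cK)
  have sub: "(\<lambda>k. Rk (r k)) \<longlonglongrightarrow> R" "(\<lambda>k. Rck (r k)) \<longlonglongrightarrow> Rc" "(\<lambda>k. Dk (r k)) \<longlonglongrightarrow> D" "(\<lambda>k. \<epsilon> (r k)) \<longlonglongrightarrow> 0"
    using LIMSEQ_subseq_LIMSEQ[OF _ r] lim \<epsilon>_lim by (auto simp: comp_def)
  have "pconv (\<lambda>k. bind_pmf (Qk k) (strategy_act P W (Vk k))) (bind_pmf Q (strategy_act P W V))"
    by (intro pconv_bind cQ cA)
  then have 1: "bind_pmf Q (strategy_act P W V) = P"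
    unfolding Qk_def Vk_def QV(1) using pconv_unique pconv_const by blast
  have 2: "expn (bind_pmf Q (strategy_kernel P W V)) (\<lambda>(se, s, y, z, sh). d s sh) \<le> D"
    using pconv_expn[OF pconv_bind[OF cQ cK]] sub(3) by (rule LIMSEQ_le) (auto simp: Qk_def Vk_def QV(2))
  have 3: "info_rate Q (strategy_act P W V) \<le> R + Rc"
    using pconv_info_rate[OF cQ cA] tendsto_add[OF sub(1,2)] by (rule LIMSEQ_le) (auto simp: Qk_def Vk_def QV(3))
  have "(\<lambda>k. (1 - \<epsilon> (r k)) * Rk (r k)) \<longlonglongrightarrow> (1 - 0) * R"
    by (intro tendsto_intros sub)
  moreover have "(\<lambda>k. info_rate (Qk k) (output_kernel P W) + \<epsilon> (r k)) \<longlonglongrightarrow> info_rate Q (output_kernel P W) + 0"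
    by (intro tendsto_intros sub pconv_info_rate cQ pconv_const)
  ultimately have "(1 - 0) * R \<le> info_rate Q (output_kernel P W) + 0"
    by (rule LIMSEQ_le) (auto simp: Qk_def QV(4))
  then have 4: "R \<le> info_rate Q (output_kernel P W)" by simp
  show thesis by (rule that[OF R0 Rc0 1 2 3 4])
qed

theorem theorem2:
  fixes P :: "('se::finite \<times> 's::finite) pmf"
    and W :: "'x::finite \<Rightarrow> 's \<Rightarrow> ('y::finite \<times> 'z::finite) pmf"
    and d :: "'s \<Rightarrow> 's \<Rightarrow> real"
    and D :: real
  assumes "\<And>s sh. 0 \<le> d s sh"
    and "0 \<le> D"
  shows "capacity_distortion_region P W d D =
    {(R, Rc). 0 \<le> R \<and> 0 \<le> Rc \<and>
       (\<exists>J \<in> P_DE' P W.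
          R \<le> mutual_info J (\<lambda>(se, s, u, x, y, z, sh). u) (\<lambda>(se, s, u, x, y, z, sh). y) \<and>
          R + Rc \<ge> mutual_info J (\<lambda>(se, s, u, x, y, z, sh). u) (\<lambda>(se, s, u, x, y, z, sh). (sh, se)) \<and>
          D \<ge> measure_pmf.expectation J (\<lambda>(se, s, u, x, y, z, sh). d s sh))}"
proof (intro subset_antisym subsetI)
  fix RRc assume "RRc \<in> capacity_distortion_region P W d D"
  then obtain R Rc where RRc: "RRc = (R, Rc)" and reg: "(R, Rc) \<in> capacity_distortion_region P W d D"
    by (cases RRc) auto
  obtain Q V where QV: "0 \<le> R" "0 \<le> Rc" "bind_pmf Q (strategy_act P W V) = P"
    "expn (bind_pmf Q (strategy_kernel P W V)) (\<lambda>(se, s, y, z, sh). d s sh) \<le> D"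
    "info_rate Q (strategy_act P W V) \<le> R + Rc" "R \<le> info_rate Q (output_kernel P W)"
    using converse_part[OF reg] .
  \<comment> \<open>Strategies are numbered to fit the alphabet \<open>nat\<close> of the auxiliary
    variable; the decoding \<open>from_nat\<close> is then itself the required function x(u,
    s_e).\<close>
  define Q' where "Q' = map_pmf to_nat Q"
  define J where "J = single_letter_law P W Q' from_nat V"
  have fin: "finite (set_pmf Q')" by (simp add: Q'_def)
  note sl = single_letter_quantities[OF fin J_def]
  have K: "channel_kernel P W from_nat V (to_nat u) = strategy_kernel P W V u" for u :: "'se \<Rightarrow> 'x"
    by (simp add: channel_kernel_def)
  have 1: "map_pmf (\<lambda>(se, s, u, x, y, z, sh). (se, sh)) J = P"
    using QV(3) unfolding sl(2) by (simp add: Q'_def bind_map_pmf K)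
  have 2: "mutual_info J (\<lambda>(se, s, u, x, y, z, sh). u) (\<lambda>(se, s, u, x, y, z, sh). y) = info_rate Q (output_kernel P W)"
    unfolding sl(3) info_rate_def[symmetric] Q'_def by (subst info_rate_map) (auto simp: K channel_kernel_output)
  have 3: "mutual_info J (\<lambda>(se, s, u, x, y, z, sh). u) (\<lambda>(se, s, u, x, y, z, sh). (sh, se)) = info_rate Q (strategy_act P W V)"
    unfolding sl(4) info_rate_def[symmetric] Q'_def by (subst info_rate_map) (auto simp: K)
  have 4: "expn J (\<lambda>(se, s, u, x, y, z, sh). d s sh) = expn (bind_pmf Q (strategy_kernel P W V)) (\<lambda>(se, s, y, z, sh). d s sh)"
    unfolding sl(5) by (simp add: Q'_def bind_map_pmf K)
  have "J \<in> P_DE' P W"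
    unfolding P_DE'_def P_tilde_def using 1 fin J_def by auto
  then show "RRc \<in> {(R, Rc). 0 \<le> R \<and> 0 \<le> Rc \<and>
       (\<exists>J \<in> P_DE' P W.
          R \<le> mutual_info J (\<lambda>(se, s, u, x, y, z, sh). u) (\<lambda>(se, s, u, x, y, z, sh). y) \<and>
          R + Rc \<ge> mutual_info J (\<lambda>(se, s, u, x, y, z, sh). u) (\<lambda>(se, s, u, x, y, z, sh). (sh, se)) \<and>
          D \<ge> measure_pmf.expectation J (\<lambda>(se, s, u, x, y, z, sh). d s sh))}"
    unfolding RRc mem_Collect_eq prod.case using QV
    by (intro conjI bexI[of _ J]) (simp_all only: 2 3 4)
next
  fix RRc assume "RRc \<in> {(R, Rc). 0 \<le> R \<and> 0 \<le> Rc \<and>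
       (\<exists>J \<in> P_DE' P W.
          R \<le> mutual_info J (\<lambda>(se, s, u, x, y, z, sh). u) (\<lambda>(se, s, u, x, y, z, sh). y) \<and>
          R + Rc \<ge> mutual_info J (\<lambda>(se, s, u, x, y, z, sh). u) (\<lambda>(se, s, u, x, y, z, sh). (sh, se)) \<and>
          D \<ge> measure_pmf.expectation J (\<lambda>(se, s, u, x, y, z, sh). d s sh))}"
  then obtain R Rc J where "RRc = (R, Rc)" "0 \<le> R" "0 \<le> Rc" "J \<in> P_DE' P W"
    "R \<le> mutual_info J (\<lambda>(se, s, u, x, y, z, sh). u) (\<lambda>(se, s, u, x, y, z, sh). y)"
    "mutual_info J (\<lambda>(se, s, u, x, y, z, sh). u) (\<lambda>(se, s, u, x, y, z, sh). (sh, se)) \<le> R + Rc"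
    "expn J (\<lambda>(se, s, u, x, y, z, sh). d s sh) \<le> D"
    by blast
  then show "RRc \<in> capacity_distortion_region P W d D"
    using direct_part[OF assms(1)] by simp
qed

end
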